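(* Let $X\subseteq\mathbb C^n$ be an open subset, $f$ a non-invertible, not identically zero holomorphic function on $X$, and $\alpha\in\mathbb Q$. If $\nu_{1,\alpha-1}<\nu_{1,\alpha}$ and $\underset{s=-\alpha}{\mathrm{ord}}Z_f=\nu_{1,\alpha}$, then $\mathcal D_X\cdot f^{-\alpha}\ne\mathcal D_X\cdot f^{-\alpha+1}$.
   Context: Throughout the paper $X$ is assumed to be a quasi-projective complex manifold. $\mathcal D_X\cdot f^{-\alpha}$ and $\mathcal D_X\cdot f^{-\alpha+1}$ are the $\mathcal D_X$-submodules generated by $f^{-\alpha}$ and $f\cdot f^{-\alpha}$ in $(\mathcal O_X)_f\cdot f^{-\alpha}$, where $\xi\cdot(hf^{-\alpha})=(\xi(h)-\alpha h\,\xi(f)/f)f^{-\alpha}$ for vector fields $\xi$. For $j\ge1$, $b^{(j)}(s)$ is the monic polynomial of minimal degree with $P(s)f^{s+j}=b^{(j)}(s)f^s$ for some $P(s)\in\mathcal D_X[s]$, and $\nu_{1,\beta}:=\lim_{j\to\infty}\operatorname{mult}_{s=-\beta}b^{(j)}(s)$ (the multiplicities of $-\beta$ as a root are non-decreasing in $j$ and bounded). Archimedean zeta function: for a compactly supported smooth function $\varphi$ on $\mathbb C^n$ with support in $X$, $Z_f(\varphi;s)$ is the meromorphic extension to $\mathbb C$ of $s\mapsto\int_X|f|^{2s}\varphi\,d\mu(x)$, $\mathrm{Re}(s)>0$, with $d\mu$ Lebesgue measure. $\mathrm{ord}_{s=-\alpha}Z_f:=\max_\varphi\mathrm{ord}_{s=-\alpha}Z_f(\varphi;s)$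 is the (maximal) pole order at $s=-\alpha$ ($0$ if there is no pole). *)

theory Defs
  imports "HOL-Complex_Analysis.Complex_Analysis"
begin

text \<open>Only used for open sets \<open>U\<close>: the Frechet derivative exists and is complex linear.\<close>

definition holo_on :: "(complex^'n \<Rightarrow> complex) \<Rightarrow> (complex^'n) set \<Rightarrow> bool" where
  "holo_on g U \<longleftrightarrow>
     (\<forall>x\<in>U. \<exists>g'. (g has_derivative g') (at x) \<and> (\<forall>c v. g' (c *s v) = c * g' v))"

definition pd :: "'n \<Rightarrow> (complex^'n \<Rightarrow> complex) \<Rightarrow> complex^'n \<Rightarrow> complex" where
  "pd i g x = deriv (\<lambda>t. g (x + t *s axis i 1)) 0"

text \<open>
  On an open set \<open>V\<close>, an operator in \<open>D_X(V)\<close> is a finite sum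
  \<open>\<Sum>\<^sub>w P w * \<partial>\<^sub>w\<close>, where \<open>w = [i\<^sub>1, \<dots>, i\<^sub>k]\<close> is a word of coordinate indices,
  \<open>\<partial>\<^sub>w = \<partial>\<^sub>i\<^sub>1 \<cdots> \<partial>\<^sub>i\<^sub>k\<close>, and \<open>P w\<close> is holomorphic on \<open>V\<close>. Since the \<open>\<partial>\<^sub>i\<close> commute on
  holomorphic functions, words present the same operators as multi-indices, redundantly.
\<close>

definition diff_ops :: "(complex^'n) set \<Rightarrow> ('n list \<Rightarrow> complex^'n \<Rightarrow> complex) set" where
  "diff_ops V = {P. finite {w. P w \<noteq> (\<lambda>_. 0)} \<and> (\<forall>w. holo_on (P w) V)}"

text \<open>
  An element \<open>h f\<^sup>c\<close> of \<open>(O_X)_f f\<^sup>c\<close> is represented by the function \<open>h\<close>, of which only the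
  values off the zero set of \<open>f\<close> matter. (A section of \<open>(O_X)_f\<close> is determined by these values;
  near a point where \<open>f\<close> vanishes identically the localization is zero.)
  \<open>conn f c i\<close> is the action of \<open>\<partial>\<^sub>i\<close>:
  \<open>\<partial>\<^sub>i (h f\<^sup>c) = (\<partial>\<^sub>i h + c h (\<partial>\<^sub>i f) / f) f\<^sup>c\<close>.
\<close>

definition conn :: "(complex^'n \<Rightarrow> complex) \<Rightarrow> complex \<Rightarrow> 'n
    \<Rightarrow> (complex^'n \<Rightarrow> complex) \<Rightarrow> complex^'n \<Rightarrow> complex" where
  "conn f c i h x = pd i h x + c * h x * (pd i f x / f x)"

definition diff_act :: "(complex^'n \<Rightarrow> complex) \<Rightarrow> complex \<Rightarrow> ('n list \<Rightarrow> complex^'n \<Rightarrow> complex)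
    \<Rightarrow> (complex^'n \<Rightarrow> complex) \<Rightarrow> complex^'n \<Rightarrow> complex" where
  "diff_act f c P h x = (\<Sum>w | P w \<noteq> (\<lambda>_. 0). P w x * foldr (conn f c) w h x)"

text \<open>
  The subsheaf \<open>D_X \<cdot> (u f\<^sup>c)\<close> of \<open>(O_X)_f f\<^sup>c\<close>, as the set of all pairs of an open \<open>U \<subseteq> X\<close> and a
  section \<open>h f\<^sup>c\<close> over \<open>U\<close>. As \<open>D_X\<close> is a sheaf, a section is only locally of the
  form \<open>P (u f\<^sup>c)\<close>.
\<close>

definition D_submodule :: "(complex^'n) set \<Rightarrow> (complex^'n \<Rightarrow> complex) \<Rightarrow> complex
    \<Rightarrow> (complex^'n \<Rightarrow> complex) \<Rightarrow> ((complex^'n) set \<times> (complex^'n \<Rightarrow> complex)) set" where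
  "D_submodule X f c u =
     {(U, h). open U \<and> U \<subseteq> X \<and>
        (\<forall>x\<in>U. \<exists>V. open V \<and> x \<in> V \<and> V \<subseteq> U \<and>
           (\<exists>P\<in>diff_ops V. \<forall>y\<in>V. f y \<noteq> 0 \<longrightarrow> h y = diff_act f c P u y))}"

text \<open>
  Elements of \<open>O(V)[s]\<close> and of \<open>(O_X)_f[s] f\<^sup>s\<close> are represented by functions with values in
  \<^typ>\<open>complex poly\<close>, the polynomial variable being \<open>s\<close>.
\<close>

definition holo_poly_on :: "(complex^'n \<Rightarrow> complex poly) \<Rightarrow> (complex^'n) set \<Rightarrow> bool" where
  "holo_poly_on a V \<longleftrightarrow>
     (\<exists>d. \<forall>x\<in>V. degree (a x) \<le> d) \<and> (\<forall>k. holo_on (\<lambda>x. coeff (a x) k) V)"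

definition diff_ops_s :: "(complex^'n) set \<Rightarrow> ('n list \<Rightarrow> complex^'n \<Rightarrow> complex poly) set" where
  "diff_ops_s V = {P. finite {w. P w \<noteq> (\<lambda>_. 0)} \<and> (\<forall>w. holo_poly_on (P w) V)}"

text \<open>Coefficientwise partial derivative; meaningful where the degree of \<open>h\<close> is locally bounded,
  as it is for all elements arising below.\<close>

definition pd_s :: "'n \<Rightarrow> (complex^'n \<Rightarrow> complex poly) \<Rightarrow> complex^'n \<Rightarrow> complex poly" where
  "pd_s i h x = Abs_poly (\<lambda>k. pd i (\<lambda>y. coeff (h y) k) x)"

text \<open>\<open>\<partial>\<^sub>i (h f\<^sup>s) = (\<partial>\<^sub>i h + s h (\<partial>\<^sub>i f) / f) f\<^sup>s\<close>, with \<open>s = [:0, 1:]\<close>.\<close>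

definition conn_s :: "(complex^'n \<Rightarrow> complex) \<Rightarrow> 'n
    \<Rightarrow> (complex^'n \<Rightarrow> complex poly) \<Rightarrow> complex^'n \<Rightarrow> complex poly" where
  "conn_s f i h x = pd_s i h x + [:0, 1:] * h x * [:pd i f x / f x:]"

definition diff_act_s :: "(complex^'n \<Rightarrow> complex) \<Rightarrow> ('n list \<Rightarrow> complex^'n \<Rightarrow> complex poly)
    \<Rightarrow> (complex^'n \<Rightarrow> complex poly) \<Rightarrow> complex^'n \<Rightarrow> complex poly" where
  "diff_act_s f P h x = (\<Sum>w | P w \<noteq> (\<lambda>_. 0). P w x * foldr (conn_s f) w h x)"

text \<open>\<open>P(s) f\<^sup>s\<^sup>+\<^sup>j = b(s) f\<^sup>s\<close> with \<open>P(s)\<close> a local section of the sheaf \<open>D_X[s]\<close>, that is,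
  \<open>b(s) f\<^sup>s\<close> is a section of the subsheaf generated by \<open>f\<^sup>s\<^sup>+\<^sup>j = f\<^sup>j f\<^sup>s\<close>.\<close>

definition functional_eq :: "(complex^'n) set \<Rightarrow> (complex^'n \<Rightarrow> complex) \<Rightarrow> nat
    \<Rightarrow> complex poly \<Rightarrow> bool" where
  "functional_eq X f j b \<longleftrightarrow>
     (\<forall>x\<in>X. \<exists>V. open V \<and> x \<in> V \<and> V \<subseteq> X \<and>
        (\<exists>P\<in>diff_ops_s V. \<forall>y\<in>V. f y \<noteq> 0 \<longrightarrow> diff_act_s f P (\<lambda>z. [:f z ^ j:]) y = b))"

definition is_b_poly :: "(complex^'n) set \<Rightarrow> (complex^'n \<Rightarrow> complex) \<Rightarrow> nat
    \<Rightarrow> complex poly \<Rightarrow> bool" where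
  "is_b_poly X f j b \<longleftrightarrow>
     functional_eq X f j b \<and> lead_coeff b = 1 \<and>
     (\<forall>c. functional_eq X f j c \<and> lead_coeff c = 1 \<longrightarrow> degree b \<le> degree c)"

text \<open>\<open>b\<close> is the sequence of the \<open>b^(j)\<close>, \<open>j \<ge> 1\<close>; only its tail matters.\<close>

definition nu1 :: "(nat \<Rightarrow> complex poly) \<Rightarrow> rat \<Rightarrow> nat" where
  "nu1 b \<beta> = lim (\<lambda>j. order (- of_rat \<beta>) (b j))"

primrec Ck :: "nat \<Rightarrow> ('a::real_normed_vector \<Rightarrow> 'b::real_normed_vector) \<Rightarrow> bool" where
  "Ck 0 g \<longleftrightarrow> continuous_on UNIV g"
| "Ck (Suc k) g \<longleftrightarrow>
     (\<exists>g'. (\<forall>x. (g has_derivative g' x) (at x)) \<and> (\<forall>v. Ck k (\<lambda>x. g' x v)))"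

definition test_function :: "(complex^'n) set \<Rightarrow> (complex^'n \<Rightarrow> complex) \<Rightarrow> bool" where
  "test_function X \<phi> \<longleftrightarrow>
     (\<forall>k. Ck k \<phi>) \<and> compact (closure {x. \<phi> x \<noteq> 0}) \<and> closure {x. \<phi> x \<noteq> 0} \<subseteq> X"

text \<open>The meromorphic extension is unique up to its values on a discrete set, which do not affect
  pole orders.\<close>

definition zeta :: "(complex^'n) set \<Rightarrow> (complex^'n \<Rightarrow> complex) \<Rightarrow> (complex^'n \<Rightarrow> complex)
    \<Rightarrow> complex \<Rightarrow> complex" where
  "zeta X f \<phi> = (SOME F. F meromorphic_on UNIV \<and>
     (\<forall>s. Re s > 0 \<longrightarrow>
        F s = (LINT x:X|lborel. complex_of_real (cmod (f x)) powr (2 * s) * \<phi> x)))"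

definition pole_order :: "(complex \<Rightarrow> complex) \<Rightarrow> complex \<Rightarrow> nat" where
  "pole_order F z = (if is_pole F z then nat (- zorder F z) else 0)"

definition zeta_pole_order :: "(complex^'n) set \<Rightarrow> (complex^'n \<Rightarrow> complex) \<Rightarrow> complex \<Rightarrow> nat" where
  "zeta_pole_order X f z = Max {pole_order (zeta X f \<phi>) z | \<phi>. test_function X \<phi>}"

end

theory Submission
  imports Defs
begin

text \<open>
  Write \<open>|f|\<^sup>2\<^sup>s = f\<^sup>s (cnj f)\<^sup>s\<close>. Holomorphic differential operators act on the first factor only, and
  integration by parts moves them to the test function. So an identity \<open>P(s) f\<^sup>s\<^sup>+\<^sup>j = b(s) f\<^sup>s\<close>
  gives, for all integers \<open>k\<close> and \<open>l\<close>,
  \<open>b(s + k) \<integral> |f|\<^sup>2\<^sup>s f\<^sup>k (cnj f)\<^sup>l \<phi> = (a sum of integrals \<integral> |f|\<^sup>2\<^sup>s f\<^sup>k\<^sup>+\<^sup>j (cnj f)\<^sup>l \<psi>, with powers of s)\<close>,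
  and the right-hand side is holomorphic on a half-plane that grows with \<open>j\<close>
  (\<open>zeta_functional_equation\<close>). For \<open>k = l = 0\<close> this continues \<open>Z\<^sub>f\<close> meromorphically to the plane. In general
  it bounds the pole order at \<open>z\<close> by the multiplicity of \<open>z + k\<close> as a root of the \<open>b\<^sup>(\<^sup>j\<^sup>)\<close>
  (\<open>zeta_integral_pole_le\<close>). Complex conjugation exchanges \<open>k\<close> and \<open>l\<close>, so for real \<open>z\<close> the
  multiplicity of \<open>z + l\<close> is a bound as well (\<open>zeta_integral_pole_le_conj\<close>).

  Let now \<open>z = -\<alpha>\<close> and suppose that the two submodules agree. Then locally \<open>f\<^sup>z = P f\<^sup>z\<^sup>+\<^sup>1\<close>
  for some \<open>P\<close> in \<open>D_X\<close>. Replacing \<open>z\<close> by \<open>s\<close> changes \<open>P f\<^sup>s\<^sup>+\<^sup>1\<close> by a multiple of \<open>s - z\<close>, that is,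
  \<open>f\<^sup>s = P f\<^sup>s\<^sup>+\<^sup>1 - (s - z) h(s) f\<^sup>s\<^sup>-\<^sup>N\<close> with \<open>h(s)\<close> holomorphic and polynomial in \<open>s\<close>.
  Integrated against \<open>(cnj f)\<^sup>s \<phi>\<close>, the first term has the twist \<open>k = 1\<close>, hence a pole of order at most
  \<open>\<nu>\<^sub>1(\<alpha> - 1) < \<nu>\<^sub>1(\<alpha>)\<close>. The second term has the twist \<open>k = -N\<close>, but \<open>l = 0\<close>, so the conjugate bound
  gives order at most \<open>\<nu>\<^sub>1(\<alpha>)\<close>, and the factor \<open>s - z\<close> lowers it by one. Therefore no
  \<open>Z\<^sub>f(\<phi>; s)\<close> has a pole of order \<open>\<nu>\<^sub>1(\<alpha>)\<close> at \<open>z\<close>, against the hypothesis (\<open>zeta_pole_drop\<close>).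

  Since \<open>P\<close> and the operators behind the \<open>b\<^sup>(\<^sup>j\<^sup>)\<close> exist only locally, test functions are
  cut up by a smooth partition of unity (\<open>test_function_localization\<close>). That \<open>\<nu>\<^sub>1\<close> really bounds
  the multiplicities requires the sequence behind it to converge: \<open>b\<^sup>(\<^sup>j\<^sup>)\<close> divides \<open>b\<^sup>(\<^sup>j\<^sup>+\<^sup>1\<^sup>)\<close> and the product
  \<open>b\<^sup>(\<^sup>1\<^sup>)(s) b\<^sup>(\<^sup>1\<^sup>)(s + 1) \<cdots> b\<^sup>(\<^sup>1\<^sup>)(s + j - 1)\<close>, so the multiplicities increase and are at most
  \<open>deg b\<^sup>(\<^sup>1\<^sup>)\<close> (\<open>order_b_poly_le_nu1\<close>).
\<close>

section \<open>Holomorphic functions of several variables\<close>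

lemma holo_on_subset: "holo_on g U \<Longrightarrow> V \<subseteq> U \<Longrightarrow> holo_on g V"
  unfolding holo_on_def by blast

lemma holo_on_imp_continuous_on: "holo_on g U \<Longrightarrow> continuous_on U g"
  unfolding holo_on_def
  by (metis continuous_at_imp_continuous_on has_derivative_continuous)

lemma holo_on_const: "holo_on (\<lambda>_. c) U"
  unfolding holo_on_def by (auto intro!: exI[of _ "\<lambda>_. 0"] derivative_intros)

lemma holo_on_add: 
  assumes "holo_on g U" "holo_on h U" shows "holo_on (\<lambda>x. g x + h x) U"
  unfolding holo_on_def
proof
  fix x assume "x \<in> U"
  then obtain g' h' where "(g has_derivative g') (at x)" "\<forall>c v. g' (c *s v) = c * g' v"
    "(h has_derivative h') (at x)" "\<forall>c v. h' (c *s v) = c * h' v"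
    using assms unfolding holo_on_def by blast
  thus "\<exists>f'. ((\<lambda>x. g x + h x) has_derivative f') (at x) \<and> (\<forall>c v. f' (c *s v) = c * f' v)"
    by (intro exI[of _ "\<lambda>v. g' v + h' v"]) (auto intro!: derivative_eq_intros simp: algebra_simps)
qed

lemma holo_on_mult: 
  assumes "holo_on g U" "holo_on h U" shows "holo_on (\<lambda>x. g x * h x) U"
  unfolding holo_on_def
proof
  fix x assume "x \<in> U"
  then obtain g' h' where "(g has_derivative g') (at x)" "\<forall>c v. g' (c *s v) = c * g' v"
    "(h has_derivative h') (at x)" "\<forall>c v. h' (c *s v) = c * h' v"
    using assms unfolding holo_on_def by blast
  thus "\<exists>f'. ((\<lambda>x. g x * h x) has_derivative f') (at x) \<and> (\<forall>c v. f' (c *s v) = c * f' v)"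
    by (intro exI[of _ "\<lambda>v. g x * h' v + g' v * h x"]) (auto intro!: derivative_eq_intros simp: algebra_simps)
qed

lemma holo_on_power: "holo_on g U \<Longrightarrow> holo_on (\<lambda>x. g x ^ n) U"
  by (induction n) (auto intro: holo_on_const holo_on_mult)

lemma holo_on_sum: "(\<And>i. i \<in> I \<Longrightarrow> holo_on (g i) U) \<Longrightarrow> holo_on (\<lambda>x. \<Sum>i\<in>I. g i x) U"
  by (induction I rule: infinite_finite_induct) (auto intro: holo_on_const holo_on_add)

lemma bounded_linear_scalar_mult_axis: "bounded_linear (\<lambda>t::complex. t *s (axis i 1 :: complex^'n))"
proof -
  have "linear (\<lambda>t::complex. t *s (axis i 1 :: complex^'n))"
    by (rule linearI) (auto simp: vec_eq_iff axis_def algebra_simps)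
  thus ?thesis by (simp add: linear_conv_bounded_linear)
qed

lemma pd_eqI: "((\<lambda>t. g (x + t *s axis i 1)) has_field_derivative d) (at 0) \<Longrightarrow> pd i g x = d"
  unfolding pd_def by (rule DERIV_imp_deriv)

lemma complex_line_derivative:
  fixes g :: "complex^'n \<Rightarrow> complex"
  assumes "(g has_derivative g') (at x)" "\<And>c v. g' (c *s v) = c * g' v"
  shows "((\<lambda>t. g (x + t *s axis i 1)) has_field_derivative g' (axis i 1)) (at 0)"
proof -
  have "((\<lambda>t::complex. x + t *s axis i 1) has_derivative (\<lambda>t. t *s axis i 1)) (at 0)"
    by (auto intro!: derivative_eq_intros bounded_linear_imp_has_derivative bounded_linear_scalar_mult_axis)
  hence "((\<lambda>t. g (x + t *s axis i 1)) has_derivative (\<lambda>t. g' (t *s axis i 1))) (at 0)"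
    using assms(1) has_derivative_compose[of "\<lambda>t. x + t *s axis i 1" "\<lambda>t. t *s axis i 1" 0 UNIV g g'] by simp
  thus ?thesis by (simp add: has_field_derivative_def assms(2) mult_commute_abs)
qed

lemma holo_on_has_field_derivative_line:
  assumes "holo_on g U" "x \<in> U"
  shows "((\<lambda>t. g (x + t *s axis i 1)) has_field_derivative pd i g x) (at 0)"
proof -
  obtain g' where "(g has_derivative g') (at x)" "\<And>c v. g' (c *s v) = c * g' v"
    using assms unfolding holo_on_def by blast
  from complex_line_derivative[OF this, of i] have "((\<lambda>t. g (x + t *s axis i 1)) has_field_derivative g' (axis i 1)) (at 0)" .
  thus ?thesis by (simp add: pd_eqI)
qed

lemma holo_on_has_derivative:
  assumes "holo_on g U" "x \<in> U"
  shows "(g has_derivative (\<lambda>v. \<Sum>i\<in>UNIV. v $ i * pd i g x)) (at x)"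
proof -
  obtain g' where g': "(g has_derivative g') (at x)" "\<And>c v. g' (c *s v) = c * g' v"
    using assms unfolding holo_on_def by blast
  have lin: "linear g'" using g'(1) has_derivative_linear by blast
  have "g' v = (\<Sum>i\<in>UNIV. v $ i * pd i g x)" for v
  proof -
    have "g' v = g' (\<Sum>i\<in>UNIV. v $ i *s axis i 1)" by (simp add: basis_expansion)
    also have "\<dots> = (\<Sum>i\<in>UNIV. v $ i * pd i g x)"
      by (simp add: linear_sum[OF lin] g'(2) pd_eqI[OF complex_line_derivative[OF g']])
    finally show ?thesis .
  qed
  thus ?thesis using g'(1) by (metis (no_types, lifting) ext)
qed

text \<open>
  Cauchy's formula for the derivative along one complex line. It expresses \<open>pd i g\<close> by values of \<open>g\<close>
  alone, so regularity of \<open>g\<close> passes to \<open>pd i g\<close> under the integral sign.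
\<close>

lemma pd_circle_integral:
  fixes g :: "complex^'n \<Rightarrow> complex"
  assumes g: "holo_on g U" and r: "r > 0" and sub: "\<And>t. norm t \<le> r \<Longrightarrow> x + t *s axis i 1 \<in> U"
  shows "pd i g x = integral (cbox 0 1) (\<lambda>\<theta>::real. g (x + circlepath 0 r \<theta> *s axis i 1) / circlepath 0 r \<theta>)"
proof -
  let ?h = "\<lambda>t. g (x + t *s axis i 1)"
  have der: "(?h has_field_derivative pd i g (x + t *s axis i 1)) (at t)" if "norm t \<le> r" for t
  proof -
    have "((\<lambda>u. g (x + t *s axis i 1 + u *s axis i 1)) has_field_derivative pd i g (x + t *s axis i 1)) (at 0)"
      by (rule holo_on_has_field_derivative_line[OF g sub[OF that]])
    hence "((\<lambda>u. ?h (t + u)) has_field_derivative pd i g (x + t *s axis i 1)) (at 0)"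
      by (simp add: algebra_simps)
    thus ?thesis using DERIV_at_within_shift[of ?h "pd i g (x + t *s axis i 1)" t 0 UNIV]
      by simp
  qed
  have "?h holomorphic_on ball 0 r"
    using der unfolding holomorphic_on_def field_differentiable_def
    by (metis DERIV_subset dist_0_norm less_imp_le mem_ball subset_UNIV)
  moreover have "continuous_on (cball 0 r) ?h"
    using der by (intro continuous_at_imp_continuous_on ballI) (auto intro: DERIV_isCont)
  ultimately have "(?h has_field_derivative (1 / (2 * of_real pi * \<i>) * contour_integral (circlepath 0 r) (\<lambda>u. ?h u / (u-0)^2))) (at 0)"
    using Cauchy_derivative_integral_circlepath(2)[of 0 r ?h 0] r by auto
  hence "pd i g x = 1 / (2 * of_real pi * \<i>) * contour_integral (circlepath 0 r) (\<lambda>u. ?h u / u^2)"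
    by (intro pd_eqI) auto
  also have "\<dots> = 1 / (2 * of_real pi * \<i>) * integral (cbox 0 1) (\<lambda>\<theta>. ?h (circlepath 0 r \<theta>) / (circlepath 0 r \<theta>)^2 * (2 * of_real pi * \<i> * circlepath 0 r \<theta>))"
    by (simp only: contour_integral_integral vector_derivative_circlepath) (simp add: circlepath mult_ac)
  also have "\<dots> = integral (cbox 0 1) (\<lambda>\<theta>. (1 / (2 * of_real pi * \<i>)) * (?h (circlepath 0 r \<theta>) / (circlepath 0 r \<theta>)^2 * (2 * of_real pi * \<i> * circlepath 0 r \<theta>)))"
    by (simp only: integral_mult_right)
  also have "\<dots> = integral (cbox 0 1) (\<lambda>\<theta>. ?h (circlepath 0 r \<theta>) / circlepath 0 r \<theta>)"
    using r by (intro integral_cong) (auto simp: power2_eq_square field_simps circlepath)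
  finally show ?thesis .
qed

lemma norm_scalar_mult_axis [simp]: "norm (t *s (axis i 1 :: complex^'n)) = norm t"
proof -
  have "t *s (axis i 1 :: complex^'n) = axis i t" by (auto simp: vec_eq_iff axis_def)
  thus ?thesis by (simp add: norm_eq_sqrt_inner inner_axis_axis)
qed

text \<open>
  The radius is halved so that the circles of radius \<open>r\<close> around all points near \<open>x\<close> stay in \<open>U\<close>.
\<close>

lemma complex_line_in_ball:
  fixes y :: "complex^'n"
  assumes "ball x (2 * r) \<subseteq> U" "y \<in> ball x r" "norm t \<le> r"
  shows "y + t *s axis i 1 \<in> U"
proof -
  have "dist x (y + t *s axis i 1) \<le> dist x y + norm (t *s (axis i 1 :: complex^'n))"
    by (metis add_diff_cancel_left' dist_commute dist_norm dist_triangle)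
  thus ?thesis using assms(2,3) by (auto intro!: subsetD[OF assms(1)])
qed

lemma continuous_on_circle_lines:
  fixes h :: "complex^'n \<Rightarrow> complex"
  assumes h: "continuous_on U h" and r: "r > 0" "ball x (2 * r) \<subseteq> U"
  shows "continuous_on (ball x r \<times> cbox 0 1)
    (\<lambda>p. h (fst p + circlepath 0 r (snd p) *s axis i 1) / circlepath 0 r (snd p))"
proof -
  have c: "continuous_on (ball x r \<times> cbox 0 1) (\<lambda>p. circlepath 0 r (snd p))"
    unfolding circlepath split_beta by (intro continuous_intros)
  have "continuous_on (ball x r \<times> cbox 0 1) (\<lambda>p. fst p + circlepath 0 r (snd p) *s axis i 1)"
    using c by (intro continuous_intros bounded_linear.continuous_on[OF bounded_linear_scalar_mult_axis])
  moreover have "(\<lambda>p. fst p + circlepath 0 r (snd p) *s axis i 1) ` (ball x r \<times> cbox 0 1) \<subseteq> U"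
    using r(1) by (auto intro!: complex_line_in_ball[OF r(2)] simp: circlepath norm_mult)
  ultimately have "continuous_on (ball x r \<times> cbox 0 1) (\<lambda>p. h (fst p + circlepath 0 r (snd p) *s axis i 1))"
    using continuous_on_compose2[OF h] by blast
  thus ?thesis using c r(1) by (intro continuous_intros) (auto simp: circlepath)
qed

text \<open>
  \<^const>\<open>holo_on\<close> gives a derivative at each point but says nothing about its continuity, which
  differentiation under the integral needs; Cauchy's formula supplies it first.
\<close>

lemma continuous_on_pd:
  fixes g :: "complex^'n \<Rightarrow> complex"
  assumes g: "holo_on g U" and U: "open U"
  shows "continuous_on U (pd i g)"
proof (rule continuous_at_imp_continuous_on, rule ballI)
  fix x assume x: "x \<in> U"
  obtain r where r: "r > 0" "ball x (2*r) \<subseteq> U"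
    using U x by (metis field_sum_of_halves mult_2 open_contains_ball_eq zero_less_mult_iff half_gt_zero)
  have "continuous_on (ball x r) (\<lambda>y. integral (cbox 0 1) (\<lambda>\<theta>. g (y + circlepath 0 r \<theta> *s axis i 1) / circlepath 0 r \<theta>))"
    using continuous_on_circle_lines[OF holo_on_imp_continuous_on[OF g] r]
    by (intro integral_continuous_on_param) (simp add: split_beta)
  moreover have "integral (cbox 0 1) (\<lambda>\<theta>. g (y + circlepath 0 r \<theta> *s axis i 1) / circlepath 0 r \<theta>) = pd i g y"
    if "y \<in> ball x r" for y
    by (rule pd_circle_integral[OF g r(1) complex_line_in_ball[OF r(2) that], symmetric])
  ultimately have "continuous_on (ball x r) (pd i g)"
    by (rule continuous_on_eq)
  thus "isCont (pd i g) x" using r(1) by (simp add: continuous_on_eq_continuous_at)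
qed

text \<open>
  With \<open>C\<^sup>1\<close> known, the Leibniz rule differentiates Cauchy's formula, and the derivative so obtained
  is again complex linear.
\<close>

lemma holo_on_pd:
  fixes g :: "complex^'n \<Rightarrow> complex"
  assumes g: "holo_on g U" and U: "open U"
  shows "holo_on (pd i g) U"
  unfolding holo_on_def
proof
  fix x assume x: "x \<in> U"
  obtain r where r: "r > 0" "ball x (2*r) \<subseteq> U"
    using U x by (metis field_sum_of_halves mult_2 open_contains_ball_eq zero_less_mult_iff half_gt_zero)
  note sub = complex_line_in_ball[OF r(2)]
  define \<gamma> where "\<gamma> = circlepath 0 r"
  have \<gamma>: "\<gamma> t \<noteq> 0" "norm (\<gamma> t) \<le> r" for t
    using r(1) by (auto simp: \<gamma>_def circlepath norm_mult)
  \<comment> \<open>The derivative of the integrand, as a bounded linear map depending continuously on its parameters.\<close>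
  define L :: "'n \<Rightarrow> (complex^'n) \<Rightarrow>\<^sub>L complex" where "L j = Blinfun (\<lambda>v. v $ j)" for j
  have L: "blinfun_apply (L j) v = v $ j" for j v
    unfolding L_def by (simp add: bounded_linear_Blinfun_apply bounded_linear_vec_nth)
  define D where "D y t = (\<Sum>j\<in>UNIV. blinfun_mult_right (pd j g (y + \<gamma> t *s axis i 1) / \<gamma> t) o\<^sub>L L j)" for y t
  have D: "blinfun_apply (D y t) v = (\<Sum>j\<in>UNIV. pd j g (y + \<gamma> t *s axis i 1) / \<gamma> t * v $ j)" for y t v
    by (simp add: D_def blinfun.sum_left L)
  have cont: "continuous_on (ball x r \<times> cbox 0 1) (\<lambda>p. h (fst p + \<gamma> (snd p) *s axis i 1) / \<gamma> (snd p))"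
    if "continuous_on U h" for h
    unfolding \<gamma>_def by (rule continuous_on_circle_lines[OF that r])
  let ?I = "\<lambda>y. integral (cbox 0 1) (\<lambda>\<theta>. g (y + \<gamma> \<theta> *s axis i 1) / \<gamma> \<theta>)"
  have contD: "continuous_on (ball x r \<times> cbox 0 1) (\<lambda>(y,t). D y t)"
    unfolding D_def split_beta
    by (intro continuous_intros bounded_linear.continuous_on[OF bounded_linear_blinfun_mult_right] cont continuous_on_pd[OF g U])
  have cPair: "continuous_on (cbox 0 (1::real)) (\<lambda>t. (y, t))" for y :: "complex^'n"
    by (intro continuous_intros)
  have contDx: "continuous_on (cbox 0 1) (D x)"
    using continuous_on_compose2[OF contD cPair[of x]] r(1) by (simp add: image_subset_iff)
  have "(?I has_derivative integral (cbox 0 1) (D x)) (at x within ball x r)"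
  proof (rule leibniz_rule)
    fix y t assume y: "y \<in> ball x r"
    have "(g has_derivative (\<lambda>v. \<Sum>j\<in>UNIV. v $ j * pd j g (y + \<gamma> t *s axis i 1))) (at (y + \<gamma> t *s axis i 1))"
      by (rule holo_on_has_derivative[OF g sub[OF y \<gamma>(2)]])
    moreover have "((\<lambda>y. y + \<gamma> t *s axis i 1) has_derivative (\<lambda>v. v)) (at y)"
      by (auto intro!: derivative_eq_intros)
    ultimately have "((\<lambda>y. g (y + \<gamma> t *s axis i 1)) has_derivative (\<lambda>v. \<Sum>j\<in>UNIV. v $ j * pd j g (y + \<gamma> t *s axis i 1))) (at y)"
      using has_derivative_compose[of "\<lambda>y. y + \<gamma> t *s axis i 1" "\<lambda>v. v" y UNIV g
        "\<lambda>v. \<Sum>j\<in>UNIV. v $ j * pd j g (y + \<gamma> t *s axis i 1)"] by simp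
    hence "((\<lambda>y. g (y + \<gamma> t *s axis i 1) / \<gamma> t) has_derivative (\<lambda>v. (\<Sum>j\<in>UNIV. v $ j * pd j g (y + \<gamma> t *s axis i 1)) / \<gamma> t)) (at y)"
      using \<gamma>(1) by (intro bounded_linear.has_derivative[OF bounded_linear_divide])
    moreover have "(\<lambda>v. (\<Sum>j\<in>UNIV. v $ j * pd j g (y + \<gamma> t *s axis i 1)) / \<gamma> t) = blinfun_apply (D y t)"
      by (simp add: fun_eq_iff D sum_divide_distrib mult_ac)
    ultimately show "((\<lambda>y. g (y + \<gamma> t *s axis i 1) / \<gamma> t) has_derivative blinfun_apply (D y t)) (at y within ball x r)"
      using has_derivative_at_withinI by metis
  next
    fix y assume y: "y \<in> ball x r"
    show "(\<lambda>\<theta>. g (y + \<gamma> \<theta> *s axis i 1) / \<gamma> \<theta>) integrable_on cbox 0 1"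
    proof (rule integrable_continuous)
      have "(\<lambda>t. (y, t)) ` cbox 0 1 \<subseteq> ball x r \<times> cbox 0 (1::real)"
        using y by auto
      hence "continuous_on (cbox 0 1) ((\<lambda>p. g (fst p + \<gamma> (snd p) *s axis i 1) / \<gamma> (snd p)) \<circ> (\<lambda>t. (y, t)))"
        by (intro continuous_on_compose[OF cPair] continuous_on_subset[OF cont[OF holo_on_imp_continuous_on[OF g]]])
      thus "continuous_on (cbox 0 1) (\<lambda>\<theta>. g (y + \<gamma> \<theta> *s axis i 1) / \<gamma> \<theta>)"
        by (simp only: o_def fst_conv snd_conv)
    qed
  next
    show "continuous_on (ball x r \<times> cbox 0 1) (\<lambda>(y, t). D y t)" by (rule contD)
    show "x \<in> ball x r" using r(1) by simp
    show "convex (ball x r)" by (rule convex_ball)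
  qed
  hence der: "(?I has_derivative integral (cbox 0 1) (D x)) (at x)"
    by (subst (asm) at_within_open) (simp_all only: open_ball centre_in_ball r(1))
  have eq: "?I y = pd i g y" if "y \<in> ball x r" for y
    unfolding \<gamma>_def by (rule pd_circle_integral[OF g r(1) sub[OF that], symmetric])
  have der: "(pd i g has_derivative integral (cbox 0 1) (D x)) (at x)"
    by (rule has_derivative_transform_within_open[OF der open_ball _ eq]) (simp_all only: centre_in_ball r(1))
  have int: "integral (cbox 0 1) (D x) v = integral (cbox 0 1) (\<lambda>t. D x t v)" for v
    by (rule blinfun_apply_integral[OF integrable_continuous[OF contDx]])
  have lin: "D x t (c *s v) = c * D x t v" for c v t
    unfolding D sum_distrib_left by (rule sum.cong) auto
  have "integral (cbox 0 1) (D x) (c *s v) = c * integral (cbox 0 1) (D x) v" for c v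
    by (simp only: int[of "c *s v"] int[of v] lin integral_mult_right)
  thus "\<exists>g'. (pd i g has_derivative g') (at x) \<and> (\<forall>c v. g' (c *s v) = c * g' v)"
    using der by blast
qed

section \<open>Test functions and partitions of unity\<close>

lemma Ck_SucI:
  assumes "\<And>x. (g has_derivative g' x) (at x)" "\<And>v. Ck k (\<lambda>x. g' x v)"
  shows "Ck (Suc k) g"
  unfolding Ck.simps using assms by blast

lemma Ck_SucD: "Ck (Suc k) g \<Longrightarrow> Ck k g"
proof (induction k arbitrary: g)
  case 0
  then obtain g' where "\<And>x. (g has_derivative g' x) (at x)" by auto
  hence "isCont g x" for x by (rule has_derivative_continuous)
  thus ?case by (simp add: continuous_at_imp_continuous_on)
next
  case (Suc k)
  from Suc.prems obtain g' where *: "\<And>x. (g has_derivative g' x) (at x)" "\<And>v. Ck (Suc k) (\<lambda>x. g' x v)"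
    by auto
  show ?case by (rule Ck_SucI[OF *(1) Suc.IH[OF *(2)]])
qed

lemma Ck_const: "Ck k (\<lambda>_. c)"
proof (induction k arbitrary: c)
  case (Suc k)
  show ?case by (rule Ck_SucI[of _ "\<lambda>_ _. 0"]) (auto intro: Suc)
qed auto

lemma Ck_add: "Ck k g \<Longrightarrow> Ck k h \<Longrightarrow> Ck k (\<lambda>x. g x + h x)"
proof (induction k arbitrary: g h)
  case 0
  thus ?case by (auto intro: continuous_intros)
next
  case (Suc k)
  then obtain g' h' where "\<And>x. (g has_derivative g' x) (at x)" "\<And>v. Ck k (\<lambda>x. g' x v)"
    "\<And>x. (h has_derivative h' x) (at x)" "\<And>v. Ck k (\<lambda>x. h' x v)" by auto
  thus ?case using Suc.IH
    by (intro Ck_SucI[where g' = "\<lambda>x v. g' x v + h' x v"]) (auto intro!: derivative_eq_intros)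
qed

lemma Ck_sum: "(\<And>i. i \<in> I \<Longrightarrow> Ck k (g i)) \<Longrightarrow> Ck k (\<lambda>x. \<Sum>i\<in>I. g i x)"
  by (induction I rule: infinite_finite_induct) (auto intro: Ck_const Ck_add)

lemma Ck_bounded_linear: "bounded_linear L \<Longrightarrow> Ck k g \<Longrightarrow> Ck k (\<lambda>x. L (g x))"
proof (induction k arbitrary: g)
  case 0
  thus ?case by (auto intro: bounded_linear.continuous_on)
next
  case (Suc k)
  then obtain g' where "\<And>x. (g has_derivative g' x) (at x)" "\<And>v. Ck k (\<lambda>x. g' x v)" by auto
  thus ?case using Suc
    by (intro Ck_SucI[where g' = "\<lambda>x v. L (g' x v)"]) (auto intro: bounded_linear.has_derivative)
qed

lemma Ck_mult:
  fixes g h :: "'a::real_normed_vector \<Rightarrow> 'b::real_normed_algebra"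
  shows "Ck k g \<Longrightarrow> Ck k h \<Longrightarrow> Ck k (\<lambda>x. g x * h x)"
proof (induction k arbitrary: g h)
  case 0
  thus ?case by (auto intro: continuous_intros)
next
  case (Suc k)
  note k = Suc.prems[THEN Ck_SucD]
  from Suc.prems obtain g' h' where "\<And>x. (g has_derivative g' x) (at x)" "\<And>v. Ck k (\<lambda>x. g' x v)"
    "\<And>x. (h has_derivative h' x) (at x)" "\<And>v. Ck k (\<lambda>x. h' x v)" by auto
  thus ?case using Suc.IH k
    by (intro Ck_SucI[where g' = "\<lambda>x v. g x * h' x v + g' x v * h x"] Ck_add) (auto intro!: derivative_eq_intros)
qed

lemma test_function_Ck: "test_function V \<phi> \<Longrightarrow> Ck k \<phi>"
  unfolding test_function_def by blast

lemma test_function_mono: "test_function V \<phi> \<Longrightarrow> V \<subseteq> W \<Longrightarrow> test_function W \<phi>"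
  unfolding test_function_def by blast

lemma test_function_continuous: "test_function V \<phi> \<Longrightarrow> continuous_on UNIV \<phi>"
  using test_function_Ck[of V \<phi> 0] by simp

lemma test_functionI:
  assumes "\<And>k. Ck k \<psi>" "test_function V \<phi>" "\<And>x. x \<notin> closure {x. \<phi> x \<noteq> 0} \<Longrightarrow> \<psi> x = 0"
  shows "test_function V \<psi>"
proof -
  have "closure {x. \<psi> x \<noteq> 0} \<subseteq> closure {x. \<phi> x \<noteq> 0}"
    using assms(3) by (intro closure_minimal) auto
  thus ?thesis using assms(1,2) unfolding test_function_def
    by (meson closed_closure closed_subset compact_eq_bounded_closed bounded_subset order_trans)
qed

lemma test_function_zero_outside: "test_function V \<phi> \<Longrightarrow> x \<notin> V \<Longrightarrow> \<phi> x = 0"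
  unfolding test_function_def using closure_subset[of "{x. \<phi> x \<noteq> 0}"] by auto

lemma test_function_zero_near:
  assumes "test_function V \<phi>" "x \<notin> V" 
  obtains W where "open W" "x \<in> W" "\<And>y. y \<in> W \<Longrightarrow> \<phi> y = 0"
proof (rule that)
  show "open (- closure {x. \<phi> x \<noteq> 0})" by auto
  show "x \<in> - closure {x. \<phi> x \<noteq> 0}" using assms unfolding test_function_def by auto
  show "\<phi> y = 0" if "y \<in> - closure {x. \<phi> x \<noteq> 0}" for y
    using that closure_subset[of "{x. \<phi> x \<noteq> 0}"] by auto
qed

lemma test_function_0: "test_function V (\<lambda>_. 0)"
  unfolding test_function_def by (auto intro: Ck_const)

lemma test_function_mult: 
  assumes "test_function V \<phi>" "\<And>k. Ck k \<psi>" shows "test_function V (\<lambda>x. \<psi> x * \<phi> x)"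
  using closure_subset[of "{x. \<phi> x \<noteq> 0}"]
  by (intro test_functionI[OF _ assms(1)] Ck_mult assms(2) test_function_Ck[OF assms(1)]) auto

lemma test_function_add:
  assumes "test_function V \<phi>" "test_function V \<psi>" shows "test_function V (\<lambda>x. \<phi> x + \<psi> x)"
proof -
  have "{x. \<phi> x + \<psi> x \<noteq> 0} \<subseteq> {x. \<phi> x \<noteq> 0} \<union> {x. \<psi> x \<noteq> 0}" by auto
  hence "closure {x. \<phi> x + \<psi> x \<noteq> 0} \<subseteq> closure {x. \<phi> x \<noteq> 0} \<union> closure {x. \<psi> x \<noteq> 0}"
    unfolding closure_Un[symmetric] by (rule closure_mono)
  moreover have "bounded (closure {x. \<phi> x \<noteq> 0} \<union> closure {x. \<psi> x \<noteq> 0})"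
    using assms by (auto simp: test_function_def compact_imp_bounded)
  ultimately have "compact (closure {x. \<phi> x + \<psi> x \<noteq> 0})"
    using bounded_subset unfolding compact_eq_bounded_closed by blast
  moreover note \<open>closure _ \<subseteq> _ \<union> _\<close>
  ultimately show ?thesis using assms unfolding test_function_def by (auto intro: Ck_add)
qed

lemma test_function_cmult: "test_function V \<phi> \<Longrightarrow> test_function V (\<lambda>x. c * \<phi> x)"
  by (rule test_function_mult) (auto intro: Ck_const)

lemma test_function_cnj: 
  assumes "test_function V \<phi>" shows "test_function V (\<lambda>x. cnj (\<phi> x))"
  using closure_subset[of "{x. \<phi> x \<noteq> 0}"]
  by (intro test_functionI[OF _ assms] Ck_bounded_linear[OF bounded_linear_cnj] test_function_Ck[OF assms]) auto

definition dir_deriv :: "complex^'n \<Rightarrow> (complex^'n \<Rightarrow> complex) \<Rightarrow> complex^'n \<Rightarrow> complex" where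
  "dir_deriv v \<phi> x = frechet_derivative \<phi> (at x) v"

lemma test_function_has_derivative:
  assumes "test_function V \<phi>"
  shows "(\<phi> has_derivative (\<lambda>v. dir_deriv v \<phi> x)) (at x)"
proof -
  have "\<phi> differentiable at x"
    using test_function_Ck[OF assms, of 1] by (auto simp: differentiable_def)
  thus ?thesis unfolding dir_deriv_def using frechet_derivative_works by metis
qed

lemma dir_deriv_eq: "(\<phi> has_derivative \<phi>') (at x) \<Longrightarrow> dir_deriv v \<phi> x = \<phi>' v"
  unfolding dir_deriv_def by (metis frechet_derivative_at)

lemma test_function_dir_deriv:
  assumes "test_function V \<phi>"
  shows "test_function V (dir_deriv v \<phi>)"
proof (rule test_functionI[OF _ assms])
  fix k
  from test_function_Ck[OF assms, of "Suc k"] obtain \<phi>' where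
    *: "\<And>x. (\<phi> has_derivative \<phi>' x) (at x)" "\<And>v. Ck k (\<lambda>x. \<phi>' x v)" by auto
  have "dir_deriv v \<phi> = (\<lambda>x. \<phi>' x v)" using dir_deriv_eq[OF *(1)] by blast
  thus "Ck k (dir_deriv v \<phi>)" using *(2) by simp
next
  fix x assume x: "x \<notin> closure {x. \<phi> x \<noteq> 0}"
  have "(\<phi> has_derivative (\<lambda>_. 0)) (at x)"
    by (rule has_derivative_transform_within_open[of "\<lambda>_. 0" _ _ _ "- closure {x. \<phi> x \<noteq> 0}"])
       (use x closure_subset[of "{x. \<phi> x \<noteq> 0}"] in auto)
  thus "dir_deriv v \<phi> x = 0" using dir_deriv_eq by blast
qed

lemma test_function_mult_has_derivative:
  assumes "test_function V \<phi>" "\<And>x. x \<in> V \<Longrightarrow> (g has_derivative g' x) (at x)"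
  shows "((\<lambda>x. g x * \<phi> x) has_derivative (\<lambda>v. g' x v * \<phi> x + g x * dir_deriv v \<phi> x)) (at x)"
proof (cases "x \<in> V")
  case True
  show ?thesis
    by (rule derivative_eq_intros assms(2)[OF True] test_function_has_derivative[OF assms(1)] refl)+ 
       (simp add: algebra_simps)
next
  case False
  then obtain W where W: "open W" "x \<in> W" "\<And>y. y \<in> W \<Longrightarrow> \<phi> y = 0"
    using test_function_zero_near[OF assms(1)] by metis
  have "((\<lambda>x. g x * \<phi> x) has_derivative (\<lambda>_. 0)) (at x)"
    by (rule has_derivative_transform_within_open[of "\<lambda>_. 0" _ _ _ W]) (use W in auto)
  moreover have "\<phi> x = 0" "dir_deriv v \<phi> x = 0" for v
    using test_function_zero_outside[OF _ False] test_function_dir_deriv assms(1) by auto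
  ultimately show ?thesis by simp
qed

text \<open>
  Smoothness of \<open>g \<phi>\<close> when \<open>g\<close> is smooth on \<open>V\<close> only: outside \<open>V\<close> the product vanishes near each
  point. Smoothness of \<open>g\<close> is expressed by membership in a class \<open>G\<close> closed under directional derivatives, so that
  one induction serves for holomorphic functions and for quotients by powers of a nonvanishing function.
\<close>

lemma test_function_mult_class:
  assumes step: "\<And>g. g \<in> G \<Longrightarrow> \<exists>g'. (\<forall>x\<in>V. (g has_derivative g' x) (at x)) \<and> (\<forall>v. (\<lambda>x. g' x v) \<in> G)"
    and "g \<in> G" "test_function V \<phi>"
  shows "test_function V (\<lambda>x. g x * \<phi> x)"
proof -
  have "Ck k (\<lambda>x. g x * \<phi> x)" for k
    using assms(2,3)
  proof (induction k arbitrary: g \<phi>)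
    case 0
    then obtain g' where "\<forall>x\<in>V. (g has_derivative g' x) (at x)" using step by blast
    hence "((\<lambda>x. g x * \<phi> x) has_derivative (\<lambda>v. g' x v * \<phi> x + g x * dir_deriv v \<phi> x)) (at x)" for x
      using test_function_mult_has_derivative[OF 0(2), of g g'] by blast
    hence "isCont (\<lambda>x. g x * \<phi> x) x" for x by (rule has_derivative_continuous)
    thus ?case by (simp add: continuous_at_imp_continuous_on)
  next
    case (Suc k)
    then obtain g' where g': "\<And>x. x\<in>V \<Longrightarrow> (g has_derivative g' x) (at x)" "\<And>v. (\<lambda>x. g' x v) \<in> G"
      using step by blast
    show ?case
      by (rule Ck_SucI[OF test_function_mult_has_derivative[OF Suc.prems(2) g'(1)]])
         (auto intro!: Ck_add Suc.IH[OF g'(2)] Suc.IH Suc.prems test_function_dir_deriv)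
  qed
  thus ?thesis using closure_subset[of "{x. \<phi> x \<noteq> 0}"]
    by (intro test_functionI[OF _ assms(3)]) auto
qed

lemma holo_mult_test_function:
  fixes g :: "complex^'n \<Rightarrow> complex"
  assumes "open V" "holo_on g V" "test_function V \<phi>"
  shows "test_function V (\<lambda>x. g x * \<phi> x)"
proof (rule test_function_mult_class[where G = "{g. holo_on g V}"])
  fix g :: "complex^'n \<Rightarrow> complex" assume g: "g \<in> {g. holo_on g V}"
  have "\<forall>x\<in>V. (g has_derivative (\<lambda>v. \<Sum>i\<in>UNIV. v $ i * pd i g x)) (at x)"
    using holo_on_has_derivative g by blast
  moreover have "\<forall>v. (\<lambda>x. \<Sum>i\<in>UNIV. v $ i * pd i g x) \<in> {g. holo_on g V}"
    using g assms(1) by (auto intro!: holo_on_sum holo_on_mult holo_on_const holo_on_pd)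
  ultimately show "\<exists>g'. (\<forall>x\<in>V. (g has_derivative g' x) (at x)) \<and> (\<forall>v. (\<lambda>x. g' x v) \<in> {g. holo_on g V})"
    by (intro exI[of _ "\<lambda>x v. \<Sum>i\<in>UNIV. v $ i * pd i g x"]) auto
qed (use assms in auto)

text \<open>
  The operator \<open>\<partial>/\<partial>z\<^sub>i\<close> on functions that are smooth in the real sense; it agrees with \<^const>\<open>pd\<close> on
  holomorphic ones and kills antiholomorphic ones.
\<close>

definition wirtinger :: "'n \<Rightarrow> (complex^'n \<Rightarrow> complex) \<Rightarrow> complex^'n \<Rightarrow> complex" where
  "wirtinger i \<phi> x = (dir_deriv (axis i 1) \<phi> x - \<i> * dir_deriv (axis i \<i>) \<phi> x) / 2"

lemma test_function_wirtinger: 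
  assumes "test_function V \<phi>" shows "test_function V (wirtinger i \<phi>)"
proof -
  have "wirtinger i \<phi> = (\<lambda>x. (1/2) * dir_deriv (axis i 1) \<phi> x + (-\<i>/2) * dir_deriv (axis i \<i>) \<phi> x)"
    by (auto simp: wirtinger_def field_simps)
  thus ?thesis using assms 
    by (simp only:) (intro test_function_add test_function_cmult test_function_dir_deriv)
qed

lemma wirtinger_holo_mult:
  assumes "open V" "holo_on g V" "test_function V \<phi>"
  shows "wirtinger i (\<lambda>x. g x * \<phi> x) x = pd i g x * \<phi> x + g x * wirtinger i \<phi> x"
proof -
  have *: "dir_deriv v (\<lambda>x. g x * \<phi> x) x = (\<Sum>i\<in>UNIV. v $ i * pd i g x) * \<phi> x + g x * dir_deriv v \<phi> x" for v
    using dir_deriv_eq[OF test_function_mult_has_derivative[OF assms(3) holo_on_has_derivative[OF assms(2)]]] .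
  have "(\<Sum>j\<in>UNIV. axis i c $ j * pd j g x) = c * pd i g x" for c
    by (simp add: axis_def if_distrib[of "\<lambda>a. a * _"] sum.delta cong: if_cong)
  thus ?thesis unfolding wirtinger_def * by (simp add: field_simps)
qed

text \<open>
  The functions \<open>t\<^sup>-\<^sup>n e\<^sup>-\<^sup>1\<^sup>/\<^sup>t\<close>, extended by \<open>0\<close>. All exponents \<open>n\<close> are needed at once because
  differentiation maps this family to its linear span, which makes smoothness a plain induction.
\<close>

definition flat_exp :: "nat \<Rightarrow> real \<Rightarrow> real" where
  "flat_exp n t = (if t > 0 then exp (- 1 / t) / t ^ n else 0)"

lemma flat_exp_tendsto_0: "(flat_exp n \<longlongrightarrow> 0) (at_right 0)"
proof -
  have "((\<lambda>u::real. u ^ n / exp u) \<longlongrightarrow> 0) at_top"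
    by (rule tendsto_power_div_exp_0)
  hence "((\<lambda>u. flat_exp n (inverse u)) \<longlongrightarrow> 0) at_top"
    by (rule Lim_transform_eventually)
       (auto simp: flat_exp_def exp_minus field_simps intro!: eventually_mono[OF eventually_gt_at_top[of 0]])
  thus ?thesis by (simp add: filterlim_at_right_to_top)
qed

lemma flat_exp_deriv: 
  "(flat_exp n has_real_derivative flat_exp (n+2) t - real n * flat_exp (n+1) t) (at t)"
proof (cases t "0::real" rule: linorder_cases)
  case less
  have "(flat_exp n has_real_derivative 0) (at t)"
    by (rule has_field_derivative_transform_within_open[of "\<lambda>_. 0" _ _ "{..<0}"])
       (use less in \<open>auto simp: flat_exp_def\<close>)
  thus ?thesis using less by (simp add: flat_exp_def)
next
  case greater
  have "((\<lambda>t. exp (- 1 / t) / t ^ n) has_real_derivative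
      (exp (- 1 / t) * (1 / t\<^sup>2) * t ^ n - exp (- 1 / t) * (real n * t ^ (n - 1))) / (t ^ n * t ^ n)) (at t)"
    using greater by (auto intro!: derivative_eq_intros simp: power2_eq_square)
  moreover have "real n * t ^ (n - 1) = real n * t ^ n / t"
    using greater by (cases n) auto
  moreover have "(exp (- 1 / t) * (1 / t\<^sup>2) * t ^ n - exp (- 1 / t) * (real n * t ^ n / t)) / (t ^ n * t ^ n)
      = flat_exp (n+2) t - real n * flat_exp (n+1) t"
    using greater by (simp add: flat_exp_def field_simps power2_eq_square)
  ultimately have "((\<lambda>t. exp (- 1 / t) / t ^ n) has_real_derivative flat_exp (n+2) t - real n * flat_exp (n+1) t) (at t)"
    by simp
  thus ?thesis
    by (rule has_field_derivative_transform_within_open[of _ _ _ "{0<..}"])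
       (use greater in \<open>auto simp: flat_exp_def\<close>)
next
  case equal
  have "((\<lambda>h. flat_exp n h / h) \<longlongrightarrow> 0) (at_right 0)"
    by (rule Lim_transform_eventually[OF flat_exp_tendsto_0[of "Suc n"]])
       (auto simp: flat_exp_def eventually_at_filter mult_ac)
  moreover have "((\<lambda>h. flat_exp n h / h) \<longlongrightarrow> 0) (at_left 0)"
    by (rule Lim_transform_eventually[OF tendsto_const])
       (auto simp: flat_exp_def eventually_at_filter)
  ultimately have "((\<lambda>h. flat_exp n h / h) \<longlongrightarrow> 0) (at 0)"
    by (rule filterlim_split_at[rotated])
  thus ?thesis using equal by (simp add: DERIV_def flat_exp_def)
qed

lemma Ck_inner_affine: "Ck k (\<lambda>x. c * ((x - a) \<bullet> v))"
proof (cases k)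
  case (Suc m)
  show ?thesis unfolding Suc
    by (rule Ck_SucI[where g' = "\<lambda>x w. c * (w \<bullet> v)"]) (auto intro!: derivative_eq_intros Ck_const)
qed (auto intro!: continuous_intros)

lemma Ck_flat_exp_ball:
  fixes a :: "'a::real_inner"
  shows "Ck k (\<lambda>x. flat_exp n (r\<^sup>2 - (x - a) \<bullet> (x - a)))"
proof (induction k arbitrary: n)
  case 0
  have "continuous_on UNIV (flat_exp n)"
    using flat_exp_deriv by (auto intro!: continuous_at_imp_continuous_on DERIV_isCont)
  hence "continuous_on UNIV (\<lambda>x. flat_exp n (r\<^sup>2 - (x - a) \<bullet> (x - a)))"
    by (rule continuous_on_compose2) (auto intro!: continuous_intros)
  thus ?case by simp
next
  case (Suc k)
  let ?q = "\<lambda>x. r\<^sup>2 - (x - a) \<bullet> (x - a)"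
  let ?d = "\<lambda>t. flat_exp (n+2) t + (- real n) * flat_exp (n+1) t"
  show ?case
  proof (rule Ck_SucI[where g' = "\<lambda>x v. ?d (?q x) * (-2 * ((x - a) \<bullet> v))"])
    fix x :: 'a
    have "(?q has_derivative (\<lambda>v. -2 * ((x - a) \<bullet> v))) (at x)"
      by (auto intro!: derivative_eq_intros simp: inner_commute)
    moreover have "(flat_exp n has_derivative (\<lambda>v. ?d (?q x) * v)) (at (?q x))"
      using flat_exp_deriv[of n "?q x"] by (simp add: has_field_derivative_def)
    ultimately show "((\<lambda>x. flat_exp n (?q x)) has_derivative (\<lambda>v. ?d (?q x) * (-2 * ((x - a) \<bullet> v)))) (at x)"
      by (rule has_derivative_compose)
    show "Ck k (\<lambda>x. ?d (?q x) * (-2 * ((x - a) \<bullet> v)))" for v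
      by (intro Ck_mult Ck_add Ck_inner_affine Suc Ck_const)
  qed
qed

definition bump :: "complex^'n \<Rightarrow> real \<Rightarrow> complex^'n \<Rightarrow> complex" where
  "bump a r x = of_real (flat_exp 0 (r\<^sup>2 - (x - a) \<bullet> (x - a)))"

lemma Ck_bump: "Ck k (bump a r)"
  unfolding bump_def by (intro Ck_bounded_linear[OF bounded_linear_of_real] Ck_flat_exp_ball)

lemma bump_eq_0_iff: "r > 0 \<Longrightarrow> bump a r x = 0 \<longleftrightarrow> x \<notin> ball a r"
  using power2_less_imp_less[of "norm (x - a)" r] power_strict_mono[of "norm (x - a)" r 2]
  by (auto simp: bump_def flat_exp_def dist_norm norm_minus_commute power2_norm_eq_inner[symmetric])

lemma bump_nonneg: "bump a r x = of_real \<bar>Re (bump a r x)\<bar>"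
  by (simp add: bump_def flat_exp_def)

text \<open>
  Partition of unity. Finitely many balls with the property cover the support of \<open>\<phi>\<close>; the sum \<open>S\<close> of
  their bump functions does not vanish there, and \<open>\<phi>\<close> is the sum of the \<open>bump \<cdot> \<phi> / S\<close>. All statements about
  \<open>D_X\<close> are local, so this is how they reach arbitrary test functions.
\<close>

lemma test_function_localization:
  fixes X :: "(complex^'n) set"
  assumes loc: "\<And>x. x \<in> X \<Longrightarrow> \<exists>V. open V \<and> x \<in> V \<and> (\<forall>\<phi>. test_function V \<phi> \<longrightarrow> Q \<phi>)"
    and Q0: "Q (\<lambda>_. 0)" and Qadd: "\<And>\<phi> \<psi>. Q \<phi> \<Longrightarrow> Q \<psi> \<Longrightarrow> Q (\<lambda>x. \<phi> x + \<psi> x)"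
    and \<phi>: "test_function X \<phi>"
  shows "Q \<phi>"
proof -
  define K where "K = closure {x. \<phi> x \<noteq> 0}"
  have K: "compact K" "K \<subseteq> X" using \<phi> by (auto simp: K_def test_function_def)
  have "\<forall>x\<in>K. \<exists>p. snd p > 0 \<and> cball x (snd p) \<subseteq> fst p \<and> (\<forall>\<phi>. test_function (fst p) \<phi> \<longrightarrow> Q \<phi>)"
  proof
    fix x assume "x \<in> K"
    hence "x \<in> X" using K(2) by (rule subsetD[rotated])
    from loc[OF this] obtain V where V: "open V" "x \<in> V" "\<forall>\<phi>. test_function V \<phi> \<longrightarrow> Q \<phi>"
      by (elim exE conjE)
    obtain r where "r > 0" "cball x r \<subseteq> V" using V(1,2) open_contains_cball[of V] by auto
    thus "\<exists>p. snd p > 0 \<and> cball x (snd p) \<subseteq> fst p \<and> (\<forall>\<phi>. test_function (fst p) \<phi> \<longrightarrow> Q \<phi>)"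
      using V(3) by (intro exI[of _ "(V, r)"]) simp
  qed
  from bchoice[OF this] obtain p where p: "\<forall>x\<in>K. snd (p x) > 0 \<and> cball x (snd (p x)) \<subseteq> fst (p x)
      \<and> (\<forall>\<phi>. test_function (fst (p x)) \<phi> \<longrightarrow> Q \<phi>)" ..
  define V r where "V x = fst (p x)" and "r x = snd (p x)" for x
  have V: "r x > 0" "cball x (r x) \<subseteq> V x" "test_function (V x) \<phi> \<Longrightarrow> Q \<phi>" if "x \<in> K" for x \<phi>
    using p that by (simp_all add: V_def r_def)
  have "K \<subseteq> (\<Union>x\<in>K. ball x (r x))" using V(1) by force
  then obtain D where D: "D \<subseteq> K" "finite D" "K \<subseteq> (\<Union>x\<in>D. ball x (r x))"
    using compactE_image[OF K(1), of K "\<lambda>x. ball x (r x)"] by auto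
  define S where "S x = (\<Sum>a\<in>D. bump a (r a) x)" for x
  have CkS: "Ck k S" for k unfolding S_def by (intro Ck_sum Ck_bump)
  define W where "W = {x. S x \<noteq> 0}"
  have "K \<subseteq> W"
  proof
    fix x assume "x \<in> K"
    then obtain a where a: "a \<in> D" "x \<in> ball a (r a)" using D by blast
    have "S x = of_real (\<Sum>a\<in>D. \<bar>Re (bump a (r a) x)\<bar>)"
      unfolding S_def of_real_sum by (intro sum.cong refl bump_nonneg)
    moreover have "bump a (r a) x \<noteq> 0" using a D V(1) by (auto simp: bump_eq_0_iff subset_iff)
    hence "\<bar>Re (bump a (r a) x)\<bar> \<noteq> 0" using bump_nonneg by (metis of_real_0)
    hence "(\<Sum>a\<in>D. \<bar>Re (bump a (r a) x)\<bar>) \<noteq> 0" using D(2) a(1) by (subst sum_nonneg_eq_0_iff) auto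
    ultimately show "x \<in> W" by (simp add: W_def del: of_real_sum)
  qed
  hence \<phi>W: "test_function W \<phi>" using \<phi> by (auto simp: test_function_def K_def)
  \<comment> \<open>Quotients by powers of \<open>S\<close> are smooth on \<open>W\<close>.\<close>
  let ?G = "{\<lambda>x. a x / S x ^ n |a n. \<forall>k. Ck k a}"
  have "test_function W (\<lambda>x. (1 / S x) * \<phi> x)"
  proof (rule test_function_mult_class[where G = ?G])
    show "(\<lambda>x. 1 / S x) \<in> ?G"
      by (intro CollectI exI[of _ "\<lambda>_. 1"] exI[of _ "1::nat"]) (simp add: Ck_const)
  next
    fix g assume "g \<in> ?G"
    then obtain a n where a: "g = (\<lambda>x. a x / S x ^ n)" "\<And>k. Ck k a" by blast
    have "\<exists>a'. (\<forall>x. (a has_derivative a' x) (at x)) \<and> (\<forall>k v. Ck k (\<lambda>x. a' x v))" if Cka: "\<And>k. Ck k a" for a :: "complex^'n \<Rightarrow> complex"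
    proof -
      obtain a' where a': "\<And>x. (a has_derivative a' x) (at x)" using Cka[of 1] by auto
      have "Ck k (\<lambda>x. a' x v)" for k v
      proof -
        obtain a'' where "\<And>x. (a has_derivative a'' x) (at x)" "\<And>v. Ck k (\<lambda>x. a'' x v)" using Cka[of "Suc k"] by auto
        moreover from this have "a'' = a'" using a' has_derivative_unique by blast
        ultimately show ?thesis by blast
      qed
      thus ?thesis using a' by blast
    qed
    then obtain a' S' where a': "\<And>x. (a has_derivative a' x) (at x)" "\<And>k v. Ck k (\<lambda>x. a' x v)"
      and S': "\<And>x. (S has_derivative S' x) (at x)" "\<And>k v. Ck k (\<lambda>x. S' x v)" using a(2) CkS by metis
    let ?g' = "\<lambda>x v. (a' x v * S x + (- of_nat n * a x) * S' x v) / S x ^ (n + 1)"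
    have "\<forall>x\<in>W. (g has_derivative ?g' x) (at x)"
    proof
      fix x assume "x \<in> W"
      hence [simp]: "S x \<noteq> 0" by (simp add: W_def)
      have "((\<lambda>x. S x ^ n) has_derivative (\<lambda>v. of_nat n * S' x v * S x ^ (n - 1))) (at x)"
        by (rule has_derivative_power[OF S'(1)])
      hence "(g has_derivative (\<lambda>v. - a x * (inverse (S x ^ n) * (of_nat n * S' x v * S x ^ (n - 1)) * inverse (S x ^ n))
          + a' x v / S x ^ n)) (at x)"
        unfolding a(1) by (intro has_derivative_divide a'(1)) auto
      moreover have "- a x * (inverse (S x ^ n) * (of_nat n * S' x v * S x ^ (n - 1)) * inverse (S x ^ n))
          + a' x v / S x ^ n = ?g' x v" for v
      proof -
        have "of_nat n * S' x v * S x ^ (n - 1) = of_nat n * S' x v * S x ^ n / S x"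
          by (cases n) auto
        thus ?thesis by (simp only:) (simp add: field_simps)
      qed
      ultimately show "(g has_derivative ?g' x) (at x)" by simp
    qed
    moreover have "\<forall>v. (\<lambda>x. ?g' x v) \<in> ?G"
    proof
      fix v
      have "\<forall>k. Ck k (\<lambda>x. a' x v * S x + (- of_nat n * a x) * S' x v)"
        by (intro allI Ck_add Ck_mult a'(2) CkS S'(2) Ck_const a(2))
      thus "(\<lambda>x. ?g' x v) \<in> ?G"
        by (intro CollectI exI[of _ "\<lambda>x. a' x v * S x + (- of_nat n * a x) * S' x v"] exI[of _ "n + 1"] conjI refl)
    qed
    ultimately show "\<exists>g'. (\<forall>x\<in>W. (g has_derivative g' x) (at x)) \<and> (\<forall>v. (\<lambda>x. g' x v) \<in> ?G)"
      by (intro exI[of _ ?g'] conjI)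
  qed (rule \<phi>W)
  hence piece: "test_function W (\<lambda>x. bump a (r a) x * ((1 / S x) * \<phi> x))" for a
    by (rule test_function_mult[OF _ Ck_bump])
  have Qp: "Q (\<lambda>x. bump a (r a) x * ((1 / S x) * \<phi> x))" (is "Q ?p") if "a \<in> D" for a
  proof (rule V(3))
    show "a \<in> K" using that D by blast
    have "{x. ?p x \<noteq> 0} \<subseteq> cball a (r a)" using V(1)[OF \<open>a \<in> K\<close>] by (auto simp: bump_eq_0_iff)
    hence "closure {x. ?p x \<noteq> 0} \<subseteq> V a" 
      by (rule order_trans[OF closure_minimal[OF _ closed_cball] V(2)[OF \<open>a \<in> K\<close>]])
    thus "test_function (V a) ?p" using piece by (simp add: test_function_def)
  qed
  have "Q (\<lambda>x. \<Sum>a\<in>D'. bump a (r a) x * ((1 / S x) * \<phi> x))" if "finite D'" "D' \<subseteq> D" for D'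
    using that by (induction D') (simp_all only: sum.empty sum.insert Q0 Qadd Qp insert_subset not_False_eq_True)
  from this[OF D(2) order_refl] have "Q (\<lambda>x. \<Sum>a\<in>D. bump a (r a) x * ((1 / S x) * \<phi> x))" .
  moreover have "(\<Sum>a\<in>D. bump a (r a) x * ((1 / S x) * \<phi> x)) = \<phi> x" for x
  proof (cases "x \<in> W")
    case True
    hence "S x \<noteq> 0" by (simp add: W_def)
    moreover have "(\<Sum>a\<in>D. bump a (r a) x * ((1 / S x) * \<phi> x)) = S x * ((1 / S x) * \<phi> x)"
      unfolding S_def by (simp only: sum_distrib_right)
    ultimately show ?thesis by simp
  next
    case False
    thus ?thesis using test_function_zero_outside[OF \<phi>W] by simp
  qed
  ultimately show ?thesis by simp
qed

section \<open>Zeta integrals with integer twists\<close>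

text \<open>
  The function \<open>|w|\<^sup>2\<^sup>s w\<^sup>k (cnj w)\<^sup>l\<close>. Its modulus has the exponent \<open>2 Re s + k + l\<close>; where this is positive,
  the value \<open>0\<close> at \<open>w = 0\<close> is the continuous one. That value also makes the zero set of \<open>f\<close> harmless: pointwise
  identities are needed only where \<open>f \<noteq> 0\<close>.
\<close>

definition zeta_kernel :: "complex \<Rightarrow> int \<Rightarrow> int \<Rightarrow> complex \<Rightarrow> complex" where
  "zeta_kernel s k l w =
     (if w = 0 then 0 else exp (2 * s * of_real (ln (cmod w))) * w powi k * cnj w powi l)"

lemma zeta_kernel_0 [simp]: "zeta_kernel s k l 0 = 0"
  by (simp add: zeta_kernel_def)

lemma powr_eq_zeta_kernel: "complex_of_real (cmod w) powr (2 * s) = zeta_kernel s 0 0 w"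
  by (simp add: zeta_kernel_def powr_def Ln_of_real)

lemma norm_zeta_kernel: "cmod (zeta_kernel s k l w) = cmod w powr (2 * Re s + of_int k + of_int l)"
proof (cases "w = 0")
  case False
  hence "cmod (zeta_kernel s k l w) = exp (2 * Re s * ln (cmod w)) * cmod w powi k * cmod w powi l"
    by (simp add: zeta_kernel_def norm_mult norm_power_int)
  also have "\<dots> = cmod w powr (2 * Re s) * cmod w powr of_int k * cmod w powr of_int l"
    using False by (simp add: powr_def[of _ "2 * Re s"] powr_real_of_int')
  finally show ?thesis by (simp add: powr_add)
qed simp

lemma zeta_kernel_add: "w \<noteq> 0 \<Longrightarrow> zeta_kernel s (k + m) l w = zeta_kernel s k l w * w powi m"
  by (simp add: zeta_kernel_def power_int_add)

lemma cnj_zeta_kernel: "cnj (zeta_kernel s k l w) = zeta_kernel (cnj s) l k w"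
  by (simp add: zeta_kernel_def exp_cnj power_int_def mult_ac)

lemma holomorphic_zeta_kernel: "(\<lambda>s. zeta_kernel s k l w) holomorphic_on A"
  unfolding zeta_kernel_def by (cases "w = 0") (auto intro!: holomorphic_intros)

lemma continuous_on_zeta_kernel:
  assumes "2 * Re s + of_int k + of_int l > 0"
  shows "continuous_on UNIV (zeta_kernel s k l)"
proof (rule continuous_at_imp_continuous_on, rule ballI)
  fix w :: complex
  show "isCont (zeta_kernel s k l) w"
  proof (cases "w = 0")
    case False
    have "isCont (\<lambda>w. exp (2 * s * of_real (ln (cmod w))) * w powi k * cnj w powi l) w"
      using False by (intro continuous_intros) auto
    moreover have "eventually (\<lambda>w. exp (2 * s * of_real (ln (cmod w))) * w powi k * cnj w powi l = zeta_kernel s k l w) (nhds w)"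
      using False by (intro eventually_mono[OF t1_space_nhds[of w 0]]) (auto simp: zeta_kernel_def)
    ultimately show ?thesis by (simp add: isCont_cong)
  next
    case True
    have "((\<lambda>w::complex. cmod w powr (2 * Re s + of_int k + of_int l)) \<longlongrightarrow> 0) (at 0)"
      by (rule tendsto_zero_powrI[where b = "2 * Re s + of_int k + of_int l"]) 
         (use assms in \<open>auto intro!: tendsto_norm_zero tendsto_eq_intros\<close>)
    hence "(zeta_kernel s k l \<longlongrightarrow> 0) (at 0)"
      unfolding norm_zeta_kernel[symmetric] by (rule tendsto_norm_zero_cancel)
    thus ?thesis using True by (simp add: isCont_def)
  qed
qed

text \<open>
  For exponent above \<open>1\<close> the kernel is differentiable at \<open>0\<close> too, with derivative \<open>0\<close>, and the formula
  holds there because kernels vanish at \<open>0\<close>. So the chain rule applies to \<open>zeta_kernel s k l (f x)\<close> at every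
  point of the domain of \<open>f\<close>, zeros included.
\<close>

lemma zeta_kernel_has_derivative:
  assumes "2 * Re s + of_int k + of_int l > 1"
  shows "(zeta_kernel s k l has_derivative (\<lambda>h. (s + of_int k) * zeta_kernel s (k - 1) l w * h
           + (s + of_int l) * zeta_kernel s k (l - 1) w * cnj h)) (at w)"
proof (cases "w = 0")
  case False
  have ln: "((\<lambda>w. ln (cmod w)) has_derivative (\<lambda>h. (w \<bullet> h) / (cmod w)\<^sup>2)) (at w)"
    using False by (auto intro!: derivative_eq_intros has_derivative_norm simp: sgn_div_norm power2_eq_square divide_simps inner_commute)
  have inn: "2 * complex_of_real ((w \<bullet> h) / (cmod w)\<^sup>2) = h / w + cnj h / cnj w" for h
  proof -
    have "2 * complex_of_real (w \<bullet> h) = cnj w * h + w * cnj h"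
      by (simp add: complex_eq_iff inner_complex_def)
    moreover have "complex_of_real ((cmod w)\<^sup>2) = w * cnj w" by (rule complex_norm_square)
    ultimately show ?thesis using False by (simp add: field_simps)
  qed
  have pk: "((\<lambda>w. w powi k) has_derivative (\<lambda>h. of_int k * w powi (k - 1) * h)) (at w)"
    using DERIV_power_int[OF DERIV_ident, where n = k and x = w and s = UNIV] False by (simp add: has_field_derivative_def)
  have "((\<lambda>w. w powi l) has_derivative (\<lambda>h. of_int l * cnj w powi (l - 1) * h)) (at (cnj w))"
    using DERIV_power_int[OF DERIV_ident, where n = l and x = "cnj w" and s = UNIV] False by (simp add: has_field_derivative_def)
  from has_derivative_compose[OF bounded_linear_imp_has_derivative[OF bounded_linear_cnj] this]
  have pl: "((\<lambda>w. cnj w powi l) has_derivative (\<lambda>h. of_int l * cnj w powi (l - 1) * cnj h)) (at w)" .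
  let ?L = "complex_of_real (ln (cmod w))"
  have ex: "((\<lambda>w. exp (2 * s * of_real (ln (cmod w)))) has_derivative
      (\<lambda>h. exp (2 * s * ?L) * (s * (h / w + cnj h / cnj w)))) (at w)"
  proof -
    have "((\<lambda>w. 2 * s * of_real (ln (cmod w))) has_derivative (\<lambda>h. 2 * s * of_real ((w \<bullet> h) / (cmod w)\<^sup>2))) (at w)"
      by (intro has_derivative_mult_right has_derivative_of_real ln)
    from has_derivative_compose[OF this DERIV_exp[unfolded has_field_derivative_def]]
    have "((\<lambda>w. exp (2 * s * of_real (ln (cmod w)))) has_derivative
      (\<lambda>h. exp (2 * s * ?L) * (2 * s * of_real ((w \<bullet> h) / (cmod w)\<^sup>2)))) (at w)" .
    moreover have "exp (2 * s * ?L) * (2 * s * of_real ((w \<bullet> h) / (cmod w)\<^sup>2)) = exp (2 * s * ?L) * (s * (h / w + cnj h / cnj w))" for h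
      unfolding inn[symmetric] by (simp only: mult_ac)
    ultimately show ?thesis by (simp only:)
  qed
  have "((\<lambda>w. exp (2 * s * of_real (ln (cmod w))) * w powi k * cnj w powi l) has_derivative
     (\<lambda>h. exp (2 * s * ?L) * w powi k * (of_int l * cnj w powi (l - 1) * cnj h)
        + (exp (2 * s * ?L) * (of_int k * w powi (k - 1) * h)
           + exp (2 * s * ?L) * (s * (h / w + cnj h / cnj w)) * w powi k) * cnj w powi l)) (at w)"
    by (intro has_derivative_mult ex pk pl)
  moreover have "exp (2 * s * ?L) * w powi k * (of_int l * cnj w powi (l - 1) * cnj h)
        + (exp (2 * s * ?L) * (of_int k * w powi (k - 1) * h)
           + exp (2 * s * ?L) * (s * (h / w + cnj h / cnj w)) * w powi k) * cnj w powi l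
      = (s + of_int k) * zeta_kernel s (k - 1) l w * h + (s + of_int l) * zeta_kernel s k (l - 1) w * cnj h" for h
    using False by (simp add: zeta_kernel_def power_int_diff field_simps)
  ultimately have "((\<lambda>w. exp (2 * s * of_real (ln (cmod w))) * w powi k * cnj w powi l) has_derivative
     (\<lambda>h. (s + of_int k) * zeta_kernel s (k - 1) l w * h + (s + of_int l) * zeta_kernel s k (l - 1) w * cnj h)) (at w)"
    by simp
  thus ?thesis
    by (rule has_derivative_transform_within_open[of _ _ _ _ "-{0}"]) (use False in \<open>auto simp: zeta_kernel_def\<close>)
next
  case True
  have "((\<lambda>h::complex. cmod h powr (2 * Re s + of_int k + of_int l - 1)) \<longlongrightarrow> 0) (at 0)"
    by (rule tendsto_zero_powrI[where b = "2 * Re s + of_int k + of_int l - 1"]) 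
       (use assms in \<open>auto intro!: tendsto_norm_zero tendsto_eq_intros\<close>)
  hence "((\<lambda>h. cmod (zeta_kernel s k l h) / cmod h) \<longlongrightarrow> 0) (at 0)"
    by (rule Lim_transform_eventually)
       (auto simp: norm_zeta_kernel powr_diff eventually_at_filter)
  thus ?thesis using True by (simp add: has_derivative_at)
qed

lemma norm_zeta_kernel_le:
  assumes "cmod w \<le> M" "2 * Re s + of_int k + of_int l \<le> A" "2 * Re s + of_int k + of_int l > 0"
  shows "cmod (zeta_kernel s k l w) \<le> max 1 M powr A"
proof -
  have "cmod w powr (2 * Re s + of_int k + of_int l) \<le> max 1 M powr (2 * Re s + of_int k + of_int l)"
    using assms by (intro powr_mono2) auto
  also have "\<dots> \<le> max 1 M powr A" using assms by (intro powr_mono) auto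
  finally show ?thesis by (simp add: norm_zeta_kernel)
qed

text \<open>
  Cauchy's inequality turns the local bound on \<open>h\<close> into a bound on the difference quotients, so
  dominated convergence applies without a separate bound on derivatives.
\<close>

lemma holomorphic_on_lebesgue_integral:
  fixes h :: "complex \<Rightarrow> 'a \<Rightarrow> complex"
  assumes S: "open S" and hol: "\<And>x. (\<lambda>s. h s x) holomorphic_on S"
    and meas: "\<And>s. s \<in> S \<Longrightarrow> h s \<in> borel_measurable M"
    and bound: "\<And>s0. s0 \<in> S \<Longrightarrow> \<exists>r>0. \<exists>B. cball s0 r \<subseteq> S \<and> integrable M B \<and> (\<forall>s\<in>cball s0 r. \<forall>x. norm (h s x) \<le> B x)"
  shows "(\<lambda>s. \<integral>x. h s x \<partial>M) holomorphic_on S"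
proof (rule holomorphic_onI)
  fix s0 assume s0: "s0 \<in> S"
  then obtain r B where r: "r > 0" "cball s0 r \<subseteq> S" and B: "integrable M B"
    "\<And>s x. s \<in> cball s0 r \<Longrightarrow> norm (h s x) \<le> B x" using bound by metis
  have int: "integrable M (h s)" if "s \<in> cball s0 r" for s
    using that r by (intro Bochner_Integration.integrable_bound[OF B(1) meas]) (auto intro!: AE_I2 order_trans[OF B(2) abs_ge_self])
  define q where "q y x = (h y x - h s0 x) / (y - s0)" for y x
  have q_le: "norm (q y x) \<le> 2 / r * B x" if y: "y \<in> cball s0 (r/2)" "y \<noteq> s0" for y x
  proof -
    have "norm (deriv (\<lambda>s. h s x) z) \<le> 2 / r * B x" if z: "z \<in> cball s0 (r/2)" for z
    proof -
      have sub: "cball z (r/2) \<subseteq> cball s0 r" 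
        using z by (intro cball_subset_cball_iff[THEN iffD2]) (auto simp: dist_commute)
      have "norm ((deriv ^^ 1) (\<lambda>s. h s x) z) \<le> fact 1 * B x / (r/2) ^ 1"
      proof (rule Cauchy_inequality)
        show "(\<lambda>s. h s x) holomorphic_on ball z (r/2)"
          by (rule holomorphic_on_subset[OF hol]) (use sub r ball_subset_cball in blast)
        show "continuous_on (cball z (r/2)) (\<lambda>s. h s x)"
          by (rule holomorphic_on_imp_continuous_on[OF holomorphic_on_subset[OF hol]]) (use sub r in blast)
        show "norm (h u x) \<le> B x" if "norm (z - u) = r/2" for u
          using that sub by (intro B(2)) (auto simp: dist_norm)
      qed (use r in auto)
      thus ?thesis by (simp add: field_simps)
    qed
    moreover have "((\<lambda>s. h s x) has_field_derivative deriv (\<lambda>s. h s x) z) (at z within cball s0 (r/2))" if "z \<in> cball s0 (r/2)" for z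
    proof -
      have "z \<in> S" using that r by (intro subsetD[OF r(2)]) auto
      thus ?thesis using hol S by (metis has_field_derivative_at_within holomorphic_derivI)
    qed
    ultimately have "norm (h y x - h s0 x) \<le> 2 / r * B x * norm (y - s0)"
      using y r by (intro field_differentiable_bound[of "cball s0 (r/2)"]) auto
    thus ?thesis using y(2) by (simp add: q_def norm_divide field_simps)
  qed
  have "((\<lambda>y. ((\<integral>x. h y x \<partial>M) - (\<integral>x. h s0 x \<partial>M)) / (y - s0)) \<longlongrightarrow> (\<integral>x. deriv (\<lambda>s. h s x) s0 \<partial>M)) (at s0)"
    unfolding tendsto_at_iff_sequentially comp_def
  proof (intro allI impI)
    fix y assume y: "\<forall>i. y i \<in> UNIV - {s0}" "y \<longlonglongrightarrow> s0"
    have "eventually (\<lambda>n. y n \<in> ball s0 (r/2)) sequentially"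
      using y(2) r(1) by (metis centre_in_ball half_gt_zero open_ball topological_tendstoD)
    then obtain N where N: "\<And>n. n \<ge> N \<Longrightarrow> y n \<in> ball s0 (r/2)" by (auto simp: eventually_at_top_linorder)
    let ?y = "\<lambda>n. y (n + N)"
    have yb: "?y n \<in> cball s0 (r/2)" "?y n \<in> cball s0 r" "?y n \<noteq> s0" for n
      using N[of "n + N"] y(1) r(1) by auto
    have y': "?y \<longlonglongrightarrow> s0" using y(2) by (rule LIMSEQ_ignore_initial_segment)
    have qlim: "(\<lambda>n. q (?y n) x) \<longlonglongrightarrow> deriv (\<lambda>s. h s x) s0" for x
    proof -
      have "((\<lambda>s. h s x) has_field_derivative deriv (\<lambda>s. h s x) s0) (at s0)"
        using holomorphic_derivI[OF hol S s0] .
      hence "((\<lambda>y. q y x) \<longlongrightarrow> deriv (\<lambda>s. h s x) s0) (at s0)"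
        by (simp add: has_field_derivative_iff q_def)
      thus ?thesis using y' yb(3) unfolding tendsto_at_iff_sequentially comp_def by auto
    qed
    have qmeas: "q (?y n) \<in> borel_measurable M" for n
      unfolding q_def using meas[of "?y n"] meas[of s0] s0 yb(2)[of n] r(2) by (auto intro!: borel_measurable_divide borel_measurable_diff)
    have "(\<lambda>n. \<integral>x. q (?y n) x \<partial>M) \<longlonglongrightarrow> (\<integral>x. deriv (\<lambda>s. h s x) s0 \<partial>M)"
    proof (rule integral_dominated_convergence[where w = "\<lambda>x. 2 / r * B x"])
      show "(\<lambda>x. deriv (\<lambda>s. h s x) s0) \<in> borel_measurable M"
        by (rule borel_measurable_LIMSEQ_metric[OF qmeas qlim])
    qed (use B qmeas qlim q_le[OF yb(1,3)] in auto)
    moreover have "(\<integral>x. q (?y n) x \<partial>M) = ((\<integral>x. h (?y n) x \<partial>M) - (\<integral>x. h s0 x \<partial>M)) / (?y n - s0)" for n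
      unfolding q_def using int[OF yb(2)[of n]] int[of s0] r(1) by simp
    ultimately have "(\<lambda>n. ((\<integral>x. h (?y n) x \<partial>M) - (\<integral>x. h s0 x \<partial>M)) / (?y n - s0)) \<longlonglongrightarrow> (\<integral>x. deriv (\<lambda>s. h s x) s0 \<partial>M)"
      by simp
    thus "(\<lambda>n. ((\<integral>x. h (y n) x \<partial>M) - (\<integral>x. h s0 x \<partial>M)) / (y n - s0)) \<longlonglongrightarrow> (\<integral>x. deriv (\<lambda>s. h s x) s0 \<partial>M)"
      by (rule LIMSEQ_offset)
  qed
  hence "((\<lambda>s. \<integral>x. h s x \<partial>M) has_field_derivative (\<integral>x. deriv (\<lambda>s. h s x) s0 \<partial>M)) (at s0)"
    by (simp only: has_field_derivative_iff)
  thus "(\<lambda>s. \<integral>x. h s x \<partial>M) field_differentiable at s0 within S"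
    unfolding field_differentiable_def by (intro exI) (rule has_field_derivative_at_within)
qed

lemma continuous_on_compose_mult_test_function:
  fixes f :: "complex^'n \<Rightarrow> complex" and e :: "complex \<Rightarrow> complex"
  assumes X: "open X" "continuous_on X f" and e: "continuous_on UNIV e" and \<phi>: "test_function X \<phi>"
  shows "continuous_on UNIV (\<lambda>x. e (f x) * \<phi> x)"
proof (rule continuous_at_imp_continuous_on, rule ballI)
  fix x
  show "isCont (\<lambda>x. e (f x) * \<phi> x) x"
  proof (cases "x \<in> X")
    case True
    hence "isCont f x" using X continuous_on_eq_continuous_at by blast
    moreover have "isCont e (f x)" "isCont \<phi> x" 
      using e test_function_continuous[OF \<phi>] by (auto simp: continuous_on_eq_continuous_at)
    ultimately show ?thesis by (intro continuous_mult isCont_o2[of _ f e])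
  next
    case False
    then obtain W where W: "open W" "x \<in> W" "\<And>y. y \<in> W \<Longrightarrow> \<phi> y = 0"
      by (rule test_function_zero_near[OF \<phi>]) (rule that)
    hence "eventually (\<lambda>y. e (f y) * \<phi> y = 0) (nhds x)"
      unfolding eventually_nhds by (intro exI[of _ W]) simp
    from isCont_cong[OF this] show ?thesis by simp
  qed
qed

lemma integrable_compose_mult_test_function:
  fixes f :: "complex^'n \<Rightarrow> complex" and e :: "complex \<Rightarrow> complex"
  assumes X: "open X" "continuous_on X f" and e: "continuous_on UNIV e" and \<phi>: "test_function X \<phi>"
  shows "integrable lborel (\<lambda>x. e (f x) * \<phi> x)"
proof -
  let ?K = "closure {x. \<phi> x \<noteq> 0}"
  have "integrable lborel (\<lambda>x. indicator ?K x *\<^sub>R (e (f x) * \<phi> x))"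
    using \<phi> by (intro borel_integrable_compact continuous_on_subset[OF continuous_on_compose_mult_test_function[OF assms]])
               (auto simp: test_function_def)
  moreover have "indicator ?K x *\<^sub>R (e (f x) * \<phi> x) = e (f x) * \<phi> x" for x
    using closure_subset[of "{x. \<phi> x \<noteq> 0}"] by (auto simp: indicator_def)
  ultimately show ?thesis by simp
qed

definition zeta_integral :: "(complex^'n \<Rightarrow> complex) \<Rightarrow> int \<Rightarrow> int \<Rightarrow> (complex^'n \<Rightarrow> complex) \<Rightarrow> complex \<Rightarrow> complex" where
  "zeta_integral f k l \<phi> s = (\<integral>x. zeta_kernel s k l (f x) * \<phi> x \<partial>lborel)"

lemma integrable_zeta_integral:
  assumes "open X" "continuous_on X f" "test_function X \<phi>" "2 * Re s + of_int k + of_int l > 0"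
  shows "integrable lborel (\<lambda>x. zeta_kernel s k l (f x) * \<phi> x)"
  by (rule integrable_compose_mult_test_function[OF assms(1,2) continuous_on_zeta_kernel[OF assms(4)] assms(3)])

lemma zeta_integral_add:
  assumes "open X" "continuous_on X f" "test_function X \<phi>" "test_function X \<psi>" "2 * Re s + of_int k + of_int l > 0"
  shows "zeta_integral f k l (\<lambda>x. \<phi> x + \<psi> x) s = zeta_integral f k l \<phi> s + zeta_integral f k l \<psi> s"
  unfolding zeta_integral_def using assms
  by (simp add: ring_distribs Bochner_Integration.integral_add[OF integrable_zeta_integral integrable_zeta_integral])

lemma zeta_integral_cmult: "zeta_integral f k l (\<lambda>x. c * \<phi> x) s = c * zeta_integral f k l \<phi> s"
  unfolding zeta_integral_def by (simp add: mult.left_commute[of _ c])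

lemma zeta_integral_0: "zeta_integral f k l (\<lambda>_. 0) s = 0"
  unfolding zeta_integral_def by simp

lemma cnj_zeta_integral: "cnj (zeta_integral f k l \<phi> s) = zeta_integral f l k (\<lambda>x. cnj (\<phi> x)) (cnj s)"
  unfolding zeta_integral_def Bochner_Integration.integral_cnj[symmetric] by (simp only: complex_cnj_mult cnj_zeta_kernel)

lemma holomorphic_zeta_integral:
  assumes X: "open X" "continuous_on X f" and \<phi>: "test_function X \<phi>"
  shows "zeta_integral f k l \<phi> holomorphic_on {s. 2 * Re s + of_int k + of_int l > 0}"
  unfolding zeta_integral_def
proof (rule holomorphic_on_lebesgue_integral)
  let ?S = "{s. 2 * Re s + of_int k + of_int l > 0}"
  show S: "open ?S" by (intro open_Collect_less continuous_intros)
  show "(\<lambda>s. zeta_kernel s k l (f x) * \<phi> x) holomorphic_on ?S" for x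
    by (intro holomorphic_intros holomorphic_zeta_kernel)
  show "(\<lambda>x. zeta_kernel s k l (f x) * \<phi> x) \<in> borel_measurable lborel" if "s \<in> ?S" for s
    using integrable_zeta_integral[OF X \<phi>] that by (intro borel_measurable_integrable) auto
  fix s0 assume "s0 \<in> ?S"
  then obtain r where r: "r > 0" "cball s0 r \<subseteq> ?S" using S open_contains_cball by metis
  let ?K = "closure {x. \<phi> x \<noteq> 0}"
  have "compact ?K" "?K \<subseteq> X" using \<phi> by (auto simp: test_function_def)
  hence "compact (f ` ?K)" using X(2) by (meson compact_continuous_image continuous_on_subset)
  from compact_imp_bounded[OF this] obtain M where "\<forall>y\<in>f ` ?K. cmod y \<le> M"
    unfolding bounded_iff by (elim exE)
  hence M: "cmod (f x) \<le> M" if "x \<in> ?K" for x using that by blast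
  define A where "A = 2 * (Re s0 + r) + of_int k + of_int l"
  have "integrable lborel (\<lambda>x. norm (max 1 M powr A * \<phi> x))"
    using integrable_compose_mult_test_function[OF X _ \<phi>, of "\<lambda>_. complex_of_real (max 1 M powr A)"]
    by (intro integrable_norm) (auto intro!: continuous_intros)
  moreover have "norm (zeta_kernel s k l (f x) * \<phi> x) \<le> norm (max 1 M powr A * \<phi> x)" if s: "s \<in> cball s0 r" for s x
  proof (cases "x \<in> ?K")
    case True
    have "Re s \<le> Re s0 + r" using s complex_Re_le_cmod[of "s - s0"] by (auto simp: dist_norm norm_minus_commute)
    hence "norm (zeta_kernel s k l (f x)) \<le> max 1 M powr A"
      using s r(2) by (intro norm_zeta_kernel_le M True) (auto simp: A_def)
    thus ?thesis by (simp add: norm_mult mult_right_mono)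
  next
    case False
    hence "\<phi> x = 0" using closure_subset[of "{x. \<phi> x \<noteq> 0}"] by auto
    thus ?thesis by simp
  qed
  ultimately show "\<exists>r>0. \<exists>B. cball s0 r \<subseteq> ?S \<and> integrable lborel B \<and>
      (\<forall>s\<in>cball s0 r. \<forall>x. norm (zeta_kernel s k l (f x) * \<phi> x) \<le> B x)"
    using r by blast
qed

section \<open>Integration by parts\<close>

text \<open>
  The integral of \<open>H (x + t v)\<close> does not depend on \<open>t\<close>, by translation invariance; differentiate
  at \<open>t = 0\<close>. This gives integration by parts without Fubini's theorem.
\<close>

lemma integral_directional_derivative_eq_0:
  fixes H :: "'a::euclidean_space \<Rightarrow> complex"
  assumes der: "\<And>x. (H has_derivative H' x) (at x)" and cont: "continuous_on UNIV (\<lambda>x. H' x v)"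
    and K: "compact K" "\<And>x. x \<notin> K \<Longrightarrow> H x = 0"
  shows "(\<integral>x. H' x v \<partial>lborel) = 0"
proof -
  have H'0: "H' x v = 0" if "x \<notin> K" for x
  proof -
    have "(H has_derivative (\<lambda>_. 0)) (at x)"
      by (rule has_derivative_transform_within_open[of "\<lambda>_. 0" _ _ _ "- K"])
         (use that K compact_imp_closed in auto)
    thus ?thesis using has_derivative_unique[OF der] by metis
  qed
  have "compact ((\<lambda>x. H' x v) ` K)" using cont K(1) by (meson compact_continuous_image continuous_on_subset subset_UNIV)
  then obtain C where C: "\<And>x. x \<in> K \<Longrightarrow> norm (H' x v) \<le> C" "C > 0"
    using compact_imp_bounded bounded_pos by (metis (no_types, lifting) imageI)
  have C': "norm (H' x v) \<le> C" for x using C H'0[of x] by (cases "x \<in> K") auto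
  have lip: "norm (H (x + t *\<^sub>R v) - H x) \<le> C * t" if "t \<ge> 0" for x t
  proof -
    have "norm (H (x + t *\<^sub>R v) - H (x + 0 *\<^sub>R v)) \<le> C * norm (t - 0)"
    proof (rule differentiable_bound[of "{0..t}" "\<lambda>u. H (x + u *\<^sub>R v)" "\<lambda>u h. h *\<^sub>R H' (x + u *\<^sub>R v) v"])
      fix u
      have "((\<lambda>u. x + u *\<^sub>R v) has_derivative (\<lambda>h. h *\<^sub>R v)) (at u within {0..t})"
        by (auto intro!: derivative_eq_intros)
      from has_derivative_compose[OF this der]
      have "((\<lambda>u. H (x + u *\<^sub>R v)) has_derivative (\<lambda>h. H' (x + u *\<^sub>R v) (h *\<^sub>R v))) (at u within {0..t})" .
      moreover have "H' (x + u *\<^sub>R v) (h *\<^sub>R v) = h *\<^sub>R H' (x + u *\<^sub>R v) v" for h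
        using has_derivative_linear[OF der] by (simp add: linear_cmul)
      ultimately show "((\<lambda>u. H (x + u *\<^sub>R v)) has_derivative (\<lambda>h. h *\<^sub>R H' (x + u *\<^sub>R v) v)) (at u within {0..t})"
        by simp
      show "onorm (\<lambda>h. h *\<^sub>R H' (x + u *\<^sub>R v) v) \<le> C"
        by (rule onorm_le) (use C'[of "x + u *\<^sub>R v"] in \<open>simp add: mult.commute[of C] mult_left_mono\<close>)
    qed (use that in auto)
    thus ?thesis using that by simp
  qed
  have contH: "continuous_on UNIV H"
    using der by (intro continuous_at_imp_continuous_on ballI) (rule has_derivative_continuous)
  have intH: "integrable lborel H"
  proof -
    have "integrable lborel (\<lambda>x. indicator K x *\<^sub>R H x)"
      by (intro borel_integrable_compact K continuous_on_subset[OF contH]) auto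
    moreover have "indicator K x *\<^sub>R H x = H x" for x using K(2) by (auto simp: indicator_def)
    ultimately show ?thesis by simp
  qed
  have shift: "integrable lborel (\<lambda>x. H (x + c))" "(\<integral>x. H (x + c) \<partial>lborel) = (\<integral>x. H x \<partial>lborel)" for c
  proof -
    have m: "(+) c \<in> measurable lborel borel" by (auto intro!: borel_measurable_continuous_onI continuous_intros)
    have Hm: "H \<in> borel_measurable borel" using contH by (rule borel_measurable_continuous_onI)
    show "integrable lborel (\<lambda>x. H (x + c))"
      using integrable_distr[OF m, of H] intH by (simp add: lborel_distr_plus add.commute)
    show "(\<integral>x. H (x + c) \<partial>lborel) = (\<integral>x. H x \<partial>lborel)"
      using integral_distr[OF m Hm] by (simp add: lborel_distr_plus add.commute)
  qed
  define q where "q n x = (H (x + (1 / Suc n) *\<^sub>R v) - H x) * of_nat (Suc n)" for n x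
  have q_int: "(\<integral>x. q n x \<partial>lborel) = 0" for n
    unfolding q_def using shift[of "(1 / Suc n) *\<^sub>R v"] intH by simp
  \<comment> \<open>All difference quotients with step at most \<open>1\<close> vanish off this compact set.\<close>
  define K' where "K' = (\<lambda>(x, u). x + u *\<^sub>R v) ` (K \<times> {-1..0})"
  have K': "compact K'" unfolding K'_def
    by (intro compact_continuous_image compact_Times K compact_Icc) (auto simp: split_beta intro!: continuous_intros)
  have q_le: "norm (q n x) \<le> C * indicator K' x" for n x
  proof (cases "x \<in> K'")
    case True
    have "norm (q n x) = norm (H (x + (1 / Suc n) *\<^sub>R v) - H x) * real (Suc n)"
      by (simp add: q_def norm_mult del: of_nat_Suc)
    also have "\<dots> \<le> (C * (1 / Suc n)) * real (Suc n)"
      by (intro mult_right_mono lip) auto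
    finally show ?thesis using True by simp
  next
    case False
    have "x \<notin> K"
    proof
      assume "x \<in> K"
      hence "x + 0 *\<^sub>R v \<in> K'" unfolding K'_def by (intro image_eqI[of _ _ "(x, 0)"]) auto
      thus False using False by simp
    qed
    moreover have "x + (1 / Suc n) *\<^sub>R v \<notin> K"
    proof
      assume "x + (1 / Suc n) *\<^sub>R v \<in> K"
      hence "(x + (1 / Suc n) *\<^sub>R v) + (- 1 / Suc n) *\<^sub>R v \<in> K'"
        unfolding K'_def by (intro image_eqI[of _ _ "(x + (1 / Suc n) *\<^sub>R v, - 1 / Suc n)"]) auto
      thus False using False by (simp add: add.assoc flip: scaleR_add_left)
    qed
    ultimately show ?thesis using False K(2) by (simp add: q_def)
  qed
  have q_lim: "(\<lambda>n. q n x) \<longlonglongrightarrow> H' x v" for x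
  proof -
    have "((\<lambda>t. x + t *\<^sub>R v) has_derivative (\<lambda>h. h *\<^sub>R v)) (at 0)"
      by (auto intro!: derivative_eq_intros)
    from has_derivative_compose[OF this, of H "H' x"] der
    have "((\<lambda>t. H (x + t *\<^sub>R v)) has_derivative (\<lambda>h. H' x (h *\<^sub>R v))) (at 0)" by simp
    hence "((\<lambda>t. norm (H (x + t *\<^sub>R v) - H x - t *\<^sub>R H' x v) / norm t) \<longlongrightarrow> 0) (at 0)"
      using has_derivative_linear[OF der] by (simp add: has_derivative_at linear_cmul)
    hence "((\<lambda>t. norm ((H (x + t *\<^sub>R v) - H x) /\<^sub>R t - H' x v)) \<longlongrightarrow> 0) (at 0)"
    proof (rule Lim_transform_eventually)
      have "norm (H (x + t *\<^sub>R v) - H x - t *\<^sub>R H' x v) / norm t = norm ((H (x + t *\<^sub>R v) - H x) /\<^sub>R t - H' x v)"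
        if "t \<noteq> 0" for t
      proof -
        have "H (x + t *\<^sub>R v) - H x - t *\<^sub>R H' x v = t *\<^sub>R ((H (x + t *\<^sub>R v) - H x) /\<^sub>R t - H' x v)"
          using that by (simp add: scaleR_diff_right)
        thus ?thesis using that by simp
      qed
      thus "\<forall>\<^sub>F t in at 0. norm (H (x + t *\<^sub>R v) - H x - t *\<^sub>R H' x v) / norm t = norm ((H (x + t *\<^sub>R v) - H x) /\<^sub>R t - H' x v)"
        by (simp add: eventually_at_filter)
    qed
    hence "((\<lambda>t. (H (x + t *\<^sub>R v) - H x) /\<^sub>R t) \<longlongrightarrow> H' x v) (at 0)"
      using Lim_null tendsto_norm_zero_iff by blast
    hence "(\<lambda>n. (H (x + (1 / Suc n) *\<^sub>R v) - H x) /\<^sub>R (1 / Suc n)) \<longlonglongrightarrow> H' x v"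
    proof -
      have "(\<lambda>n. 1 / real (Suc n)) \<longlonglongrightarrow> 0"
        using LIMSEQ_inverse_real_of_nat by (simp only: inverse_eq_divide)
      moreover have "\<forall>n. 1 / real (Suc n) \<in> UNIV - {0}" by (simp del: of_nat_Suc)
      ultimately show ?thesis
        using \<open>(_ \<longlongrightarrow> H' x v) (at 0)\<close>[unfolded tendsto_at_iff_sequentially comp_def,
            THEN spec, of "\<lambda>n. 1 / real (Suc n)"] by (simp only: simp_thms)
    qed
    thus ?thesis by (simp add: q_def scaleR_conv_of_real mult.commute)
  qed
  have "(\<lambda>n. \<integral>x. q n x \<partial>lborel) \<longlonglongrightarrow> (\<integral>x. H' x v \<partial>lborel)"
  proof (rule integral_dominated_convergence[where w = "\<lambda>x. C * indicator K' x"])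
    show "(\<lambda>x. H' x v) \<in> borel_measurable lborel"
      using borel_measurable_continuous_onI[OF cont] by simp
    show "q n \<in> borel_measurable lborel" for n
      unfolding q_def using shift(1)[of "(1 / Suc n) *\<^sub>R v"] intH by (intro borel_measurable_integrable) auto
    show "integrable lborel (\<lambda>x. C * indicator K' x)"
      using K' emeasure_compact_finite[OF K'] by (intro integrable_mult_right integrable_real_indicator) (auto simp: compact_imp_closed)
  qed (use q_lim q_le in auto)
  thus ?thesis unfolding q_int using LIMSEQ_unique tendsto_const by metis
qed

text \<open>
  Integration by parts for \<open>\<partial>/\<partial>z\<^sub>i\<close>. The factor \<open>(cnj f)\<^sup>s\<^sup>+\<^sup>l\<close> counts as a constant, so only
  \<open>f\<^sup>s\<^sup>+\<^sup>k\<close> contributes a derivative.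
\<close>

lemma zeta_integral_wirtinger:
  fixes f :: "complex^'n \<Rightarrow> complex"
  assumes X: "open X" "holo_on f X" and \<phi>: "test_function X \<phi>" and s: "2 * Re s + of_int k + of_int l > 1"
  shows "zeta_integral f k l (wirtinger i \<phi>) s
     = - (s + of_int k) * zeta_integral f (k - 1) l (\<lambda>x. pd i f x * \<phi> x) s"
proof -
  note cf = holo_on_imp_continuous_on[OF X(2)]
  let ?E = "zeta_kernel s"
  define p where "p x = pd i f x * \<phi> x" for x
  define p' where "p' x = cnj (pd i f x * cnj (\<phi> x))" for x
  have p: "test_function X p" unfolding p_def
    by (intro holo_mult_test_function X holo_on_pd \<phi>)
  have p': "test_function X p'" unfolding p'_def
    by (intro test_function_cnj holo_mult_test_function X holo_on_pd \<phi>)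
  let ?I = "\<lambda>k l \<psi>. zeta_integral f k l \<psi> s"
  have cont: "continuous_on UNIV (\<lambda>x. ?E k' l' (f x) * \<psi> x)"
    and int: "integrable lborel (\<lambda>x. ?E k' l' (f x) * \<psi> x)"
    if "test_function X \<psi>" "k' + l' \<ge> k + l - 1" for k' l' \<psi>
  proof -
    have "real_of_int (k' + l') \<ge> real_of_int (k + l - 1)" using that(2) by linarith
    hence *: "2 * Re s + of_int k' + of_int l' > 0" using s by simp
    show "continuous_on UNIV (\<lambda>x. ?E k' l' (f x) * \<psi> x)"
      by (rule continuous_on_compose_mult_test_function[OF X(1) cf continuous_on_zeta_kernel[OF *] that(1)])
    show "integrable lborel (\<lambda>x. ?E k' l' (f x) * \<psi> x)"
      by (rule integrable_zeta_integral[OF X(1) cf that(1) *])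
  qed
  \<comment> \<open>The integral of the derivative of \<open>|f|\<^sup>2\<^sup>s f\<^sup>k (cnj f)\<^sup>l \<phi>\<close> in direction \<open>c e\<^sub>i\<close> vanishes.\<close>
  have main: "?I k l (dir_deriv (axis i c) \<phi>) + c * (s + of_int k) * ?I (k-1) l p
      + cnj c * (s + of_int l) * ?I k (l-1) p' = 0" for c
  proof -
    define g' where "g' x v = (s + of_int k) * ?E (k-1) l (f x) * (\<Sum>i\<in>UNIV. v $ i * pd i f x)
        + (s + of_int l) * ?E k (l-1) (f x) * cnj (\<Sum>i\<in>UNIV. v $ i * pd i f x)" for x and v :: "complex^'n"
    have "((\<lambda>x. ?E k l (f x)) has_derivative g' x) (at x)" if "x \<in> X" for x
      unfolding g'_def using has_derivative_compose[OF holo_on_has_derivative[OF X(2) that] zeta_kernel_has_derivative[OF s]] .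
    from test_function_mult_has_derivative[OF \<phi> this]
    have der: "((\<lambda>x. ?E k l (f x) * \<phi> x) has_derivative (\<lambda>v. g' x v * \<phi> x + ?E k l (f x) * dir_deriv v \<phi> x)) (at x)" for x .
    have "(\<Sum>j\<in>UNIV. axis i c $ j * pd j f x) = c * pd i f x" for x
      by (simp add: axis_def if_distrib[of "\<lambda>a. a * _"] sum.delta cong: if_cong)
    hence eq: "g' x (axis i c) * \<phi> x + ?E k l (f x) * dir_deriv (axis i c) \<phi> x
        = ?E k l (f x) * dir_deriv (axis i c) \<phi> x + c * (s + of_int k) * (?E (k-1) l (f x) * p x)
          + cnj c * (s + of_int l) * (?E k (l-1) (f x) * p' x)" for x
      by (simp add: g'_def p_def p'_def algebra_simps)
    have "(\<integral>x. g' x (axis i c) * \<phi> x + ?E k l (f x) * dir_deriv (axis i c) \<phi> x \<partial>lborel) = 0"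
    proof (rule integral_directional_derivative_eq_0[OF der])
      show "compact (closure {x. \<phi> x \<noteq> 0})" using \<phi> by (simp add: test_function_def)
      show "?E k l (f x) * \<phi> x = 0" if "x \<notin> closure {x. \<phi> x \<noteq> 0}" for x
        using that closure_subset[of "{x. \<phi> x \<noteq> 0}"] by auto
      show "continuous_on UNIV (\<lambda>x. g' x (axis i c) * \<phi> x + ?E k l (f x) * dir_deriv (axis i c) \<phi> x)"
        unfolding eq by (intro continuous_intros cont p p' test_function_dir_deriv[OF \<phi>]) auto
    qed
    moreover have "(\<integral>x. g' x (axis i c) * \<phi> x + ?E k l (f x) * dir_deriv (axis i c) \<phi> x \<partial>lborel)
      = ?I k l (dir_deriv (axis i c) \<phi>) + c * (s + of_int k) * ?I (k-1) l p + cnj c * (s + of_int l) * ?I k (l-1) p'"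
      unfolding eq zeta_integral_def
      using int[OF p, of "k-1" l] int[OF p', of k "l-1"] int[OF test_function_dir_deriv[OF \<phi>], of k l] by simp
    ultimately show ?thesis by simp
  qed
  have "?I k l (wirtinger i \<phi>) = (1/2) * ?I k l (dir_deriv (axis i 1) \<phi>) - (\<i>/2) * ?I k l (dir_deriv (axis i \<i>) \<phi>)"
  proof -
    have "?E k l (f x) * wirtinger i \<phi> x = (1/2) * (?E k l (f x) * dir_deriv (axis i 1) \<phi> x)
       - (\<i>/2) * (?E k l (f x) * dir_deriv (axis i \<i>) \<phi> x)" for x
      by (simp add: wirtinger_def field_simps)
    thus ?thesis unfolding zeta_integral_def
      using int[OF test_function_dir_deriv[OF \<phi>], of k l] by (simp del: times_divide_eq_left)
  qed
  moreover define a b where "a = (s + of_int k) * ?I (k-1) l p" and "b = (s + of_int l) * ?I k (l-1) p'"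
  have main': "?I k l (dir_deriv (axis i c) \<phi>) + c * a + cnj c * b = 0" for c
    using main[of c] by (simp only: a_def b_def mult.assoc)
  have "?I k l (dir_deriv (axis i 1) \<phi>) = - a - b"
    using main'[of 1] by (simp only: complex_cnj_one mult_1) algebra
  moreover have "?I k l (dir_deriv (axis i \<i>) \<phi>) = - \<i> * a + \<i> * b"
    using main'[of \<i>] by (simp only: complex_cnj_i) algebra
  moreover have "(1/2) * (- a - b) - (\<i>/2) * (- \<i> * a + \<i> * b) = - a"
    by (simp add: field_simps)
  ultimately have "?I k l (wirtinger i \<phi>) = - a" by (simp only:)
  thus ?thesis unfolding p_def[symmetric] a_def by (simp only: mult_minus_left)
qed

section \<open>Sections with denominators and their pairing with test functions\<close>

lemma pd_cong:
  assumes "open W" "y \<in> W" "\<And>z. z \<in> W \<Longrightarrow> g z = h z"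
  shows "pd i g y = pd i h y"
proof -
  have "open ((\<lambda>t. y + t *s axis i 1) -` W)"
    by (intro open_vimage assms(1) continuous_intros bounded_linear.continuous_on[OF bounded_linear_scalar_mult_axis])
  hence "eventually (\<lambda>t. t \<in> (\<lambda>t. y + t *s axis i 1) -` W) (nhds 0)"
    using assms(2) by (intro eventually_nhds_in_open) auto
  hence "eventually (\<lambda>t. g (y + t *s axis i 1) = h (y + t *s axis i 1)) (nhds 0)"
    by eventually_elim (simp add: assms(3))
  thus ?thesis unfolding pd_def by (intro deriv_cong_ev) auto
qed

text \<open>
  The sections \<open>h(s) f\<^sup>s\<close> of \<open>O[1/f, s] f\<^sup>s\<close> over \<open>V\<close>, as functions of \<open>s\<close> and of the point, given by a
  common denominator \<open>f\<^sup>N\<close> and holomorphic coefficients. Specialisation of \<open>s\<close> to a number is then application,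
  and the action of \<open>\<partial>\<^sub>i\<close> at \<open>s\<close> is \<^term>\<open>conn f s i\<close>.
\<close>

definition fs_section :: "(complex^'n \<Rightarrow> complex) \<Rightarrow> (complex^'n) set \<Rightarrow> (complex \<Rightarrow> complex^'n \<Rightarrow> complex) \<Rightarrow> bool" where
  "fs_section f V h \<longleftrightarrow> (\<exists>N d g. (\<forall>k. holo_on (g k) V) \<and>
     (\<forall>s. \<forall>y\<in>V. f y \<noteq> 0 \<longrightarrow> h s y = (\<Sum>k\<le>d. s ^ k * g k y) / f y ^ N))"

lemma fs_sectionI:
  fixes N d :: nat
  assumes "\<And>k. holo_on (g k) V" "\<And>s y. y \<in> V \<Longrightarrow> f y \<noteq> 0 \<Longrightarrow> h s y = (\<Sum>k\<le>d. s ^ k * g k y) / f y ^ N"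
  shows "fs_section f V h"
  unfolding fs_section_def using assms by blast

lemma fs_sectionE:
  assumes "fs_section f V h"
  obtains N d g where "\<And>k. holo_on (g k) V" "\<And>s y. y \<in> V \<Longrightarrow> f y \<noteq> 0 \<Longrightarrow> h s y = (\<Sum>k\<le>d. s ^ k * g k y) / f y ^ N"
  using assms unfolding fs_section_def by blast

lemma fs_section_cong:
  assumes "fs_section f V h" "\<And>s y. y \<in> V \<Longrightarrow> f y \<noteq> 0 \<Longrightarrow> h' s y = h s y"
  shows "fs_section f V h'"
  using assms(1) by (rule fs_sectionE) (rule fs_sectionI, use assms(2) in auto)

lemma fs_section_holo: "holo_on g V \<Longrightarrow> fs_section f V (\<lambda>_. g)"
  by (rule fs_sectionI[where N = 0 and d = 0 and g = "\<lambda>_. g"]) auto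

lemma fs_section_add:
  assumes "holo_on f V" "fs_section f V h1" "fs_section f V h2"
  shows "fs_section f V (\<lambda>s y. h1 s y + h2 s y)"
proof -
  obtain N1 d1 g1 where 1: "\<And>k. holo_on (g1 k) V" "\<And>s y. y \<in> V \<Longrightarrow> f y \<noteq> 0 \<Longrightarrow> h1 s y = (\<Sum>k\<le>d1. s ^ k * g1 k y) / f y ^ N1"
    using fs_sectionE[OF assms(2)] by metis
  obtain N2 d2 g2 where 2: "\<And>k. holo_on (g2 k) V" "\<And>s y. y \<in> V \<Longrightarrow> f y \<noteq> 0 \<Longrightarrow> h2 s y = (\<Sum>k\<le>d2. s ^ k * g2 k y) / f y ^ N2"
    using fs_sectionE[OF assms(3)] by metis
  have ext: "(\<Sum>k\<le>d. s ^ k * g k y) = (\<Sum>k\<le>max d d'. s ^ k * (if k \<le> d then g k y else 0))" for d d' s y and g :: "nat \<Rightarrow> complex^'a \<Rightarrow> complex"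
    by (rule sum.mono_neutral_cong_left) auto
  let ?g = "\<lambda>k y. (if k \<le> d1 then g1 k y else 0) * f y ^ N2 + (if k \<le> d2 then g2 k y else 0) * f y ^ N1"
  show ?thesis
  proof (rule fs_sectionI)
    fix k
    have "holo_on (\<lambda>y. if k \<le> d1 then g1 k y else 0) V" "holo_on (\<lambda>y. if k \<le> d2 then g2 k y else 0) V"
      using 1(1)[of k] 2(1)[of k] by (cases "k \<le> d1"; cases "k \<le> d2"; simp add: holo_on_const)+
    thus "holo_on (?g k) V" by (intro holo_on_add holo_on_mult holo_on_power assms(1))
  next
    fix s y assume y: "y \<in> V" "f y \<noteq> 0"
    have "h1 s y + h2 s y = ((\<Sum>k\<le>max d1 d2. s ^ k * (if k \<le> d1 then g1 k y else 0)) * f y ^ N2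
        + (\<Sum>k\<le>max d1 d2. s ^ k * (if k \<le> d2 then g2 k y else 0)) * f y ^ N1) / f y ^ (N1 + N2)"
      using y(2) by (simp add: 1(2)[OF y] 2(2)[OF y] ext[of s g1 y d1 d2] ext[of s g2 y d2 d1] max.commute power_add field_simps)
    also have "\<dots> = (\<Sum>k\<le>max d1 d2. s ^ k * ?g k y) / f y ^ (N1 + N2)"
      by (simp only: sum_distrib_right distrib_left sum.distrib mult.assoc)
    finally show "h1 s y + h2 s y = (\<Sum>k\<le>max d1 d2. s ^ k * ?g k y) / f y ^ (N1 + N2)" .
  qed
qed

lemma fs_section_holo_mult:
  assumes "holo_on a V" "fs_section f V h"
  shows "fs_section f V (\<lambda>s y. a y * h s y)"
proof -
  obtain N d g where g: "\<And>k. holo_on (g k) V" "\<And>s y. y \<in> V \<Longrightarrow> f y \<noteq> 0 \<Longrightarrow> h s y = (\<Sum>k\<le>d. s ^ k * g k y) / f y ^ N"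
    using fs_sectionE[OF assms(2)] by metis
  show ?thesis
    by (rule fs_sectionI[where N = N and d = d and g = "\<lambda>k y. a y * g k y"])
       (auto intro!: holo_on_mult g assms(1) simp: g sum_distrib_left mult_ac)
qed

lemma fs_section_mult_s:
  assumes "fs_section f V h" shows "fs_section f V (\<lambda>s y. s * h s y)"
proof -
  obtain N d g where g: "\<And>k. holo_on (g k) V" "\<And>s y. y \<in> V \<Longrightarrow> f y \<noteq> 0 \<Longrightarrow> h s y = (\<Sum>k\<le>d. s ^ k * g k y) / f y ^ N"
    using fs_sectionE[OF assms] by metis
  show ?thesis
  proof (rule fs_sectionI[where N = N and d = "Suc d" and g = "\<lambda>k y. if k = 0 then 0 else g (k - 1) y"])
    show "holo_on (\<lambda>y. if k = 0 then 0 else g (k - 1) y) V" for k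
      using g(1) by (cases k) (auto intro: holo_on_const)
  next
    fix s y assume y: "y \<in> V" "f y \<noteq> 0"
    show "s * h s y = (\<Sum>k\<le>Suc d. s ^ k * (if k = 0 then 0 else g (k - 1) y)) / f y ^ N"
      unfolding sum.atMost_Suc_shift by (simp add: g(2)[OF y] sum_distrib_left mult_ac)
  qed
qed

lemma fs_section_mult_power:
  assumes "fs_section f V h" shows "fs_section f V (\<lambda>s y. s ^ m * h s y)"
  by (induction m) (simp_all add: assms fs_section_mult_s mult.assoc)

lemma fs_section_divide:
  assumes "fs_section f V h" shows "fs_section f V (\<lambda>s y. h s y / f y)"
proof -
  obtain N d g where g: "\<And>k. holo_on (g k) V" "\<And>s y. y \<in> V \<Longrightarrow> f y \<noteq> 0 \<Longrightarrow> h s y = (\<Sum>k\<le>d. s ^ k * g k y) / f y ^ N"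
    using fs_sectionE[OF assms] by metis
  show ?thesis
    by (rule fs_sectionI[where N = "Suc N" and d = d and g = g]) (auto simp: g)
qed

lemma fs_section_sum:
  assumes "holo_on f V" "\<And>i. i \<in> I \<Longrightarrow> fs_section f V (h i)"
  shows "fs_section f V (\<lambda>s y. \<Sum>i\<in>I. h i s y)"
  using assms(2) by (induction I rule: infinite_finite_induct)
    (auto intro!: fs_section_add assms(1) fs_section_holo holo_on_const)

lemma conn_cong:
  assumes "open W" "y \<in> W" "\<And>z. z \<in> W \<Longrightarrow> g z = h z"
  shows "conn f c i g y = conn f c i h y"
  using pd_cong[OF assms] assms(2,3) by (simp add: conn_def)

lemma open_nonzero_set:
  assumes "open V" "holo_on f V" shows "open {y \<in> V. f y \<noteq> 0}"
proof -
  have "open (V \<inter> f -` (- {0}))"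
    by (rule continuous_open_preimage[OF holo_on_imp_continuous_on[OF assms(2)] assms(1)]) auto
  moreover have "V \<inter> f -` (- {0}) = {y \<in> V. f y \<noteq> 0}" by auto
  ultimately show ?thesis by simp
qed

text \<open>
  Quotient rule: \<open>\<partial>\<^sub>i\<close> acts on \<open>g f\<^sup>c\<^sup>-\<^sup>N\<close>, which explains the factor \<open>c - N\<close>.
\<close>

lemma conn_quotient:
  assumes V: "open V" "holo_on f V" and g: "\<And>k. holo_on (g k) V" and y: "y \<in> V" "f y \<noteq> 0"
  shows "conn f c i (\<lambda>y. (\<Sum>k\<le>d. s ^ k * g k y) / f y ^ N) y
     = (\<Sum>k\<le>d. s ^ k * (pd i (g k) y / f y ^ N + (c - of_nat N) * (g k y * pd i f y / f y ^ Suc N)))"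
proof -
  let ?L = "\<lambda>t. y + t *s axis i 1"
  have df: "((\<lambda>t. f (?L t)) has_field_derivative pd i f y) (at 0)"
    by (rule holo_on_has_field_derivative_line[OF V(2) y(1)])
  have dg: "((\<lambda>t. g k (?L t)) has_field_derivative pd i (g k) y) (at 0)" for k
    by (rule holo_on_has_field_derivative_line[OF g y(1)])
  have "pd i (\<lambda>y. (\<Sum>k\<le>d. s ^ k * g k y) / f y ^ N) y =
     ((\<Sum>k\<le>d. s ^ k * pd i (g k) y) * f y ^ N - (\<Sum>k\<le>d. s ^ k * g k y) * (of_nat N * f y ^ (N - 1) * pd i f y)) / (f y ^ N * f y ^ N)"
  proof (rule pd_eqI)
    have n: "((\<lambda>t. \<Sum>k\<le>d. s ^ k * g k (?L t)) has_field_derivative (\<Sum>k\<le>d. s ^ k * pd i (g k) y)) (at 0)"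
      by (intro DERIV_sum DERIV_cmult dg)
    have m: "((\<lambda>t. f (?L t) ^ N) has_field_derivative of_nat N * f y ^ (N - 1) * pd i f y) (at 0)"
      using DERIV_power[OF df, of N] by (simp add: mult_ac)
    show "((\<lambda>t. (\<Sum>k\<le>d. s ^ k * g k (?L t)) / f (?L t) ^ N) has_field_derivative 
        ((\<Sum>k\<le>d. s ^ k * pd i (g k) y) * f y ^ N - (\<Sum>k\<le>d. s ^ k * g k y) * (of_nat N * f y ^ (N - 1) * pd i f y)) / (f y ^ N * f y ^ N)) (at 0)"
      using DERIV_divide[OF n m] y(2) by simp
  qed
  also have "of_nat N * f y ^ (N - 1) * pd i f y = of_nat N * f y ^ N * pd i f y / f y"
    using y(2) by (cases N) auto
  also have "((\<Sum>k\<le>d. s ^ k * pd i (g k) y) * f y ^ N - (\<Sum>k\<le>d. s ^ k * g k y) * (of_nat N * f y ^ N * pd i f y / f y)) / (f y ^ N * f y ^ N)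
     = (\<Sum>k\<le>d. s ^ k * pd i (g k) y) / f y ^ N - of_nat N * (\<Sum>k\<le>d. s ^ k * g k y) * pd i f y / f y ^ Suc N"
    using y(2) by (simp add: field_simps)
  finally have "conn f c i (\<lambda>y. (\<Sum>k\<le>d. s ^ k * g k y) / f y ^ N) y
     = (\<Sum>k\<le>d. s ^ k * pd i (g k) y) / f y ^ N + (c - of_nat N) * ((\<Sum>k\<le>d. s ^ k * g k y) * pd i f y / f y ^ Suc N)"
    using y(2) by (simp add: conn_def field_simps)
  thus ?thesis
    by (simp add: sum_divide_distrib sum_distrib_left sum_distrib_right sum.distrib ring_distribs mult_ac)
qed

lemma fs_section_conn_expand:
  assumes V: "open V" "holo_on f V" 
    and h: "\<And>s y. y \<in> V \<Longrightarrow> f y \<noteq> 0 \<Longrightarrow> h s y = (\<Sum>k\<le>d. s ^ k * g k y) / f y ^ N"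
    and g: "\<And>k. holo_on (g k) V" and y: "y \<in> V" "f y \<noteq> 0"
  shows "conn f c i (h s) y = (\<Sum>k\<le>d. s ^ k * (pd i (g k) y / f y ^ N + (c - of_nat N) * (g k y * pd i f y / f y ^ Suc N)))"
proof -
  have "conn f c i (h s) y = conn f c i (\<lambda>y. (\<Sum>k\<le>d. s ^ k * g k y) / f y ^ N) y"
    by (rule conn_cong[OF open_nonzero_set[OF V]]) (use y h in auto)
  thus ?thesis using conn_quotient[where d = d and s = s and c = c and N = N, OF V g y] by simp
qed

lemma fs_section_conn:
  assumes V: "open V" "holo_on f V" and h: "fs_section f V h"
  shows "fs_section f V (\<lambda>s. conn f s i (h s))"
proof -
  obtain N d g where g: "\<And>k. holo_on (g k) V" "\<And>s y. y \<in> V \<Longrightarrow> f y \<noteq> 0 \<Longrightarrow> h s y = (\<Sum>k\<le>d. s ^ k * g k y) / f y ^ N"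
    using fs_sectionE[OF h] by metis
  let ?a = "\<lambda>s y. (\<Sum>k\<le>d. s ^ k * pd i (g k) y) / f y ^ N"
  let ?b = "\<lambda>s y. (\<Sum>k\<le>d. s ^ k * (- of_nat N * (g k y * pd i f y))) / f y ^ Suc N"
  let ?c = "\<lambda>s y. (\<Sum>k\<le>d. s ^ k * (g k y * pd i f y)) / f y ^ Suc N"
  have "fs_section f V ?a" "fs_section f V ?b" "fs_section f V ?c"
    by (rule fs_sectionI[OF _ refl]; intro holo_on_mult holo_on_const holo_on_pd g(1) V)+
  hence "fs_section f V (\<lambda>s y. ?a s y + (?b s y + s * ?c s y))"
    by (intro fs_section_add fs_section_mult_s V(2))
  thus ?thesis
  proof (rule fs_section_cong)
    fix s y assume y: "y \<in> V" "f y \<noteq> 0"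
    have eq: "conn f s i (h s) y = (\<Sum>k\<le>d. s ^ k * (pd i (g k) y / f y ^ N + (s - of_nat N) * (g k y * pd i f y / f y ^ Suc N)))"
      by (rule fs_section_conn_expand[where d = d and N = N and g = g and h = h, OF V g(2) g(1) y])
    show "conn f s i (h s) y = ?a s y + (?b s y + s * ?c s y)"
      unfolding eq sum_divide_distrib sum_distrib_left sum.distrib[symmetric]
      by (rule sum.cong) (simp_all add: algebra_simps add_divide_distrib diff_divide_distrib del: power_Suc)
  qed
qed

lemma fs_section_word:
  assumes V: "open V" "holo_on f V" and h: "fs_section f V h"
  shows "fs_section f V (\<lambda>s. foldr (conn f s) w (h s))"
  by (induction w) (auto intro!: fs_section_conn V h)

text \<open>
  The section \<open>h(s + k) f\<^sup>s\<^sup>+\<^sup>k\<close> paired with \<open>(cnj f)\<^sup>s\<^sup>+\<^sup>l \<phi>\<close>. The argument of \<open>h\<close> is shifted because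
  \<open>f\<^sup>k\<close> is part of the power on which \<open>\<partial>\<^sub>i\<close> acts.
\<close>

definition zeta_pairing :: "(complex^'n \<Rightarrow> complex) \<Rightarrow> int \<Rightarrow> int \<Rightarrow> (complex \<Rightarrow> complex^'n \<Rightarrow> complex) \<Rightarrow>
    (complex^'n \<Rightarrow> complex) \<Rightarrow> complex \<Rightarrow> complex" where
  "zeta_pairing f k l h \<phi> s = (\<integral>x. zeta_kernel s k l (f x) * (h (s + of_int k) x * \<phi> x) \<partial>lborel)"

lemma zeta_pairing_cong:
  assumes "test_function V \<phi>" "\<And>s y. y \<in> V \<Longrightarrow> f y \<noteq> 0 \<Longrightarrow> h s y * \<phi> y = h' s y * \<psi> y"
    "test_function V \<psi>"
  shows "zeta_pairing f k l h \<phi> s = zeta_pairing f k l h' \<psi> s"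
proof -
  have "zeta_kernel s k l (f x) * (h (s + of_int k) x * \<phi> x) = zeta_kernel s k l (f x) * (h' (s + of_int k) x * \<psi> x)" for x
    using assms(2)[of x] test_function_zero_outside[OF assms(1), of x] test_function_zero_outside[OF assms(3), of x]
    by (cases "x \<in> V"; cases "f x = 0") auto
  thus ?thesis unfolding zeta_pairing_def by (simp only:)
qed

lemma zeta_pairing_integrand:
  assumes "test_function V \<phi>" "\<And>s y. y \<in> V \<Longrightarrow> f y \<noteq> 0 \<Longrightarrow> h s y = (\<Sum>m\<le>d. s ^ m * g m y) / f y ^ N"
  shows "zeta_kernel s k l (f x) * (h (s + of_int k) x * \<phi> x)
      = (\<Sum>m\<le>d. (s + of_int k) ^ m * (zeta_kernel s (k - int N) l (f x) * (g m x * \<phi> x)))"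
proof (cases "x \<in> V \<and> f x \<noteq> 0")
  case True
  have "zeta_kernel s (k - int N) l (f x) = zeta_kernel s k l (f x) / f x ^ N"
    using zeta_kernel_add[of "f x" s k "- int N" l] True by (simp add: power_int_minus field_simps)
  thus ?thesis using True by (simp add: assms(2) sum_distrib_left sum_distrib_right sum_divide_distrib mult_ac)
next
  case False
  thus ?thesis using test_function_zero_outside[OF assms(1), of x] by auto
qed

lemma zeta_pairing_expand:
  fixes f :: "complex^'n \<Rightarrow> complex"
  assumes V: "open V" "holo_on f V" and \<phi>: "test_function V \<phi>" and g: "\<And>m. holo_on (g m) V"
    and h: "\<And>s y. y \<in> V \<Longrightarrow> f y \<noteq> 0 \<Longrightarrow> h s y = (\<Sum>m\<le>d. s ^ m * g m y) / f y ^ N"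
    and s: "2 * Re s + of_int (k - int N) + of_int l > 0"
  shows "integrable lborel (\<lambda>x. zeta_kernel s k l (f x) * (h (s + of_int k) x * \<phi> x))"
    "zeta_pairing f k l h \<phi> s = (\<Sum>m\<le>d. (s + of_int k) ^ m * zeta_integral f (k - int N) l (\<lambda>x. g m x * \<phi> x) s)"
proof -
  have *: "integrable lborel (\<lambda>x. zeta_kernel s (k - int N) l (f x) * (g m x * \<phi> x))" for m
    by (rule integrable_zeta_integral[OF V(1) holo_on_imp_continuous_on[OF V(2)] holo_mult_test_function[OF V(1) g \<phi>] s])
  have eq: "zeta_kernel s k l (f x) * (h (s + of_int k) x * \<phi> x)
      = (\<Sum>m\<le>d. (s + of_int k) ^ m * (zeta_kernel s (k - int N) l (f x) * (g m x * \<phi> x)))" for x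
    by (rule zeta_pairing_integrand[where d = d and N = N and g = g and h = h, OF \<phi> h])
  show "integrable lborel (\<lambda>x. zeta_kernel s k l (f x) * (h (s + of_int k) x * \<phi> x))"
    unfolding eq using * by simp
  show "zeta_pairing f k l h \<phi> s = (\<Sum>m\<le>d. (s + of_int k) ^ m * zeta_integral f (k - int N) l (\<lambda>x. g m x * \<phi> x) s)"
    unfolding zeta_pairing_def zeta_integral_def eq using * by simp
qed

lemma zeta_pairing_integrable:
  fixes f :: "complex^'n \<Rightarrow> complex"
  assumes V: "open V" "holo_on f V" and \<phi>: "test_function V \<phi>" and h: "fs_section f V h"
  obtains R where "\<And>s. Re s > R \<Longrightarrow> integrable lborel (\<lambda>x. zeta_kernel s k l (f x) * (h (s + of_int k) x * \<phi> x))"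
proof -
  obtain N d g where g: "\<And>k. holo_on (g k) V" "\<And>s y. y \<in> V \<Longrightarrow> f y \<noteq> 0 \<Longrightarrow> h s y = (\<Sum>k\<le>d. s ^ k * g k y) / f y ^ N"
    using fs_sectionE[OF h] by metis
  show ?thesis
  proof (rule that[of "- (of_int (k - int N) + of_int l) / 2"])
    fix s assume "Re s > - (of_int (k - int N) + of_int l) / 2"
    hence s: "2 * Re s + of_int (k - int N) + of_int l > 0" by (simp add: field_simps)
    show "integrable lborel (\<lambda>x. zeta_kernel s k l (f x) * (h (s + of_int k) x * \<phi> x))"
      by (rule zeta_pairing_expand(1)[where h = h and d = d and N = N and g = g, OF V \<phi> g s])
  qed
qed

text \<open>
  The adjoint of \<open>\<partial>\<^sub>i\<close> is \<open>- \<partial>/\<partial>z\<^sub>i\<close>. Expanded in powers of \<open>s\<close> and divided by \<open>f\<^sup>N\<close>, the claim becomes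
  \<open>zeta_integral_wirtinger\<close> for the test functions \<open>g\<^sub>m \<phi>\<close>, at the twist \<open>k - N\<close>.
\<close>

lemma zeta_pairing_conn:
  fixes f :: "complex^'n \<Rightarrow> complex"
  assumes V: "open V" "holo_on f V" and \<phi>: "test_function V \<phi>" and h: "fs_section f V h"
  obtains R where "\<And>s. Re s > R \<Longrightarrow> zeta_pairing f k l (\<lambda>s. conn f s i (h s)) \<phi> s
      = - zeta_pairing f k l h (wirtinger i \<phi>) s"
proof -
  note cf = holo_on_imp_continuous_on[OF V(2)]
  obtain N d g where g: "\<And>k. holo_on (g k) V" "\<And>s y. y \<in> V \<Longrightarrow> f y \<noteq> 0 \<Longrightarrow> h s y = (\<Sum>k\<le>d. s ^ k * g k y) / f y ^ N"
    using fs_sectionE[OF h] by metis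
  show ?thesis
  proof (rule that[of "(1 - (of_int (k - int N) + of_int l)) / 2"])
    fix s assume "Re s > (1 - (of_int (k - int N) + of_int l)) / 2"
    hence s: "2 * Re s + of_int (k - int N) + of_int l > 1" by (simp add: field_simps)
    hence s0: "2 * Re s + of_int (k - int N) + of_int l > 0" 
      and s1: "2 * Re s + of_int (k - int N - 1) + of_int l > 0" by simp_all
    let ?K = "k - int N"
    let ?c = "s + of_int k"
    note tf = holo_mult_test_function[OF V(1)]
    have expand: "zeta_kernel s k l (f x) * (conn f ?c i (h ?c) x * \<phi> x)
        = (\<Sum>m\<le>d. ?c ^ m * (zeta_kernel s ?K l (f x) * (pd i (g m) x * \<phi> x)
             + (s + of_int ?K) * (zeta_kernel s (?K - 1) l (f x) * (pd i f x * (g m x * \<phi> x)))))" for x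
    proof (cases "x \<in> V \<and> f x \<noteq> 0")
      case True
      hence x: "x \<in> V" "f x \<noteq> 0" by auto
      have 1: "zeta_kernel s ?K l (f x) = zeta_kernel s k l (f x) / f x ^ N"
        using zeta_kernel_add[of "f x" s k "- int N" l] x by (simp add: power_int_minus field_simps)
      have "zeta_kernel s (?K - 1) l (f x) = zeta_kernel s ?K l (f x) / f x"
        using zeta_kernel_add[of "f x" s ?K "- 1" l] x by (simp add: power_int_minus field_simps)
      hence 2: "zeta_kernel s (?K - 1) l (f x) = zeta_kernel s k l (f x) / f x ^ Suc N" 
        by (simp add: 1)
      have conn_eq: "conn f ?c i (h ?c) x = (\<Sum>k\<le>d. ?c ^ k * (pd i (g k) x / f x ^ N + (?c - of_nat N) * (g k x * pd i f x / f x ^ Suc N)))"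
        by (rule fs_section_conn_expand[where d = d and N = N and g = g and h = h, OF V g(2) g(1) x])
      have "of_int ?K = of_int k - (of_nat N :: complex)" by simp
      thus ?thesis
        unfolding conn_eq 1 2 sum_distrib_left sum_distrib_right
        by (intro sum.cong) (simp_all add: algebra_simps add_divide_distrib diff_divide_distrib del: power_Suc)
    next
      case False
      thus ?thesis using test_function_zero_outside[OF \<phi>, of x] by auto
    qed
    have int: "integrable lborel (\<lambda>x. zeta_kernel s ?K l (f x) * (pd i (g m) x * \<phi> x))"
      "integrable lborel (\<lambda>x. zeta_kernel s (?K - 1) l (f x) * (pd i f x * (g m x * \<phi> x)))" for m
      by (rule integrable_zeta_integral[OF V(1) cf _ s0] integrable_zeta_integral[OF V(1) cf _ s1];
          intro tf holo_on_pd g(1) V \<phi>)+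
    have "zeta_pairing f k l (\<lambda>s. conn f s i (h s)) \<phi> s
        = (\<Sum>m\<le>d. ?c ^ m * (zeta_integral f ?K l (\<lambda>x. pd i (g m) x * \<phi> x) s
            + (s + of_int ?K) * zeta_integral f (?K - 1) l (\<lambda>x. pd i f x * (g m x * \<phi> x)) s))"
      unfolding zeta_pairing_def expand zeta_integral_def using int by simp
    also have "\<dots> = (\<Sum>m\<le>d. ?c ^ m * (- zeta_integral f ?K l (\<lambda>x. g m x * wirtinger i \<phi> x) s))"
    proof (rule sum.cong[OF refl], rule arg_cong[where f = "(*) _"])
      fix m
      have "wirtinger i (\<lambda>x. g m x * \<phi> x) = (\<lambda>x. pd i (g m) x * \<phi> x + g m x * wirtinger i \<phi> x)"
        using wirtinger_holo_mult[OF V(1) g(1) \<phi>] by blast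
      hence "zeta_integral f ?K l (wirtinger i (\<lambda>x. g m x * \<phi> x)) s
         = zeta_integral f ?K l (\<lambda>x. pd i (g m) x * \<phi> x) s + zeta_integral f ?K l (\<lambda>x. g m x * wirtinger i \<phi> x) s"
        using zeta_integral_add[OF V(1) cf tf[OF holo_on_pd[OF g(1) V(1)] \<phi>] tf[OF g(1) test_function_wirtinger[OF \<phi>]] s0]
        by simp
      moreover have "zeta_integral f ?K l (wirtinger i (\<lambda>x. g m x * \<phi> x)) s
         = - (s + of_int ?K) * zeta_integral f (?K - 1) l (\<lambda>x. pd i f x * (g m x * \<phi> x)) s"
        by (rule zeta_integral_wirtinger[OF V tf[OF g(1) \<phi>] s])
      ultimately show "zeta_integral f ?K l (\<lambda>x. pd i (g m) x * \<phi> x) s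
            + (s + of_int ?K) * zeta_integral f (?K - 1) l (\<lambda>x. pd i f x * (g m x * \<phi> x)) s
            = - zeta_integral f ?K l (\<lambda>x. g m x * wirtinger i \<phi> x) s"
        by (simp only:) (simp add: algebra_simps)
    qed
    also have "\<dots> = - zeta_pairing f k l h (wirtinger i \<phi>) s"
    proof -
      have "zeta_pairing f k l h (wirtinger i \<phi>) s
          = (\<Sum>m\<le>d. ?c ^ m * zeta_integral f ?K l (\<lambda>x. g m x * wirtinger i \<phi> x) s)"
        by (rule zeta_pairing_expand(2)[where h = h and d = d and N = N and g = g, OF V test_function_wirtinger[OF \<phi>] g s0])
      thus ?thesis by (simp add: sum_negf)
    qed
    finally show "zeta_pairing f k l (\<lambda>s. conn f s i (h s)) \<phi> s = - zeta_pairing f k l h (wirtinger i \<phi>) s" .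
  qed
qed

lemma zeta_pairing_uminus: "zeta_pairing f k l h (\<lambda>x. - \<phi> x) s = - zeta_pairing f k l h \<phi> s"
  unfolding zeta_pairing_def by simp

lemma zeta_pairing_word:
  fixes f :: "complex^'n \<Rightarrow> complex"
  assumes V: "open V" "holo_on f V" and h: "fs_section f V h"
  shows "test_function V \<phi> \<Longrightarrow> \<exists>\<psi>. test_function V \<psi> \<and>
     (\<exists>R. \<forall>s. Re s > R \<longrightarrow> zeta_pairing f k l (\<lambda>s. foldr (conn f s) w (h s)) \<phi> s = zeta_pairing f k l h \<psi> s)"
proof (induction w arbitrary: \<phi>)
  case Nil
  thus ?case by auto
next
  case (Cons i w)
  obtain R1 where R1: "\<And>s. Re s > R1 \<Longrightarrow> zeta_pairing f k l (\<lambda>s. conn f s i (foldr (conn f s) w (h s))) \<phi> s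
      = - zeta_pairing f k l (\<lambda>s. foldr (conn f s) w (h s)) (wirtinger i \<phi>) s"
    by (rule zeta_pairing_conn[where k = k and l = l and i = i, OF V Cons.prems fs_section_word[OF V h, of w]]) (rule that)
  have "test_function V (\<lambda>x. - wirtinger i \<phi> x)"
    using test_function_cmult[OF test_function_wirtinger[OF Cons.prems], of "-1"] by simp
  from Cons.IH[OF this] obtain \<psi> R2 where \<psi>: "test_function V \<psi>"
    "\<And>s. Re s > R2 \<Longrightarrow> zeta_pairing f k l (\<lambda>s. foldr (conn f s) w (h s)) (\<lambda>x. - wirtinger i \<phi> x) s = zeta_pairing f k l h \<psi> s"
    by blast
  have "\<forall>s. Re s > max R1 R2 \<longrightarrow> zeta_pairing f k l (\<lambda>s. foldr (conn f s) (i # w) (h s)) \<phi> s = zeta_pairing f k l h \<psi> s"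
    using R1 \<psi>(2) by (simp add: zeta_pairing_uminus)
  thus ?case using \<psi>(1) by blast
qed

text \<open>
  Polynomials in \<open>s\<close> whose coefficients are zeta integrals with one fixed twist. Poles and domains of
  holomorphy depend on the twist alone, so this is all that has to be remembered of an integral.
  Only large \<open>Re s\<close> matter, where all integrals in question converge.
\<close>

definition zeta_span :: "(complex^'n \<Rightarrow> complex) \<Rightarrow> (complex^'n) set \<Rightarrow> int \<Rightarrow> int \<Rightarrow> (complex \<Rightarrow> complex) \<Rightarrow> bool" where
  "zeta_span f V k l J \<longleftrightarrow> (\<exists>d \<psi>. (\<forall>m. test_function V (\<psi> m)) \<and>
     (\<exists>R. \<forall>s. Re s > R \<longrightarrow> J s = (\<Sum>m\<le>d. s ^ m * zeta_integral f k l (\<psi> m) s)))"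

lemma zeta_spanI:
  fixes d :: nat
  assumes "\<And>m. test_function V (\<psi> m)" "\<And>s. Re s > R \<Longrightarrow> J s = (\<Sum>m\<le>d. s ^ m * zeta_integral f k l (\<psi> m) s)"
  shows "zeta_span f V k l J"
  unfolding zeta_span_def using assms by blast

lemma zeta_spanE:
  assumes "zeta_span f V k l J"
  obtains d \<psi> R where "\<And>m. test_function V (\<psi> m)" "\<And>s. Re s > R \<Longrightarrow> J s = (\<Sum>m\<le>d. s ^ m * zeta_integral f k l (\<psi> m) s)"
  using assms unfolding zeta_span_def by blast

lemma zeta_span_cong:
  assumes "zeta_span f V k l J" "\<And>s. Re s > R \<Longrightarrow> J' s = J s"
  shows "zeta_span f V k l J'"
proof -
  obtain d \<psi> R' where "\<And>m. test_function V (\<psi> m)" "\<And>s. Re s > R' \<Longrightarrow> J s = (\<Sum>m\<le>d. s ^ m * zeta_integral f k l (\<psi> m) s)"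
    using zeta_spanE[OF assms(1)] by metis
  thus ?thesis using assms(2) by (intro zeta_spanI[of V \<psi> "max R R'"]) auto
qed

lemma zeta_span_integral: "test_function V \<psi> \<Longrightarrow> zeta_span f V k l (zeta_integral f k l \<psi>)"
  by (rule zeta_spanI[where d = 0 and \<psi> = "\<lambda>_. \<psi>"]) auto

lemma zeta_span_0: "zeta_span f V k l (\<lambda>_. 0)"
  by (rule zeta_spanI[where d = 0 and \<psi> = "\<lambda>_ _. 0"]) (auto simp: test_function_0 zeta_integral_0)

lemma zeta_span_add:
  assumes V: "open V" "holo_on f V" and J: "zeta_span f V k l J1" "zeta_span f V k l J2"
  shows "zeta_span f V k l (\<lambda>s. J1 s + J2 s)"
proof -
  obtain d1 \<psi>1 R1 where 1: "\<And>m. test_function V (\<psi>1 m)" "\<And>s. Re s > R1 \<Longrightarrow> J1 s = (\<Sum>m\<le>d1. s ^ m * zeta_integral f k l (\<psi>1 m) s)"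
    using zeta_spanE[OF J(1)] by metis
  obtain d2 \<psi>2 R2 where 2: "\<And>m. test_function V (\<psi>2 m)" "\<And>s. Re s > R2 \<Longrightarrow> J2 s = (\<Sum>m\<le>d2. s ^ m * zeta_integral f k l (\<psi>2 m) s)"
    using zeta_spanE[OF J(2)] by metis
  let ?p1 = "\<lambda>m x. if m \<le> d1 then \<psi>1 m x else 0" and ?p2 = "\<lambda>m x. if m \<le> d2 then \<psi>2 m x else 0"
  have t: "test_function V (?p1 m)" "test_function V (?p2 m)" for m
    using 1(1)[of m] 2(1)[of m] by (cases "m \<le> d1"; cases "m \<le> d2"; simp add: test_function_0)+
  define R where "R = max (max R1 R2) (- (of_int k + of_int l) / 2)"
  show ?thesis
  proof (rule zeta_spanI[where \<psi> = "\<lambda>m x. ?p1 m x + ?p2 m x" and d = "max d1 d2" and R = R])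
    show "test_function V (\<lambda>x. ?p1 m x + ?p2 m x)" for m by (intro test_function_add t)
    fix s assume "Re s > R"
    hence s: "Re s > R1" "Re s > R2" "2 * Re s + of_int k + of_int l > 0" by (auto simp: R_def)
    have "J1 s = (\<Sum>m\<le>max d1 d2. s ^ m * zeta_integral f k l (?p1 m) s)"
      unfolding 1(2)[OF s(1)] by (rule sum.mono_neutral_cong_left) (auto simp: zeta_integral_0)
    moreover have "J2 s = (\<Sum>m\<le>max d1 d2. s ^ m * zeta_integral f k l (?p2 m) s)"
      unfolding 2(2)[OF s(2)] by (rule sum.mono_neutral_cong_left) (auto simp: zeta_integral_0)
    ultimately show "J1 s + J2 s = (\<Sum>m\<le>max d1 d2. s ^ m * zeta_integral f k l (\<lambda>x. ?p1 m x + ?p2 m x) s)"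
      unfolding zeta_integral_add[OF V(1) holo_on_imp_continuous_on[OF V(2)] t s(3)]
      by (simp add: ring_distribs sum.distrib)
  qed
qed

lemma zeta_span_mult_s:
  assumes "zeta_span f V k l J" shows "zeta_span f V k l (\<lambda>s. s * J s)"
proof -
  obtain d \<psi> R where *: "\<And>m. test_function V (\<psi> m)" "\<And>s. Re s > R \<Longrightarrow> J s = (\<Sum>m\<le>d. s ^ m * zeta_integral f k l (\<psi> m) s)"
    using zeta_spanE[OF assms] by metis
  let ?p = "\<lambda>m x. if m = 0 then 0 else \<psi> (m - 1) x"
  show ?thesis
  proof (rule zeta_spanI[where \<psi> = ?p and d = "Suc d" and R = R])
    show "test_function V (?p m)" for m using *(1) by (cases m) (auto simp: test_function_0)
    show "s * J s = (\<Sum>m\<le>Suc d. s ^ m * zeta_integral f k l (?p m) s)" if "Re s > R" for s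
      unfolding sum.atMost_Suc_shift using *(2)[OF that] by (simp add: zeta_integral_0 sum_distrib_left mult_ac)
  qed
qed

lemma zeta_span_cmult:
  assumes "zeta_span f V k l J" shows "zeta_span f V k l (\<lambda>s. c * J s)"
proof -
  obtain d \<psi> R where *: "\<And>m. test_function V (\<psi> m)" "\<And>s. Re s > R \<Longrightarrow> J s = (\<Sum>m\<le>d. s ^ m * zeta_integral f k l (\<psi> m) s)"
    using zeta_spanE[OF assms] by metis
  show ?thesis
    by (rule zeta_spanI[where \<psi> = "\<lambda>m x. c * \<psi> m x" and d = d and R = R])
       (auto intro: test_function_cmult * simp: *(2) zeta_integral_cmult sum_distrib_left mult_ac)
qed

lemma zeta_span_mult_shift_power:
  assumes V: "open V" "holo_on f V" and J: "zeta_span f V k l J"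
  shows "zeta_span f V k l (\<lambda>s. (s + c) ^ m * J s)"
proof (induction m)
  case (Suc m)
  have "zeta_span f V k l (\<lambda>s. s * ((s + c) ^ m * J s) + c * ((s + c) ^ m * J s))"
    by (intro zeta_span_add[OF V] zeta_span_mult_s zeta_span_cmult Suc)
  thus ?case by (simp add: ring_distribs mult_ac)
qed (simp add: J)

lemma zeta_span_sum:
  assumes V: "open V" "holo_on f V" and J: "\<And>i. i \<in> I \<Longrightarrow> zeta_span f V k l (J i)"
  shows "zeta_span f V k l (\<lambda>s. \<Sum>i\<in>I. J i s)"
  using J by (induction I rule: infinite_finite_induct) (auto intro!: zeta_span_0 zeta_span_add[OF V])

text \<open>
  A denominator \<open>f\<^sup>N\<close> lowers the twist \<open>k\<close> by \<open>N\<close>; nothing else is lost.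
\<close>

lemma zeta_span_fs_section:
  fixes f :: "complex^'n \<Rightarrow> complex"
  assumes V: "open V" "holo_on f V" and \<phi>: "test_function V \<phi>" and h: "fs_section f V h"
  obtains N where "zeta_span f V (k - int N) l (zeta_pairing f k l h \<phi>)"
proof -
  obtain N d g where g: "\<And>k. holo_on (g k) V" "\<And>s y. y \<in> V \<Longrightarrow> f y \<noteq> 0 \<Longrightarrow> h s y = (\<Sum>k\<le>d. s ^ k * g k y) / f y ^ N"
    using fs_sectionE[OF h] by metis
  have "zeta_span f V (k - int N) l (\<lambda>s. \<Sum>m\<le>d. (s + of_int k) ^ m * zeta_integral f (k - int N) l (\<lambda>x. g m x * \<phi> x) s)"
    by (intro zeta_span_sum[OF V] zeta_span_mult_shift_power[OF V] zeta_span_integral holo_mult_test_function[OF V(1) g(1) \<phi>])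
  moreover have "zeta_pairing f k l h \<phi> s = (\<Sum>m\<le>d. (s + of_int k) ^ m * zeta_integral f (k - int N) l (\<lambda>x. g m x * \<phi> x) s)"
    if "Re s > - (of_int (k - int N) + of_int l) / 2" for s
  proof -
    have s: "2 * Re s + of_int (k - int N) + of_int l > 0" using that by (simp add: field_simps)
    show ?thesis
      by (rule zeta_pairing_expand(2)[where h = h and d = d and N = N and g = g, OF V \<phi> g s])
  qed
  ultimately have "zeta_span f V (k - int N) l (zeta_pairing f k l h \<phi>)"
    by (rule zeta_span_cong)
  thus ?thesis by (rule that)
qed

lemma zeta_span_word_power:
  fixes f :: "complex^'n \<Rightarrow> complex"
  assumes V: "open V" "holo_on f V" and \<phi>: "test_function V \<phi>"
  shows "zeta_span f V (k + int j) l (zeta_pairing f k l (\<lambda>s. foldr (conn f s) w (\<lambda>z. f z ^ j)) \<phi>)"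
proof -
  have "fs_section f V (\<lambda>_ z. f z ^ j)" by (intro fs_section_holo holo_on_power V)
  from zeta_pairing_word[OF V this \<phi>] obtain \<psi> R where \<psi>: "test_function V \<psi>"
    "\<And>s. Re s > R \<Longrightarrow> zeta_pairing f k l (\<lambda>s. foldr (conn f s) w (\<lambda>z. f z ^ j)) \<phi> s = zeta_pairing f k l (\<lambda>_ z. f z ^ j) \<psi> s"
    by blast
  have "zeta_pairing f k l (\<lambda>_ z. f z ^ j) \<psi> s = zeta_integral f (k + int j) l \<psi> s" for s
  proof -
    have "zeta_kernel s k l (f x) * (f x ^ j * \<psi> x) = zeta_kernel s (k + int j) l (f x) * \<psi> x" for x
      using zeta_kernel_add[of "f x" s k "int j" l] by (cases "f x = 0") auto
    thus ?thesis unfolding zeta_pairing_def zeta_integral_def by (simp only:)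
  qed
  thus ?thesis using \<psi> by (intro zeta_span_cong[OF zeta_span_integral[OF \<psi>(1)]]) auto
qed

text \<open>
  If \<open>P\<close> is an operator with coefficients in \<open>O[s]\<close>, then \<open>P(s + k) f\<^sup>s\<^sup>+\<^sup>k\<^sup>+\<^sup>j\<close>, paired with \<open>\<phi>\<close>, has the
  twist \<open>k + j\<close>: all derivatives move to the test function, so no denominators appear, in contrast to
  \<open>zeta_span_fs_section\<close>.
\<close>

lemma zeta_span_operator:
  fixes f :: "complex^'n \<Rightarrow> complex"
  assumes V: "open V" "holo_on f V" and \<phi>: "test_function V \<phi>" 
    and P: "\<And>w. w \<in> W \<Longrightarrow> holo_poly_on (P w) V"
  shows "zeta_span f V (k + int j) l (zeta_pairing f k l (\<lambda>s y. \<Sum>w\<in>W. poly (P w y) s * foldr (conn f s) w (\<lambda>z. f z ^ j) y) \<phi>)"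
  using P
proof (induction W rule: infinite_finite_induct)
  case (insert w W)
  let ?h = "\<lambda>w s. foldr (conn f s) w (\<lambda>z. f z ^ j)"
  let ?p = "\<lambda>w s y. poly (P w y) s * ?h w s y"
  have hw: "fs_section f V (?h w)" for w
    by (intro fs_section_word V fs_section_holo holo_on_power)
  have expand: "\<exists>d. \<forall>s. \<forall>y\<in>V. ?p w s y = (\<Sum>m\<le>d. s ^ m * (coeff (P w y) m * ?h w s y))"
    and cf: "\<forall>m. holo_on (\<lambda>y. coeff (P w y) m) V" if hp: "holo_poly_on (P w) V" for w
  proof -
    obtain d where d: "\<forall>y\<in>V. degree (P w y) \<le> d" using hp unfolding holo_poly_on_def by blast
    have "?p w s y = (\<Sum>m\<le>d. s ^ m * (coeff (P w y) m * ?h w s y))" if "y \<in> V" for s y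
      unfolding poly_altdef sum_distrib_right
      by (rule sum.mono_neutral_cong_left) (use d that in \<open>auto simp: coeff_eq_0\<close>)
    thus "\<exists>d. \<forall>s. \<forall>y\<in>V. ?p w s y = (\<Sum>m\<le>d. s ^ m * (coeff (P w y) m * ?h w s y))" by blast
    show "\<forall>m. holo_on (\<lambda>y. coeff (P w y) m) V" using that unfolding holo_poly_on_def by blast
  qed
  have fsp: "fs_section f V (?p w)" if w: "holo_poly_on (P w) V" for w
  proof -
    obtain d where d: "\<And>s y. y \<in> V \<Longrightarrow> ?p w s y = (\<Sum>m\<le>d. s ^ m * (coeff (P w y) m * ?h w s y))"
      using expand[OF w] by blast
    have "fs_section f V (\<lambda>s y. \<Sum>m\<le>d. s ^ m * (coeff (P w y) m * ?h w s y))"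
      by (intro fs_section_sum V fs_section_mult_power fs_section_holo_mult hw cf[OF w, rule_format])
    thus ?thesis by (rule fs_section_cong) (rule d)
  qed
  have span: "zeta_span f V (k + int j) l (zeta_pairing f k l (?p w) \<phi>)"
  proof -
    have w: "holo_poly_on (P w) V" using insert.prems by simp
    obtain d where d: "\<And>s y. y \<in> V \<Longrightarrow> ?p w s y = (\<Sum>m\<le>d. s ^ m * (coeff (P w y) m * ?h w s y))"
      using expand[OF w] by blast
    let ?c = "\<lambda>m y. coeff (P w y) m * \<phi> y"
    have c: "test_function V (?c m)" for m
      by (intro holo_mult_test_function V \<phi> cf[OF w, rule_format])
    have "\<exists>R. \<forall>s. Re s > R \<longrightarrow> integrable lborel (\<lambda>x. zeta_kernel s k l (f x) * (?h w (s + of_int k) x * ?c m x))" for m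
      by (rule zeta_pairing_integrable[OF V c hw]) blast
    hence "\<forall>m. \<exists>R. \<forall>s. Re s > R \<longrightarrow> integrable lborel (\<lambda>x. zeta_kernel s k l (f x) * (?h w (s + of_int k) x * ?c m x))" ..
    from choice[OF this] obtain R where "\<forall>m s. Re s > R m \<longrightarrow> integrable lborel (\<lambda>x. zeta_kernel s k l (f x) * (?h w (s + of_int k) x * ?c m x))"
      by (elim exE)
    hence R: "integrable lborel (\<lambda>x. zeta_kernel s k l (f x) * (?h w (s + of_int k) x * ?c m x))" if "Re s > R m" for m s
      using that by (simp only:)
    have "zeta_span f V (k + int j) l (\<lambda>s. \<Sum>m\<le>d. (s + of_int k) ^ m * zeta_pairing f k l (?h w) (?c m) s)"
      by (intro zeta_span_sum[OF V] zeta_span_mult_shift_power[OF V] zeta_span_word_power V c)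
    thus ?thesis
    proof (rule zeta_span_cong[where R = "Max (R ` {..d})"])
      fix s assume "Re s > Max (R ` {..d})"
      hence s: "Re s > R m" if "m \<le> d" for m using that by simp
      have "zeta_kernel s k l (f x) * (?p w (s + of_int k) x * \<phi> x)
        = (\<Sum>m\<le>d. (s + of_int k) ^ m * (zeta_kernel s k l (f x) * (?h w (s + of_int k) x * ?c m x)))" for x
      proof (cases "x \<in> V")
        case True
        show ?thesis unfolding d[OF True] by (simp add: sum_distrib_left sum_distrib_right mult_ac)
      next
        case False
        thus ?thesis using test_function_zero_outside[OF \<phi>] by simp
      qed
      thus "zeta_pairing f k l (?p w) \<phi> s = (\<Sum>m\<le>d. (s + of_int k) ^ m * zeta_pairing f k l (?h w) (?c m) s)"
        unfolding zeta_pairing_def using R[OF s] by simp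
    qed
  qed
  have IH: "zeta_span f V (k + int j) l (zeta_pairing f k l (\<lambda>s y. \<Sum>w\<in>W. ?p w s y) \<phi>)"
    using insert by simp
  obtain R1 where R1: "\<And>s. Re s > R1 \<Longrightarrow> integrable lborel (\<lambda>x. zeta_kernel s k l (f x) * (?p w (s + of_int k) x * \<phi> x))"
    by (rule zeta_pairing_integrable[OF V \<phi> fsp]) (use insert.prems in auto)
  have "fs_section f V (\<lambda>s y. \<Sum>w\<in>W. ?p w s y)"
    by (intro fs_section_sum V fsp) (use insert.prems in auto)
  then obtain R2 where R2: "\<And>s. Re s > R2 \<Longrightarrow> integrable lborel (\<lambda>x. zeta_kernel s k l (f x) * ((\<Sum>w\<in>W. ?p w (s + of_int k) x) * \<phi> x))"
    by (rule zeta_pairing_integrable[OF V \<phi>]) blast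
  show ?case
  proof (rule zeta_span_cong[OF zeta_span_add[OF V span IH], where R = "max R1 R2"])
    fix s assume "Re s > max R1 R2"
    hence "Re s > R1" "Re s > R2" by auto
    from R1[OF this(1)] R2[OF this(2)]
    show "zeta_pairing f k l (\<lambda>s y. \<Sum>w\<in>insert w W. ?p w s y) \<phi> s
       = zeta_pairing f k l (?p w) \<phi> s + zeta_pairing f k l (\<lambda>s y. \<Sum>w\<in>W. ?p w s y) \<phi> s"
      unfolding zeta_pairing_def sum.insert[OF insert.hyps] by (simp only: ring_distribs Bochner_Integration.integral_add)
  qed
qed (auto intro!: zeta_span_cong[OF zeta_span_0] simp: zeta_pairing_def)

section \<open>Modules generated by powers\<close>

lemma holo_poly_on_const: "holo_poly_on (\<lambda>_. p) V"
  unfolding holo_poly_on_def by (auto intro: holo_on_const)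

lemma holo_poly_on_add:
  assumes "holo_poly_on a V" "holo_poly_on b V" shows "holo_poly_on (\<lambda>x. a x + b x) V"
proof -
  obtain d e where "\<forall>x\<in>V. degree (a x) \<le> d" "\<forall>x\<in>V. degree (b x) \<le> e"
    using assms unfolding holo_poly_on_def by blast
  hence "\<forall>x\<in>V. degree (a x + b x) \<le> max d e"
    by (meson degree_add_le_max max.mono order_trans)
  thus ?thesis using assms unfolding holo_poly_on_def by (auto intro: holo_on_add)
qed

lemma holo_poly_on_sum: "(\<And>i. i \<in> I \<Longrightarrow> holo_poly_on (a i) V) \<Longrightarrow> holo_poly_on (\<lambda>x. \<Sum>i\<in>I. a i x) V"
  by (induction I rule: infinite_finite_induct) (auto intro: holo_poly_on_const holo_poly_on_add)

lemma holo_poly_on_mult: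
  assumes "holo_poly_on a V" "holo_poly_on b V" shows "holo_poly_on (\<lambda>x. a x * b x) V"
proof -
  obtain d e where "\<forall>x\<in>V. degree (a x) \<le> d" "\<forall>x\<in>V. degree (b x) \<le> e"
    using assms unfolding holo_poly_on_def by blast
  hence "\<forall>x\<in>V. degree (a x * b x) \<le> d + e"
    by (meson degree_mult_le add_mono order_trans)
  thus ?thesis using assms unfolding holo_poly_on_def coeff_mult
    by (auto intro!: holo_on_sum holo_on_mult)
qed

lemma holo_poly_on_smult:
  assumes "holo_on a V" shows "holo_poly_on (\<lambda>x. smult (a x) p) V"
  unfolding holo_poly_on_def using assms
  by (auto intro!: holo_on_mult holo_on_const exI[of _ "degree p"] simp: degree_smult_eq)

lemma holo_poly_on_degree_bound:
  assumes "holo_poly_on a V"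
  obtains d where "\<And>x c. x \<in> V \<Longrightarrow> poly (a x) c = (\<Sum>n\<le>d. coeff (a x) n * c ^ n)"
proof -
  obtain d where d: "\<forall>x\<in>V. degree (a x) \<le> d" using assms unfolding holo_poly_on_def by blast
  show ?thesis
  proof (rule that)
    fix x c assume "x \<in> V"
    thus "poly (a x) c = (\<Sum>n\<le>d. coeff (a x) n * c ^ n)"
      unfolding poly_altdef using d by (intro sum.mono_neutral_left) (auto simp: coeff_eq_0)
  qed
qed

lemma holo_poly_on_coeff: "holo_poly_on a V \<Longrightarrow> holo_on (\<lambda>x. coeff (a x) k) V"
  unfolding holo_poly_on_def by blast

text \<open>
  Membership of \<open>h\<close> in the \<open>D[s]\<close>-module generated by \<open>u\<close>, tested by evaluation at all complex numbers
  \<open>c\<close> in place of \<open>s\<close>. A polynomial is determined by its values, so nothing is lost, and operators act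
  through the plain connection \<^const>\<open>conn\<close> instead of its polynomial version.
\<close>

definition D_span :: "(complex^'n \<Rightarrow> complex) \<Rightarrow> (complex^'n) set \<Rightarrow> (complex \<Rightarrow> complex^'n \<Rightarrow> complex)
    \<Rightarrow> (complex \<Rightarrow> complex^'n \<Rightarrow> complex) \<Rightarrow> bool" where
  "D_span f V u h \<longleftrightarrow> (\<exists>P\<in>diff_ops_s V. \<forall>c. \<forall>y\<in>V. f y \<noteq> 0 \<longrightarrow>
     h c y = (\<Sum>w | P w \<noteq> (\<lambda>_. 0). poly (P w y) c * foldr (conn f c) w (u c) y))"

lemma D_spanI:
  assumes "finite W" "\<And>w. w \<in> W \<Longrightarrow> holo_poly_on (P w) V"
    "\<And>c y. y \<in> V \<Longrightarrow> f y \<noteq> 0 \<Longrightarrow> h c y = (\<Sum>w\<in>W. poly (P w y) c * foldr (conn f c) w (u c) y)"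
  shows "D_span f V u h"
proof -
  let ?P = "\<lambda>w. if w \<in> W then P w else (\<lambda>_. 0)"
  have sub: "{w. ?P w \<noteq> (\<lambda>_. 0)} \<subseteq> W" by auto
  have mem: "?P \<in> diff_ops_s V"
    using assms(1,2) finite_subset[OF sub] by (auto simp: diff_ops_s_def intro: holo_poly_on_const)
  have eq: "h c y = (\<Sum>w | ?P w \<noteq> (\<lambda>_. 0). poly (?P w y) c * foldr (conn f c) w (u c) y)" if "y \<in> V" "f y \<noteq> 0" for c y
    unfolding assms(3)[OF that] using assms(1) sub by (intro sum.mono_neutral_cong_right) (auto split: if_splits)
  show ?thesis unfolding D_span_def
    using mem eq by (intro bexI[of _ ?P] allI ballI impI)
qed

lemma D_spanE:
  assumes "D_span f V u h"
  obtains W P where "finite W" "\<And>w. holo_poly_on (P w) V"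
    "\<And>c y. y \<in> V \<Longrightarrow> f y \<noteq> 0 \<Longrightarrow> h c y = (\<Sum>w\<in>W. poly (P w y) c * foldr (conn f c) w (u c) y)"
  using assms unfolding D_span_def diff_ops_s_def by blast

lemma D_span_cong:
  assumes "D_span f V u h" "\<And>c y. y \<in> V \<Longrightarrow> f y \<noteq> 0 \<Longrightarrow> h' c y = h c y"
  shows "D_span f V u h'"
  using assms unfolding D_span_def by simp

lemma D_span_mono:
  assumes "D_span f V u h" "V' \<subseteq> V" shows "D_span f V' u h"
proof -
  have "diff_ops_s V \<subseteq> diff_ops_s V'"
    using assms(2) holo_on_subset unfolding diff_ops_s_def holo_poly_on_def by blast
  thus ?thesis using assms unfolding D_span_def by blast
qed

lemma D_span_term: "holo_poly_on a V \<Longrightarrow> D_span f V u (\<lambda>c y. poly (a y) c * foldr (conn f c) w (u c) y)"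
  by (rule D_spanI[where W = "{w}" and P = "\<lambda>_. a"]) auto

lemma D_span_add:
  assumes "D_span f V u h1" "D_span f V u h2" shows "D_span f V u (\<lambda>c y. h1 c y + h2 c y)"
proof -
  obtain W1 P1 where 1: "finite W1" "\<And>w. holo_poly_on (P1 w) V"
    "\<And>c y. y \<in> V \<Longrightarrow> f y \<noteq> 0 \<Longrightarrow> h1 c y = (\<Sum>w\<in>W1. poly (P1 w y) c * foldr (conn f c) w (u c) y)"
    by (rule D_spanE[OF assms(1)]) (rule that)
  obtain W2 P2 where 2: "finite W2" "\<And>w. holo_poly_on (P2 w) V"
    "\<And>c y. y \<in> V \<Longrightarrow> f y \<noteq> 0 \<Longrightarrow> h2 c y = (\<Sum>w\<in>W2. poly (P2 w y) c * foldr (conn f c) w (u c) y)"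
    by (rule D_spanE[OF assms(2)]) (rule that)
  let ?P = "\<lambda>w y. (if w \<in> W1 then P1 w y else 0) + (if w \<in> W2 then P2 w y else 0)"
  show ?thesis
  proof (rule D_spanI[where W = "W1 \<union> W2" and P = ?P])
    show "finite (W1 \<union> W2)" using 1(1) 2(1) by simp
    show "holo_poly_on (?P w) V" for w
      using 1(2)[of w] 2(2)[of w] by (cases "w \<in> W1"; cases "w \<in> W2") (simp_all add: holo_poly_on_add holo_poly_on_const)
    fix c y assume y: "y \<in> V" "f y \<noteq> 0"
    let ?t = "\<lambda>w. foldr (conn f c) w (u c) y"
    have "(\<Sum>w\<in>W1. poly (P1 w y) c * ?t w) = (\<Sum>w\<in>W1 \<union> W2. poly (if w \<in> W1 then P1 w y else 0) c * ?t w)"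
      using 1(1) 2(1) by (intro sum.mono_neutral_cong_left) auto
    moreover have "(\<Sum>w\<in>W2. poly (P2 w y) c * ?t w) = (\<Sum>w\<in>W1 \<union> W2. poly (if w \<in> W2 then P2 w y else 0) c * ?t w)"
      using 1(1) 2(1) by (intro sum.mono_neutral_cong_left) auto
    ultimately show "h1 c y + h2 c y = (\<Sum>w\<in>W1 \<union> W2. poly (?P w y) c * ?t w)"
      by (simp only: 1(3)[OF y] 2(3)[OF y] poly_add distrib_right sum.distrib)
  qed
qed

lemma D_span_0: "D_span f V u (\<lambda>_ _. 0)"
  by (rule D_spanI[where W = "{}" and P = "\<lambda>_ _. 0"]) auto

lemma D_span_sum: "(\<And>i. i \<in> I \<Longrightarrow> D_span f V u (h i)) \<Longrightarrow> D_span f V u (\<lambda>c y. \<Sum>i\<in>I. h i c y)"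
  by (induction I rule: infinite_finite_induct) (auto intro: D_span_0 D_span_add)

lemma D_span_mult:
  assumes "holo_poly_on a V" "D_span f V u h"
  shows "D_span f V u (\<lambda>c y. poly (a y) c * h c y)"
proof -
  obtain W P where *: "finite W" "\<And>w. holo_poly_on (P w) V"
    "\<And>c y. y \<in> V \<Longrightarrow> f y \<noteq> 0 \<Longrightarrow> h c y = (\<Sum>w\<in>W. poly (P w y) c * foldr (conn f c) w (u c) y)"
    by (rule D_spanE[OF assms(2)]) (rule that)
  show ?thesis
    by (rule D_spanI[where W = W and P = "\<lambda>w y. a y * P w y"])
       (auto intro: holo_poly_on_mult * assms(1) simp: *(3) sum_distrib_left mult.assoc)
qed

text \<open>
  Holds although \<open>h\<close> is controlled only off the zeros of \<open>f\<close>, because these form a closed set.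
\<close>

lemma fs_section_line_derivative:
  assumes V: "open V" "holo_on f V" and h: "fs_section f V h" and y: "y \<in> V" "f y \<noteq> 0"
  shows "((\<lambda>t. h c (y + t *s axis i 1)) has_field_derivative pd i (h c) y) (at 0)"
proof -
  obtain N d g where g: "\<And>k. holo_on (g k) V" "\<And>s y. y \<in> V \<Longrightarrow> f y \<noteq> 0 \<Longrightarrow> h s y = (\<Sum>k\<le>d. s ^ k * g k y) / f y ^ N"
    by (rule fs_sectionE[OF h]) (rule that)
  let ?L = "\<lambda>t. y + t *s axis i 1"
  let ?q = "\<lambda>t. (\<Sum>k\<le>d. c ^ k * g k (?L t)) / f (?L t) ^ N"
  have df: "((\<lambda>t. f (?L t)) has_field_derivative pd i f y) (at 0)"
    by (rule holo_on_has_field_derivative_line[OF V(2) y(1)])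
  have n: "((\<lambda>t. \<Sum>k\<le>d. c ^ k * g k (?L t)) has_field_derivative (\<Sum>k\<le>d. c ^ k * pd i (g k) y)) (at 0)"
    by (intro DERIV_sum DERIV_cmult holo_on_has_field_derivative_line[OF g(1) y(1)])
  obtain D where D: "(?q has_field_derivative D) (at 0)"
    using DERIV_divide[OF n DERIV_power[OF df, of N]] y(2) by auto
  have "open (?L -` {y \<in> V. f y \<noteq> 0})"
    by (intro open_vimage open_nonzero_set V continuous_intros bounded_linear.continuous_on[OF bounded_linear_scalar_mult_axis])
  hence "((\<lambda>t. h c (?L t)) has_field_derivative D) (at 0)"
    by (rule has_field_derivative_transform_within_open[OF D]) (use y g(2) in auto)
  thus ?thesis using pd_eqI by metis
qed

lemma conn_holo_mult:
  assumes V: "open V" "holo_on f V" and a: "holo_on a V" and h: "fs_section f V h" and y: "y \<in> V" "f y \<noteq> 0"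
  shows "conn f e i (\<lambda>z. a z * h c z) y = pd i a y * h c y + a y * conn f e i (h c) y"
proof -
  have "pd i (\<lambda>z. a z * h c z) y = pd i a y * h c y + a y * pd i (h c) y"
    using DERIV_mult[OF holo_on_has_field_derivative_line[OF a y(1)] fs_section_line_derivative[OF V h y, of c]]
    by (intro pd_eqI) (simp add: mult_ac add_ac)
  thus ?thesis by (simp add: conn_def algebra_simps)
qed

lemma conn_sum:
  assumes V: "open V" "holo_on f V" and h: "\<And>w. w \<in> W \<Longrightarrow> fs_section f V (h w)" and y: "y \<in> V" "f y \<noteq> 0"
  shows "conn f e i (\<lambda>z. \<Sum>w\<in>W. h w c z) y = (\<Sum>w\<in>W. conn f e i (h w c) y)"
proof -
  have "pd i (\<lambda>z. \<Sum>w\<in>W. h w c z) y = (\<Sum>w\<in>W. pd i (h w c) y)"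
    by (intro pd_eqI DERIV_sum fs_section_line_derivative[OF V h y])
  thus ?thesis by (simp add: conn_def sum.distrib sum_distrib_left sum_distrib_right sum_divide_distrib)
qed

lemma D_span_fs_section:
  assumes V: "open V" "holo_on f V" and u: "fs_section f V u" and h: "D_span f V u h"
  shows "fs_section f V h"
proof -
  obtain W P where *: "finite W" "\<And>w. holo_poly_on (P w) V"
    "\<And>c y. y \<in> V \<Longrightarrow> f y \<noteq> 0 \<Longrightarrow> h c y = (\<Sum>w\<in>W. poly (P w y) c * foldr (conn f c) w (u c) y)"
    by (rule D_spanE[OF h]) (rule that)
  have mult: "fs_section f V (\<lambda>c y. poly (a y) c * t c y)" if a: "holo_poly_on a V" and t: "fs_section f V t" for a t
  proof -
    obtain d where d: "\<And>x c. x \<in> V \<Longrightarrow> poly (a x) c = (\<Sum>n\<le>d. coeff (a x) n * c ^ n)"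
      using holo_poly_on_degree_bound[OF a] by metis
    have "fs_section f V (\<lambda>c y. \<Sum>n\<le>d. c ^ n * (coeff (a y) n * t c y))"
      by (intro fs_section_sum V fs_section_mult_power fs_section_holo_mult holo_poly_on_coeff[OF a] t)
    thus ?thesis by (rule fs_section_cong) (simp add: d sum_distrib_left sum_distrib_right mult_ac)
  qed
  have "fs_section f V (\<lambda>c y. \<Sum>w\<in>W. poly (P w y) c * foldr (conn f c) w (u c) y)"
    by (intro fs_section_sum V mult *(2) fs_section_word u)
  thus ?thesis by (rule fs_section_cong) (rule *(3))
qed

text \<open>
  The Leibniz rule \<open>\<partial>\<^sub>i (a Q u) = (\<partial>\<^sub>i a) Q u + a (\<partial>\<^sub>i Q u)\<close> for each term of the operator. The
  coefficients of the new operator are again polynomials in \<open>s\<close> with holomorphic coefficients.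
\<close>

lemma D_span_conn:
  assumes V: "open V" "holo_on f V" and u: "fs_section f V u" and h: "D_span f V u h"
  shows "D_span f V u (\<lambda>c. conn f c i (h c))"
proof -
  obtain W P where *: "finite W" "\<And>w. holo_poly_on (P w) V"
    "\<And>c y. y \<in> V \<Longrightarrow> f y \<noteq> 0 \<Longrightarrow> h c y = (\<Sum>w\<in>W. poly (P w y) c * foldr (conn f c) w (u c) y)"
    by (rule D_spanE[OF h]) (rule that)
  let ?t = "\<lambda>w c. foldr (conn f c) w (u c)"
  have t: "fs_section f V (?t w)" for w by (intro fs_section_word V u)
  have Pt: "fs_section f V (\<lambda>c y. poly (P w y) c * ?t w c y)" for w
    by (rule D_span_fs_section[OF V u D_span_term[OF *(2)]])
  have "\<exists>Q. holo_poly_on Q V \<and> (\<forall>c. \<forall>y\<in>V. f y \<noteq> 0 \<longrightarrow>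
      conn f c i (\<lambda>z. poly (P w z) c * ?t w c z) y = poly (Q y) c * ?t w c y + poly (P w y) c * ?t (i # w) c y)" for w
  proof -
    obtain d where d: "\<And>x c. x \<in> V \<Longrightarrow> poly (P w x) c = (\<Sum>n\<le>d. coeff (P w x) n * c ^ n)"
      using holo_poly_on_degree_bound[OF *(2)] by metis
    let ?c = "\<lambda>n x. coeff (P w x) n"
    let ?Q = "\<lambda>y. \<Sum>n\<le>d. smult (pd i (?c n) y) (monom 1 n)"
    have "holo_poly_on ?Q V"
      by (intro holo_poly_on_sum holo_poly_on_smult holo_on_pd holo_poly_on_coeff *(2) V)
    moreover have "conn f c i (\<lambda>z. poly (P w z) c * ?t w c z) y = poly (?Q y) c * ?t w c y + poly (P w y) c * ?t (i # w) c y"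
      if y: "y \<in> V" "f y \<noteq> 0" for c y
    proof -
      let ?a = "\<lambda>z. \<Sum>n\<le>d. ?c n z * c ^ n"
      have a: "holo_on ?a V" by (intro holo_on_sum holo_on_mult holo_on_const holo_poly_on_coeff *(2))
      have "conn f c i (\<lambda>z. poly (P w z) c * ?t w c z) y = conn f c i (\<lambda>z. ?a z * ?t w c z) y"
        by (rule conn_cong[OF V(1) y(1)]) (simp add: d)
      also have "\<dots> = pd i ?a y * ?t w c y + ?a y * conn f c i (?t w c) y"
        by (rule conn_holo_mult[OF V a t y])
      also have "pd i ?a y = (\<Sum>n\<le>d. pd i (?c n) y * c ^ n)"
        by (intro pd_eqI DERIV_sum DERIV_cmult_right holo_on_has_field_derivative_line[OF holo_poly_on_coeff[OF *(2)] y(1)])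
      also have "\<dots> = poly (?Q y) c" by (simp add: poly_sum poly_monom)
      finally show ?thesis using d[OF y(1)] by simp
    qed
    ultimately show ?thesis by blast
  qed
  hence "\<forall>w. \<exists>Q. holo_poly_on Q V \<and> (\<forall>c. \<forall>y\<in>V. f y \<noteq> 0 \<longrightarrow>
      conn f c i (\<lambda>z. poly (P w z) c * ?t w c z) y = poly (Q y) c * ?t w c y + poly (P w y) c * ?t (i # w) c y)" ..
  from choice[OF this] obtain Q where Q: "\<forall>w. holo_poly_on (Q w) V \<and> (\<forall>c. \<forall>y\<in>V. f y \<noteq> 0 \<longrightarrow>
      conn f c i (\<lambda>z. poly (P w z) c * ?t w c z) y = poly (Q w y) c * ?t w c y + poly (P w y) c * ?t (i # w) c y)" ..
  have "D_span f V u (\<lambda>c y. \<Sum>w\<in>W. poly (Q w y) c * ?t w c y + poly (P w y) c * ?t (i # w) c y)"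
    using Q *(2) by (intro D_span_sum D_span_add D_span_term) auto
  thus ?thesis
  proof (rule D_span_cong)
    fix c y assume y: "y \<in> V" "f y \<noteq> 0"
    have "conn f c i (h c) y = conn f c i (\<lambda>z. \<Sum>w\<in>W. poly (P w z) c * ?t w c z) y"
      by (rule conn_cong[OF open_nonzero_set[OF V]]) (use y *(3) in auto)
    also have "\<dots> = (\<Sum>w\<in>W. conn f c i (\<lambda>z. poly (P w z) c * ?t w c z) y)"
      using conn_sum[where h = "\<lambda>w c y. poly (P w y) c * ?t w c y" and W = W, OF V Pt y] .
    also have "\<dots> = (\<Sum>w\<in>W. poly (Q w y) c * ?t w c y + poly (P w y) c * ?t (i # w) c y)"
      using Q y by (intro sum.cong) auto
    finally show "conn f c i (h c) y = (\<Sum>w\<in>W. poly (Q w y) c * ?t w c y + poly (P w y) c * ?t (i # w) c y)" .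
  qed
qed

lemma D_span_word:
  assumes V: "open V" "holo_on f V" and u: "fs_section f V u" and h: "D_span f V u h"
  shows "D_span f V u (\<lambda>c. foldr (conn f c) w (h c))"
  by (induction w) (auto intro!: D_span_conn[OF V u] h)

text \<open>
  Composition of operators, stated for the modules that they generate: this avoids a formula for the
  product of two differential operators.
\<close>

lemma D_span_trans:
  assumes V: "open V" "holo_on f V" and u: "fs_section f V u" and h: "D_span f V u h" and k: "D_span f V h k"
  shows "D_span f V u k"
proof -
  obtain W P where *: "finite W" "\<And>w. holo_poly_on (P w) V"
    "\<And>c y. y \<in> V \<Longrightarrow> f y \<noteq> 0 \<Longrightarrow> k c y = (\<Sum>w\<in>W. poly (P w y) c * foldr (conn f c) w (h c) y)"
    by (rule D_spanE[OF k]) (rule that)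
  have "D_span f V u (\<lambda>c y. \<Sum>w\<in>W. poly (P w y) c * foldr (conn f c) w (h c) y)"
    by (intro D_span_sum D_span_mult *(2) D_span_word V u h)
  thus ?thesis by (rule D_span_cong) (rule *(3))
qed

text \<open>
  \<open>f\<^sup>c (f\<^sup>j h) = f\<^sup>c\<^sup>+\<^sup>j h\<close>: a factor \<open>f\<^sup>j\<close> shifts the exponent of the connection.
\<close>

lemma word_power_mult:
  assumes V: "open V" "holo_on f V" and h: "fs_section f V h" and y: "y \<in> V" "f y \<noteq> 0"
  shows "foldr (conn f c) w (\<lambda>z. f z ^ j * h (c + of_nat j) z) y = f y ^ j * foldr (conn f (c + of_nat j)) w (h (c + of_nat j)) y"
  using y
proof (induction w arbitrary: y)
  case (Cons i w)
  let ?e = "c + of_nat j"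
  have t: "fs_section f V (\<lambda>s. foldr (conn f s) w (h s))" by (intro fs_section_word V h)
  have "foldr (conn f c) (i # w) (\<lambda>z. f z ^ j * h ?e z) y = conn f c i (\<lambda>z. f z ^ j * foldr (conn f ?e) w (h ?e) z) y"
    unfolding foldr.simps comp_def by (rule conn_cong[OF open_nonzero_set[OF V]]) (use Cons in auto)
  also have "\<dots> = pd i (\<lambda>z. f z ^ j) y * foldr (conn f ?e) w (h ?e) y + f y ^ j * conn f c i (foldr (conn f ?e) w (h ?e)) y"
    by (rule conn_holo_mult[OF V holo_on_power[OF V(2)] t Cons.prems])
  also have "pd i (\<lambda>z. f z ^ j) y = of_nat j * f y ^ j * (pd i f y / f y)"
  proof -
    have "pd i (\<lambda>z. f z ^ j) y = of_nat j * (pd i f y * f y ^ (j - 1))"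
      by (rule pd_eqI) (use DERIV_power[OF holo_on_has_field_derivative_line[OF V(2) Cons.prems(1)], where n = j] in simp)
    thus ?thesis using Cons.prems(2) by (cases j) auto
  qed
  finally show ?case by (simp add: conn_def algebra_simps)
qed simp

lemma word_cmult:
  assumes V: "open V" "holo_on f V" and h: "fs_section f V h" and y: "y \<in> V" "f y \<noteq> 0"
  shows "foldr (conn f c) w (\<lambda>z. a * h c z) y = a * foldr (conn f c) w (h c) y"
  using y
proof (induction w arbitrary: y)
  case (Cons i w)
  have t: "fs_section f V (\<lambda>s. foldr (conn f s) w (h s))" by (intro fs_section_word V h)
  have "foldr (conn f c) (i # w) (\<lambda>z. a * h c z) y = conn f c i (\<lambda>z. a * foldr (conn f c) w (h c) z) y"
    unfolding foldr.simps comp_def by (rule conn_cong[OF open_nonzero_set[OF V]]) (use Cons in auto)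
  also have "\<dots> = pd i (\<lambda>_. a) y * foldr (conn f c) w (h c) y + a * conn f c i (foldr (conn f c) w (h c)) y"
    by (rule conn_holo_mult[OF V holo_on_const t Cons.prems])
  also have "pd i (\<lambda>_. a) y = 0" by (rule pd_eqI) simp
  finally show ?case by simp
qed simp

text \<open>
  Substitute \<open>s + j\<close> for \<open>s\<close> in \<open>P(s) f\<^sup>s\<^sup>+\<^sup>m = h(s) f\<^sup>s\<close>.
\<close>

lemma D_span_shift:
  assumes V: "open V" "holo_on f V" and h: "D_span f V (\<lambda>_ z. f z ^ m) h"
  shows "D_span f V (\<lambda>_ z. f z ^ (j + m)) (\<lambda>c y. f y ^ j * h (c + of_nat j) y)"
proof -
  obtain W P where *: "finite W" "\<And>w. holo_poly_on (P w) V"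
    "\<And>c y. y \<in> V \<Longrightarrow> f y \<noteq> 0 \<Longrightarrow> h c y = (\<Sum>w\<in>W. poly (P w y) c * foldr (conn f c) w (\<lambda>z. f z ^ m) y)"
    by (rule D_spanE[OF h]) (rule that)
  have "\<exists>Q. holo_poly_on Q V \<and> (\<forall>c. \<forall>y\<in>V. poly (Q y) c = poly (P w y) (c + of_nat j))" for w
  proof -
    obtain d where d: "\<And>x c. x \<in> V \<Longrightarrow> poly (P w x) c = (\<Sum>n\<le>d. coeff (P w x) n * c ^ n)"
      using holo_poly_on_degree_bound[OF *(2)] by metis
    let ?Q = "\<lambda>y. \<Sum>n\<le>d. smult (coeff (P w y) n) ([:of_nat j, 1:] ^ n)"
    have "holo_poly_on ?Q V" by (intro holo_poly_on_sum holo_poly_on_smult holo_poly_on_coeff *(2))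
    moreover have "poly (?Q y) c = poly (P w y) (c + of_nat j)" if "y \<in> V" for c y
      using d[OF that] by (simp add: poly_sum poly_power add.commute)
    ultimately show ?thesis by blast
  qed
  hence "\<forall>w. \<exists>Q. holo_poly_on Q V \<and> (\<forall>c. \<forall>y\<in>V. poly (Q y) c = poly (P w y) (c + of_nat j))" ..
  from choice[OF this] obtain Q where Q: "\<forall>w. holo_poly_on (Q w) V \<and> (\<forall>c. \<forall>y\<in>V. poly (Q w y) c = poly (P w y) (c + of_nat j))" ..
  have fm: "fs_section f V (\<lambda>_ z. f z ^ m)" by (intro fs_section_holo holo_on_power V)
  show ?thesis
  proof (rule D_spanI[where W = W and P = Q])
    fix c y assume y: "y \<in> V" "f y \<noteq> 0"
    show "f y ^ j * h (c + of_nat j) y = (\<Sum>w\<in>W. poly (Q w y) c * foldr (conn f c) w (\<lambda>z. f z ^ (j + m)) y)"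
      using word_power_mult[OF V fm y, of c _ j] Q y(1) unfolding *(3)[OF y] power_add sum_distrib_left
      by (intro sum.cong refl) simp
  qed (use *(1) Q in auto)
qed

text \<open>
  The analogue of \<^const>\<open>fs_section\<close> for polynomial-valued functions. The uniform bound on the degree is
  what makes the coefficientwise derivative \<^const>\<open>pd_s\<close> a polynomial.
\<close>

definition poly_section :: "(complex^'n \<Rightarrow> complex) \<Rightarrow> (complex^'n) set \<Rightarrow> (complex^'n \<Rightarrow> complex poly) \<Rightarrow> bool" where
  "poly_section f V H \<longleftrightarrow> (\<exists>N d g. (\<forall>k. holo_on (g k) V) \<and>
     (\<forall>y\<in>V. f y \<noteq> 0 \<longrightarrow> degree (H y) \<le> d \<and> (\<forall>k. coeff (H y) k = g k y / f y ^ N)))"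

text \<open>
  Evaluation at \<open>s = c\<close> carries \<^const>\<open>conn_s\<close> to \<^const>\<open>conn\<close>.
\<close>

lemma conn_s_section:
  assumes V: "open V" "holo_on f V" and H: "poly_section f V H"
  shows "poly_section f V (conn_s f i H)"
    and "\<And>y c. y \<in> V \<Longrightarrow> f y \<noteq> 0 \<Longrightarrow> poly (conn_s f i H y) c = conn f c i (\<lambda>z. poly (H z) c) y"
proof -
  obtain N d g where g: "\<And>k. holo_on (g k) V" 
    and H: "\<And>y. y \<in> V \<Longrightarrow> f y \<noteq> 0 \<Longrightarrow> degree (H y) \<le> d" "\<And>y k. y \<in> V \<Longrightarrow> f y \<noteq> 0 \<Longrightarrow> coeff (H y) k = g k y / f y ^ N"
    using H unfolding poly_section_def by blast
  define p where "p k y = pd i (\<lambda>z. coeff (H z) k) y" for k y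
  have p0: "p k y = 0" if "k > d" "y \<in> V" "f y \<noteq> 0" for k y
  proof -
    have "p k y = pd i (\<lambda>_. 0) y" unfolding p_def
      by (rule pd_cong[OF open_nonzero_set[OF V]]) (use that H(1) in \<open>auto intro!: coeff_eq_0 dest: le_less_trans\<close>)
    also have "\<dots> = 0" by (rule pd_eqI) simp
    finally show ?thesis .
  qed
  have cs: "coeff (pd_s i H y) k = p k y" if "y \<in> V" "f y \<noteq> 0" for y k
    unfolding pd_s_def p_def[symmetric] by (rule fun_cong[OF coeff_Abs_poly[of d]]) (use p0 that in auto)
  have ds: "degree (pd_s i H y) \<le> d" if "y \<in> V" "f y \<noteq> 0" for y
    using p0 that by (intro degree_le) (simp add: cs)
  have fsg: "fs_section f V (\<lambda>_ y. g k y / f y ^ N)" for k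
    by (rule fs_sectionI[where N = N and d = 0 and g = "\<lambda>_. g k"]) (auto simp: g)
  have p: "p k y = pd i (g k) y / f y ^ N - of_nat N * (g k y * pd i f y / f y ^ Suc N)" if y: "y \<in> V" "f y \<noteq> 0" for k y
  proof -
    have "p k y = pd i (\<lambda>z. g k z / f z ^ N) y" unfolding p_def
      by (rule pd_cong[OF open_nonzero_set[OF V]]) (use y H(2) in auto)
    also have "\<dots> = conn f 0 i (\<lambda>z. (\<Sum>k'\<le>0. 1 ^ k' * g k z) / f z ^ N) y" by (simp add: conn_def)
    also have "\<dots> = (\<Sum>k'\<le>0. 1 ^ k' * (pd i (g k) y / f y ^ N + (0 - of_nat N) * (g k y * pd i f y / f y ^ Suc N)))"
      by (rule conn_quotient[OF V g y])
    finally show ?thesis by simp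
  qed
  \<comment> \<open>The last summand is the multiplication by \<open>s\<close> in \<open>conn_s\<close>, which shifts the coefficients.\<close>
  let ?g = "\<lambda>k y. (pd i (g k) y * f y + - of_nat N * (g k y * pd i f y)) + (if k = 0 then 0 else g (k - 1) y) * pd i f y"
  show "poly_section f V (conn_s f i H)"
    unfolding poly_section_def
  proof (intro exI conjI allI ballI impI)
    fix k
    have "holo_on (\<lambda>y. if k = 0 then 0 else g (k - 1) y) V" using g by (cases k) (auto intro: holo_on_const)
    thus "holo_on (?g k) V" by (intro holo_on_add holo_on_mult holo_on_const holo_on_pd g V)
  next
    fix y assume y: "y \<in> V" "f y \<noteq> 0"
    have "degree ([:0, 1:] * H y * [:pd i f y / f y:]) \<le> Suc d"
      using H(1)[OF y] by (intro order_trans[OF degree_mult_le] order_trans[OF add_mono[OF degree_mult_le le_refl]]) simp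
    thus "degree (conn_s f i H y) \<le> Suc d"
      unfolding conn_s_def using ds[OF y] by (intro degree_add_le) auto
    fix k
    have "coeff (conn_s f i H y) k = p k y + (if k = 0 then 0 else coeff (H y) (k - 1)) * (pd i f y / f y)"
      unfolding conn_s_def by (simp add: cs[OF y] coeff_pCons split: nat.split) 
    thus "coeff (conn_s f i H y) k = ?g k y / f y ^ Suc N"
      using y(2) by (cases k) (simp_all add: p[OF y] H(2)[OF y] field_simps)
  qed
  fix y c assume y: "y \<in> V" "f y \<noteq> 0"
  have P: "poly (H z) c = (\<Sum>k\<le>d. c ^ k * (g k z / f z ^ N))" if z: "z \<in> V" "f z \<noteq> 0" for z
    unfolding poly_altdef H(2)[OF z, symmetric] using H(1)[OF z]
    by (intro sum.mono_neutral_cong_left) (auto simp: coeff_eq_0)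
  have "poly (pd_s i H y) c = (\<Sum>k\<le>d. c ^ k * p k y)"
    unfolding poly_altdef cs[OF y, symmetric] using ds[OF y]
    by (intro sum.mono_neutral_cong_left) (auto simp: coeff_eq_0)
  also have "\<dots> = pd i (\<lambda>z. \<Sum>k\<le>d. c ^ k * (g k z / f z ^ N)) y"
  proof (rule pd_eqI[symmetric], intro DERIV_sum DERIV_cmult)
    fix k
    have "p k y = pd i (\<lambda>z. g k z / f z ^ N) y" unfolding p_def
      by (rule pd_cong[OF open_nonzero_set[OF V]]) (use y H(2) in auto)
    thus "((\<lambda>t. g k (y + t *s axis i 1) / f (y + t *s axis i 1) ^ N) has_field_derivative p k y) (at 0)"
      using fs_section_line_derivative[OF V fsg y] by simp
  qed
  also have "\<dots> = pd i (\<lambda>z. poly (H z) c) y"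
    by (rule pd_cong[OF open_nonzero_set[OF V]]) (use y P in auto)
  finally show "poly (conn_s f i H y) c = conn f c i (\<lambda>z. poly (H z) c) y"
    by (simp add: conn_s_def conn_def mult_ac)
qed

lemma poly_word_conn_s:
  assumes V: "open V" "holo_on f V" and H: "poly_section f V H"
  shows "poly_section f V (foldr (conn_s f) w H)"
    and "y \<in> V \<Longrightarrow> f y \<noteq> 0 \<Longrightarrow> poly (foldr (conn_s f) w H y) c = foldr (conn f c) w (\<lambda>z. poly (H z) c) y"
proof -
  show sec: "poly_section f V (foldr (conn_s f) w H)" for w
    by (induction w) (auto intro: H conn_s_section(1)[OF V])
  assume "y \<in> V" "f y \<noteq> 0"
  thus "poly (foldr (conn_s f) w H y) c = foldr (conn f c) w (\<lambda>z. poly (H z) c) y"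
  proof (induction w arbitrary: y)
    case (Cons i w)
    have "poly (foldr (conn_s f) (i # w) H y) c = conn f c i (\<lambda>z. poly (foldr (conn_s f) w H z) c) y"
      using conn_s_section(2)[OF V sec Cons.prems] by simp
    also have "\<dots> = conn f c i (foldr (conn f c) w (\<lambda>z. poly (H z) c)) y"
      by (rule conn_cong[OF open_nonzero_set[OF V]]) (use Cons in auto)
    finally show ?case by simp
  qed simp
qed

lemma functional_eq_iff_D_span:
  assumes X: "open X" "holo_on f X"
  shows "functional_eq X f j b \<longleftrightarrow>
    (\<forall>x\<in>X. \<exists>V. open V \<and> x \<in> V \<and> V \<subseteq> X \<and> D_span f V (\<lambda>_ z. f z ^ j) (\<lambda>c _. poly b c))"
proof -
  have eq: "(\<exists>P\<in>diff_ops_s V. \<forall>y\<in>V. f y \<noteq> 0 \<longrightarrow> diff_act_s f P (\<lambda>z. [:f z ^ j:]) y = b)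
      \<longleftrightarrow> D_span f V (\<lambda>_ z. f z ^ j) (\<lambda>c _. poly b c)" if V: "open V" "V \<subseteq> X" for V
  proof -
    have f: "holo_on f V" using X(2) V(2) by (rule holo_on_subset)
    have hk: "holo_on (\<lambda>z. if k = 0 then f z ^ j else 0) V" for k :: nat
      by (cases "k = 0") (simp_all add: holo_on_const holo_on_power f)
    have "poly_section f V (\<lambda>z. [:f z ^ j:])"
      unfolding poly_section_def
      by (rule exI[of _ 0], rule exI[of _ 0], rule exI[of _ "\<lambda>k z. if k = 0 then f z ^ j else 0"])
         (use hk in \<open>auto simp: coeff_pCons split: nat.splits\<close>)
    note ev = poly_word_conn_s(2)[OF V(1) f this]
    have "diff_act_s f P (\<lambda>z. [:f z ^ j:]) y = b \<longleftrightarrow> 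
        (\<forall>c. poly b c = (\<Sum>w | P w \<noteq> (\<lambda>_. 0). poly (P w y) c * foldr (conn f c) w (\<lambda>z. f z ^ j) y))"
      if y: "y \<in> V" "f y \<noteq> 0" for P y
      unfolding diff_act_s_def poly_eq_poly_eq_iff[symmetric] fun_eq_iff poly_sum poly_mult ev[OF y] by auto
    hence "(\<forall>y\<in>V. f y \<noteq> 0 \<longrightarrow> diff_act_s f P (\<lambda>z. [:f z ^ j:]) y = b) \<longleftrightarrow>
        (\<forall>c. \<forall>y\<in>V. f y \<noteq> 0 \<longrightarrow> poly b c = (\<Sum>w | P w \<noteq> (\<lambda>_. 0). poly (P w y) c * foldr (conn f c) w (\<lambda>z. f z ^ j) y))" for P
      by blast
    thus ?thesis unfolding D_span_def by (simp only:)
  qed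
  show ?thesis unfolding functional_eq_def
    by (intro ball_cong refl iff_exI conj_cong eq)
qed

section \<open>Multiplicities of the roots of b-functions\<close>

lemma functional_eq_0: "open X \<Longrightarrow> holo_on f X \<Longrightarrow> functional_eq X f 0 1"
proof -
  assume X: "open X" "holo_on f X"
  have "D_span f X (\<lambda>_ z. f z ^ 0) (\<lambda>c _. poly 1 c)"
    using D_span_term[OF holo_poly_on_const[of 1 X], of f "\<lambda>_ z. f z ^ 0" "[]"] by simp
  thus ?thesis using X by (subst functional_eq_iff_D_span) auto
qed

lemma functional_eq_add:
  assumes X: "open X" "holo_on f X" and "functional_eq X f j b" "functional_eq X f j c"
  shows "functional_eq X f j (b + c)"
  unfolding functional_eq_iff_D_span[OF X]
proof
  fix x assume x: "x \<in> X"
  from assms(3)[unfolded functional_eq_iff_D_span[OF X], rule_format, OF x]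
  obtain V where V: "open V" "x \<in> V" "V \<subseteq> X" "D_span f V (\<lambda>_ z. f z ^ j) (\<lambda>c _. poly b c)"
    by (elim exE conjE)
  from assms(4)[unfolded functional_eq_iff_D_span[OF X], rule_format, OF x]
  obtain W where W: "open W" "x \<in> W" "W \<subseteq> X" "D_span f W (\<lambda>_ z. f z ^ j) (\<lambda>z _. poly c z)"
    by (elim exE conjE)
  have "D_span f (V \<inter> W) (\<lambda>_ z. f z ^ j) (\<lambda>z y. poly b z + poly c z)"
    by (rule D_span_add[OF D_span_mono[OF V(4)] D_span_mono[OF W(4)]]) auto
  hence "D_span f (V \<inter> W) (\<lambda>_ z. f z ^ j) (\<lambda>z _. poly (b + c) z)" by (simp only: poly_add)
  thus "\<exists>V. open V \<and> x \<in> V \<and> V \<subseteq> X \<and> D_span f V (\<lambda>_ z. f z ^ j) (\<lambda>z _. poly (b + c) z)"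
    using V W by (intro exI[of _ "V \<inter> W"]) auto
qed

lemma functional_eq_mult:
  assumes X: "open X" "holo_on f X" and "functional_eq X f j b"
  shows "functional_eq X f j (p * b)"
  unfolding functional_eq_iff_D_span[OF X]
proof
  fix x assume x: "x \<in> X"
  obtain V where V: "open V" "x \<in> V" "V \<subseteq> X" "D_span f V (\<lambda>_ z. f z ^ j) (\<lambda>c _. poly b c)"
    using assms(3) x unfolding functional_eq_iff_D_span[OF X] by blast
  have "D_span f V (\<lambda>_ z. f z ^ j) (\<lambda>c _. poly (p * b) c)"
    using D_span_mult[OF holo_poly_on_const[of p V] V(4)] by (simp only: poly_mult)
  thus "\<exists>V. open V \<and> x \<in> V \<and> V \<subseteq> X \<and> D_span f V (\<lambda>_ z. f z ^ j) (\<lambda>z _. poly (p * b) z)"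
    using V by blast
qed

lemma functional_eq_mono:
  assumes X: "open X" "holo_on f X" and "functional_eq X f (Suc j) b"
  shows "functional_eq X f j b"
  unfolding functional_eq_iff_D_span[OF X]
proof
  fix x assume x: "x \<in> X"
  obtain V where V: "open V" "x \<in> V" "V \<subseteq> X" "D_span f V (\<lambda>_ z. f z ^ Suc j) (\<lambda>c _. poly b c)"
    using assms(3) x unfolding functional_eq_iff_D_span[OF X] by blast
  have f: "holo_on f V" using X(2) V(3) by (rule holo_on_subset)
  have "D_span f V (\<lambda>_ z. f z ^ j) (\<lambda>c y. poly (smult (f y) 1) c * foldr (conn f c) [] (\<lambda>z. f z ^ j) y)"
    by (rule D_span_term[OF holo_poly_on_smult[OF f]])
  hence "D_span f V (\<lambda>_ z. f z ^ j) (\<lambda>c y. f y ^ Suc j)" by simp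
  from D_span_trans[OF V(1) f _ this V(4)]
  have "D_span f V (\<lambda>_ z. f z ^ j) (\<lambda>c _. poly b c)"
    using fs_section_holo[OF holo_on_power[OF f]] by blast
  thus "\<exists>V. open V \<and> x \<in> V \<and> V \<subseteq> X \<and> D_span f V (\<lambda>_ z. f z ^ j) (\<lambda>z _. poly b z)"
    using V by blast
qed

lemma D_span_scale:
  assumes V: "open V" "holo_on f V" and u: "fs_section f V u" and h: "D_span f V u h"
  shows "D_span f V (\<lambda>c y. a c * u c y) (\<lambda>c y. a c * h c y)"
proof -
  obtain W P where *: "finite W" "\<And>w. holo_poly_on (P w) V"
    "\<And>c y. y \<in> V \<Longrightarrow> f y \<noteq> 0 \<Longrightarrow> h c y = (\<Sum>w\<in>W. poly (P w y) c * foldr (conn f c) w (u c) y)"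
    by (rule D_spanE[OF h]) (rule that)
  show ?thesis
  proof (rule D_spanI[where W = W and P = P])
    fix c y assume y: "y \<in> V" "f y \<noteq> 0"
    show "a c * h c y = (\<Sum>w\<in>W. poly (P w y) c * foldr (conn f c) w (\<lambda>y. a c * u c y) y)"
      unfolding *(3)[OF y] word_cmult[OF V u y] sum_distrib_left by (intro sum.cong) auto
  qed (use * in auto)
qed

text \<open>
  \<open>b(s + j) f\<^sup>s\<^sup>+\<^sup>j\<close> lies in \<open>D[s] f\<^sup>s\<^sup>+\<^sup>j\<^sup>+\<^sup>1\<close> by the shifted equation for \<open>b\<close>; the operator
  that takes \<open>f\<^sup>s\<^sup>+\<^sup>j\<close> to \<open>c(s) f\<^sup>s\<close> commutes with \<open>b(s + j)\<close>, so it maps this section to \<open>b(s + j) c(s) f\<^sup>s\<close>.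
\<close>

lemma functional_eq_step:
  assumes X: "open X" "holo_on f X" and "functional_eq X f j c" "functional_eq X f 1 b"
  shows "functional_eq X f (Suc j) (pcompose b [:of_nat j, 1:] * c)"
  unfolding functional_eq_iff_D_span[OF X]
proof
  fix x assume x: "x \<in> X"
  from assms(3)[unfolded functional_eq_iff_D_span[OF X], rule_format, OF x]
  obtain V1 where V1: "open V1" "x \<in> V1" "V1 \<subseteq> X" "D_span f V1 (\<lambda>_ z. f z ^ j) (\<lambda>s _. poly c s)"
    by (elim exE conjE)
  from assms(4)[unfolded functional_eq_iff_D_span[OF X], rule_format, OF x]
  obtain V2 where V2: "open V2" "x \<in> V2" "V2 \<subseteq> X" "D_span f V2 (\<lambda>_ z. f z ^ 1) (\<lambda>s _. poly b s)"
    by (elim exE conjE)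
  define V where "V = V1 \<inter> V2"
  have V: "open V" "x \<in> V" "V \<subseteq> X" using V1 V2 by (auto simp: V_def)
  have f: "holo_on f V" using X(2) V(3) by (rule holo_on_subset)
  have fj: "fs_section f V (\<lambda>_ z. f z ^ j)" for j by (rule fs_section_holo[OF holo_on_power[OF f]])
  have 1: "D_span f V (\<lambda>_ z. f z ^ (j + 1)) (\<lambda>s y. f y ^ j * poly b (s + of_nat j))"
    by (rule D_span_shift[OF V(1) f D_span_mono[OF V2(4)]]) (simp add: V_def)
  have 2: "D_span f V (\<lambda>s y. poly b (s + of_nat j) * f y ^ j) (\<lambda>s _. poly b (s + of_nat j) * poly c s)"
    by (rule D_span_scale[OF V(1) f fj D_span_mono[OF V1(4)]]) (simp add: V_def)
  have "D_span f V (\<lambda>_ z. f z ^ (j + 1)) (\<lambda>s _. poly b (s + of_nat j) * poly c s)"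
    using D_span_trans[OF V(1) f fj 1] 2 by (simp only: mult.commute)
  hence "D_span f V (\<lambda>_ z. f z ^ Suc j) (\<lambda>s _. poly (pcompose b [:of_nat j, 1:] * c) s)"
    by (simp add: poly_pcompose add.commute)
  thus "\<exists>V. open V \<and> x \<in> V \<and> V \<subseteq> X \<and> D_span f V (\<lambda>_ z. f z ^ Suc j) (\<lambda>s _. poly (pcompose b [:of_nat j, 1:] * c) s)"
    using V by blast
qed

lemma functional_eq_prod:
  assumes X: "open X" "holo_on f X" and "functional_eq X f 1 b"
  shows "functional_eq X f j (\<Prod>i<j. pcompose b [:of_nat i, 1:])"
proof (induction j)
  case 0
  show ?case using functional_eq_0[OF X] by simp
next
  case (Suc j)
  show ?case using functional_eq_step[OF X Suc assms(3)] by (simp add: mult.commute)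
qed

text \<open>
  The polynomials that satisfy the functional equation form an ideal of \<open>\<complex>[s]\<close>, and an element of
  minimal degree generates it.
\<close>

lemma b_poly_dvd:
  assumes X: "open X" "holo_on f X" and b: "is_b_poly X f j b" and c: "functional_eq X f j c"
  shows "b dvd c"
proof (rule ccontr)
  assume "\<not> b dvd c"
  hence r0: "c mod b \<noteq> 0" by (simp add: mod_eq_0_iff_dvd)
  have b': "functional_eq X f j b" "lead_coeff b = 1" using b by (auto simp: is_b_poly_def)
  hence b0: "b \<noteq> 0" by auto
  have "c mod b = c + (- (c div b)) * b"
    using div_mult_mod_eq[of c b] by (simp add: algebra_simps)
  hence "functional_eq X f j (c mod b)"
    using functional_eq_add[OF X c functional_eq_mult[OF X b'(1), of "- (c div b)"]] by (simp only:)
  from functional_eq_mult[OF X this, of "[:inverse (lead_coeff (c mod b)):]"]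
  have "functional_eq X f j (smult (inverse (lead_coeff (c mod b))) (c mod b))" by simp
  moreover have "lead_coeff (smult (inverse (lead_coeff (c mod b))) (c mod b)) = 1"
    using r0 by simp
  ultimately have "degree b \<le> degree (smult (inverse (lead_coeff (c mod b))) (c mod b))"
    using b unfolding is_b_poly_def by blast
  also have "\<dots> = degree (c mod b)" using r0 by simp
  also have "\<dots> < degree b" using degree_mod_less[OF b0, of c] r0 by auto
  finally show False by simp
qed

lemma order_pcompose_shift:
  assumes "p \<noteq> (0 :: complex poly)"
  shows "order z (pcompose p [:a, 1:]) = order (z + a) p"
proof -
  have le: "order z (pcompose q [:a, 1:]) \<le> order (z + a) q" if q: "q \<noteq> 0" for q :: "complex poly" and z a
  proof -
    let ?n = "order z (pcompose q [:a, 1:])"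
    obtain r where r: "pcompose q [:a, 1:] = [:- z, 1:] ^ ?n * r" using order_1 dvdE by blast
    have "pcompose (pcompose q [:a, 1:]) [:- a, 1:] = q"
      by (rule poly_ext) (simp add: poly_pcompose)
    moreover have "pcompose ([:- z, 1:] ^ ?n * r) [:- a, 1:] = [:- (z + a), 1:] ^ ?n * pcompose r [:- a, 1:]"
      by (rule poly_ext) (simp add: poly_pcompose poly_power algebra_simps)
    ultimately have "[:- (z + a), 1:] ^ ?n dvd q" using r by (metis dvd_triv_left)
    thus ?thesis using q order_divides by blast
  qed
  have "pcompose p [:a, 1:] \<noteq> 0" using assms by (simp add: pcompose_eq_0_iff)
  from le[OF this, of "z + a" "- a"] have "order (z + a) (pcompose (pcompose p [:a, 1:]) [:- a, 1:]) \<le> order z (pcompose p [:a, 1:])"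
    by simp
  moreover have "pcompose (pcompose p [:a, 1:]) [:- a, 1:] = p"
    by (rule poly_ext) (simp add: poly_pcompose)
  ultimately show ?thesis using le[OF assms, of z a] by simp
qed

text \<open>
  The points \<open>z + i\<close> are distinct, so the left-hand side counts roots of \<open>p\<close>, with multiplicity, at most once.
\<close>

lemma sum_order_translates_le:
  assumes "p \<noteq> (0 :: complex poly)"
  shows "(\<Sum>i<j. order (z + of_nat i) p) \<le> degree p"
proof -
  let ?A = "(\<lambda>i. z + of_nat i) ` {..<j}"
  have "(\<Sum>i<j. order (z + of_nat i) p) = (\<Sum>a\<in>?A. order a p)"
    by (subst sum.reindex) (auto simp: inj_on_def)
  also have "\<dots> = (\<Sum>a\<in>?A. count (proots p) a)" using assms by simp
  also have "\<dots> = (\<Sum>a\<in>?A \<inter> set_mset (proots p). count (proots p) a)"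
    by (rule sum.mono_neutral_right) (auto simp: not_in_iff)
  also have "\<dots> \<le> (\<Sum>a\<in>set_mset (proots p). count (proots p) a)"
    by (rule sum_mono2) auto
  also have "\<dots> = size (proots p)" by (simp add: size_multiset_overloaded_eq)
  also have "\<dots> \<le> degree p" by (rule size_proots_le)
  finally show ?thesis .
qed

text \<open>
  The multiplicities increase with \<open>j\<close>, as \<open>b\<^sup>(\<^sup>j\<^sup>)\<close> divides \<open>b\<^sup>(\<^sup>j\<^sup>+\<^sup>1\<^sup>)\<close>, and are bounded by \<open>deg b\<^sup>(\<^sup>1\<^sup>)\<close>, so
  they are eventually constant. Without this, \<^const>\<open>nu1\<close> would be the limit of a sequence not known to converge.
\<close>

lemma order_b_poly_le_nu1:
  assumes X: "open X" "holo_on f X" and b: "\<And>j. j \<ge> 1 \<Longrightarrow> is_b_poly X f j (b j)" and "j \<ge> 1"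
  shows "order (- of_rat \<beta>) (b j) \<le> nu1 b \<beta>"
proof -
  let ?z = "- of_rat \<beta> :: complex"
  define g where "g j = order ?z (b (Suc j))" for j
  have fe: "functional_eq X f j (b j)" and nz: "b j \<noteq> 0" if "j \<ge> 1" for j
    using b[OF that] by (auto simp: is_b_poly_def)
  have "g j \<le> g (Suc j)" for j
    unfolding g_def using nz[of "Suc (Suc j)"] functional_eq_mono[OF X fe[of "Suc (Suc j)"]]
    by (intro dvd_imp_order_le b_poly_dvd[OF X b]) auto
  hence inc: "incseq g" by (rule incseq_SucI)
  have bd: "g j \<le> degree (b 1)" for j
  proof -
    let ?p = "\<lambda>j. \<Prod>i<j. pcompose (b 1) [:of_nat i, 1:]"
    have ne: "pcompose (b 1) [:of_nat i, 1:] \<noteq> 0" for i using nz[of 1] by (simp add: pcompose_eq_0_iff)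
    have "order ?z (?p j) = (\<Sum>i<j. order (?z + of_nat i) (b 1))" for j
    proof (induction j)
      case (Suc j)
      thus ?case using ne nz[of 1] by (simp add: order_mult order_pcompose_shift)
    qed simp
    moreover have "g j \<le> order ?z (?p (Suc j))"
      unfolding g_def using ne functional_eq_prod[OF X fe[of 1], of "Suc j"]
      by (intro dvd_imp_order_le b_poly_dvd[OF X b]) auto
    ultimately have "g j \<le> (\<Sum>i<Suc j. order (?z + of_nat i) (b 1))" by (simp only:)
    also have "\<dots> \<le> degree (b 1)" by (rule sum_order_translates_le[OF nz]) simp
    finally show ?thesis .
  qed
  \<comment> \<open>A bounded increasing sequence of natural numbers is eventually constant.\<close>
  have fin: "finite (range g)" by (rule finite_subset[of _ "{..degree (b 1)}"]) (use bd in auto)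
  define m where "m = Max (range g)"
  have le: "g j \<le> m" for j unfolding m_def using fin by simp
  obtain N where "g N = m" using Max_in[OF fin] by (auto simp: m_def)
  hence "g j = m" if "j \<ge> N" for j using le[of j] incseqD[OF inc that] by simp
  hence "g \<longlonglongrightarrow> m" by (intro tendsto_eventually eventually_sequentiallyI)
  hence "(\<lambda>j. order ?z (b j)) \<longlonglongrightarrow> m" unfolding g_def by (rule LIMSEQ_imp_Suc)
  hence "nu1 b \<beta> = m" unfolding nu1_def by (rule limI)
  moreover have "order ?z (b j) = g (j - 1)" using assms(4) by (simp add: g_def)
  ultimately show ?thesis using le by simp
qed

section \<open>The functional equation of zeta integrals and their continuation\<close>

text \<open>
  Locally, pair \<open>P(s + k) f\<^sup>s\<^sup>+\<^sup>k\<^sup>+\<^sup>j = b(s + k) f\<^sup>s\<^sup>+\<^sup>k\<close> with \<open>(cnj f)\<^sup>s\<^sup>+\<^sup>l \<phi>\<close> and move \<open>P\<close> to \<open>\<phi>\<close>. The polynomial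
  \<open>b\<close> is the same on all patches, so the pieces add up.
\<close>

lemma zeta_functional_equation:
  fixes f :: "complex^'n \<Rightarrow> complex"
  assumes X: "open X" "holo_on f X" and b: "functional_eq X f j b" and \<phi>: "test_function X \<phi>"
  obtains G R where "G holomorphic_on {s. 2 * Re s + of_int (k + int j) + of_int l > 0}"
    "\<And>s. Re s > R \<Longrightarrow> poly b (s + of_int k) * zeta_integral f k l \<phi> s = G s"
proof -
  let ?S = "{s. 2 * Re s + of_int (k + int j) + of_int l > 0}"
  \<comment> \<open>Additivity of the integrals needs test functions, hence the first conjunct.\<close>
  define Q where "Q \<phi> \<longleftrightarrow> test_function X \<phi> \<and> (\<exists>G R. G holomorphic_on ?S \<and>
     (\<forall>s. Re s > R \<longrightarrow> poly b (s + of_int k) * zeta_integral f k l \<phi> s = G s))" for \<phi>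
  have "Q \<phi>"
  proof (rule test_function_localization[where X = X])
    show "test_function X \<phi>" by fact
    have "\<exists>G R. G holomorphic_on ?S \<and> (\<forall>s. Re s > R \<longrightarrow> poly b (s + of_int k) * zeta_integral f k l (\<lambda>_. 0) s = G s)"
      by (rule exI[of _ "\<lambda>_. 0"]) (auto simp: zeta_integral_0)
    thus "Q (\<lambda>_. 0)" by (simp add: Q_def test_function_0)
    show "Q (\<lambda>x. \<phi> x + \<psi> x)" if "Q \<phi>" "Q \<psi>" for \<phi> \<psi>
    proof -
      obtain G1 R1 where 1: "test_function X \<phi>" "G1 holomorphic_on ?S" "\<And>s. Re s > R1 \<Longrightarrow> poly b (s + of_int k) * zeta_integral f k l \<phi> s = G1 s"
        using \<open>Q \<phi>\<close> unfolding Q_def by blast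
      obtain G2 R2 where 2: "test_function X \<psi>" "G2 holomorphic_on ?S" "\<And>s. Re s > R2 \<Longrightarrow> poly b (s + of_int k) * zeta_integral f k l \<psi> s = G2 s"
        using \<open>Q \<psi>\<close> unfolding Q_def by blast
      define R where "R = max (max R1 R2) (- (of_int k + of_int l) / 2)"
      have "poly b (s + of_int k) * zeta_integral f k l (\<lambda>x. \<phi> x + \<psi> x) s = G1 s + G2 s" if "Re s > R" for s
      proof -
        have s: "Re s > R1" "Re s > R2" "2 * Re s + of_int k + of_int l > 0" using that by (auto simp: R_def)
        show ?thesis
          using zeta_integral_add[OF X(1) holo_on_imp_continuous_on[OF X(2)] 1(1) 2(1) s(3)] 1(3)[OF s(1)] 2(3)[OF s(2)]
          by (simp add: distrib_left)
      qed
      moreover have "(\<lambda>s. G1 s + G2 s) holomorphic_on ?S" using 1(2) 2(2) by (rule holomorphic_on_add)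
      ultimately show ?thesis unfolding Q_def using test_function_add[OF 1(1) 2(1)] by blast
    qed
    fix x assume "x \<in> X"
    then obtain V where V: "open V" "x \<in> V" "V \<subseteq> X" "D_span f V (\<lambda>_ z. f z ^ j) (\<lambda>c _. poly b c)"
      using b unfolding functional_eq_iff_D_span[OF X] by blast
    have f: "holo_on f V" using X(2) V(3) by (rule holo_on_subset)
    obtain W P where P: "finite W" "\<And>w. holo_poly_on (P w) V"
      "\<And>c y. y \<in> V \<Longrightarrow> f y \<noteq> 0 \<Longrightarrow> poly b c = (\<Sum>w\<in>W. poly (P w y) c * foldr (conn f c) w (\<lambda>z. f z ^ j) y)"
      by (rule D_spanE[OF V(4)]) (rule that)
    have "Q \<phi>" if \<phi>: "test_function V \<phi>" for \<phi>
    proof -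
      let ?h = "\<lambda>s y. \<Sum>w\<in>W. poly (P w y) s * foldr (conn f s) w (\<lambda>z. f z ^ j) y"
      obtain d \<psi> R where \<psi>: "\<And>m. test_function V (\<psi> m)"
        "\<And>s. Re s > R \<Longrightarrow> zeta_pairing f k l ?h \<phi> s = (\<Sum>m\<le>d. s ^ m * zeta_integral f (k + int j) l (\<psi> m) s)"
        by (rule zeta_spanE[OF zeta_span_operator[where W = W and P = P and k = k and j = j and l = l, OF V(1) f \<phi> P(2)]]) (rule that)
      have "zeta_pairing f k l ?h \<phi> s = zeta_pairing f k l (\<lambda>s _. poly b s) \<phi> s" for s
        by (rule zeta_pairing_cong[OF \<phi> _ \<phi>]) (simp add: P(3))
      also have "zeta_pairing f k l (\<lambda>s _. poly b s) \<phi> s = poly b (s + of_int k) * zeta_integral f k l \<phi> s" for s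
        unfolding zeta_pairing_def zeta_integral_def by (simp add: mult.left_commute[of _ "poly b (s + of_int k)"])
      finally have "poly b (s + of_int k) * zeta_integral f k l \<phi> s = (\<Sum>m\<le>d. s ^ m * zeta_integral f (k + int j) l (\<psi> m) s)" if "Re s > R" for s
        using \<psi>(2)[OF that] by simp
      moreover have "(\<lambda>s. \<Sum>m\<le>d. s ^ m * zeta_integral f (k + int j) l (\<psi> m) s) holomorphic_on ?S"
        by (intro holomorphic_intros holomorphic_zeta_integral[OF V(1) holo_on_imp_continuous_on[OF f] \<psi>(1)])
      ultimately show ?thesis unfolding Q_def using test_function_mono[OF \<phi> V(3)] by blast
    qed
    thus "\<exists>V. open V \<and> x \<in> V \<and> (\<forall>\<phi>. test_function V \<phi> \<longrightarrow> Q \<phi>)" using V by blast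
  qed
  thus ?thesis using that unfolding Q_def by blast
qed

lemma eventually_poly_nonzero: "p \<noteq> (0 :: complex poly) \<Longrightarrow> eventually (\<lambda>s. poly p s \<noteq> 0) (at z)"
  using islimpt_finite[OF poly_roots_finite[of p], of z] by (simp add: islimpt_iff_eventually)

lemma holomorphic_divide_poly_meromorphic:
  assumes "G holomorphic_on S" "open S"
  shows "(\<lambda>s. G s / poly p s) meromorphic_on S"
proof -
  have "G meromorphic_on S"
    using assms by (intro analytic_on_imp_meromorphic_on) (simp add: analytic_on_open)
  moreover have "poly p meromorphic_on S"
    using assms(2) by (intro analytic_on_imp_meromorphic_on) (simp add: analytic_on_open holomorphic_intros)
  ultimately show ?thesis by (rule meromorphic_on_divide)
qed

text \<open>
  \<open>G\<^sub>j / b\<^sub>j\<close> continues the integral to \<open>Re s > - j / 2\<close>. By the identity theorem these quotients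
  agree off the finitely many roots of the denominators; removing removable singularities makes them agree
  everywhere, so they glue.
\<close>

lemma zeta_integral_meromorphic_continuation:
  fixes f :: "complex^'n \<Rightarrow> complex"
  assumes X: "open X" "holo_on f X" and b: "\<And>j. j \<ge> 1 \<Longrightarrow> functional_eq X f j (b j)" "\<And>j. j \<ge> 1 \<Longrightarrow> b j \<noteq> 0"
    and \<phi>: "test_function X \<phi>"
  obtains F where "F meromorphic_on UNIV" "\<And>s. Re s > 0 \<Longrightarrow> F s = zeta_integral f 0 0 \<phi> s"
proof -
  let ?Z = "zeta_integral f 0 0 \<phi>"
  define S where "S j = {s. Re s > - real j / 2}" for j :: nat
  have S: "open (S j)" "connected (S j)" for j
    unfolding S_def by (rule open_halfspace_Re_gt connected_halfspace_Re_gt)+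
  have S0: "{s. Re s > 0} \<subseteq> S j" for j unfolding S_def by (auto intro: le_less_trans[of _ 0])
  have Z: "?Z holomorphic_on {s. Re s > 0}"
    using holomorphic_zeta_integral[OF X(1) holo_on_imp_continuous_on[OF X(2)] \<phi>, of 0 0] by simp
  have "\<exists>G. G holomorphic_on S j \<and> (\<forall>s. Re s > 0 \<longrightarrow> poly (b j) s * ?Z s = G s)" if j1: "j \<ge> 1" for j
  proof -
    obtain G R where G: "G holomorphic_on {s. 2 * Re s + of_int (0 + int j) + of_int 0 > 0}"
      "\<And>s. Re s > R \<Longrightarrow> poly (b j) (s + of_int 0) * zeta_integral f 0 0 \<phi> s = G s"
      by (rule zeta_functional_equation[OF X b(1)[OF j1] \<phi>, where k = 0 and l = 0]) (rule that)
    have "{s. 2 * Re s + of_int (0 + int j) + of_int 0 > 0} = S j" by (auto simp: S_def field_simps)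
    hence GS: "G holomorphic_on S j" using G(1) by simp
    have "poly (b j) s * ?Z s = G s" if s0: "Re s > 0" for s
    proof (rule analytic_continuation_open[where f = "\<lambda>s. poly (b j) s * ?Z s" and g = G and s = "{s. Re s > max R 0}" and s' = "{s. Re s > 0}"])
      have "complex_of_real (max R 0 + 1) \<in> {s. Re s > max R 0}" by (simp add: max_def)
      thus "{s. Re s > max R 0} \<noteq> {}" by blast
      show "(\<lambda>s. poly (b j) s * ?Z s) holomorphic_on {s. Re s > 0}" by (intro holomorphic_intros Z)
      show "G holomorphic_on {s. Re s > 0}" by (rule holomorphic_on_subset[OF GS S0])
      show "open {s. Re s > max R 0}" "open {s. Re s > 0}" by (rule open_halfspace_Re_gt)+
      show "connected {s. Re s > 0}" by (rule connected_halfspace_Re_gt)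
      show "{s. Re s > max R 0} \<subseteq> {s. Re s > 0}" by auto
      show "poly (b j) u * ?Z u = G u" if "u \<in> {s. Re s > max R 0}" for u
        using G(2)[of u] that by simp
      show "s \<in> {s. Re s > 0}" using s0 by simp
    qed
    thus ?thesis using GS by blast
  qed
  hence "\<forall>j. \<exists>G. j \<ge> 1 \<longrightarrow> G holomorphic_on S j \<and> (\<forall>s. Re s > 0 \<longrightarrow> poly (b j) s * ?Z s = G s)" by blast
  from choice[OF this] obtain G where G: "\<And>j. j \<ge> 1 \<Longrightarrow> G j holomorphic_on S j"
    "\<And>j s. j \<ge> 1 \<Longrightarrow> Re s > 0 \<Longrightarrow> poly (b j) s * ?Z s = G j s" by blast
  define H where "H j s = G j s / poly (b j) s" for j s
  have HH: "eventually (\<lambda>w. H j w = H k w) (at s)" if jk: "j \<ge> 1" "k \<ge> 1" "s \<in> S j" "s \<in> S k" for j k s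
  proof -
    have eq: "poly (b k) w * G j w = poly (b j) w * G k w" if w: "w \<in> S (min j k)" for w
    proof (rule analytic_continuation_open[where f = "\<lambda>w. poly (b k) w * G j w" and g = "\<lambda>w. poly (b j) w * G k w"
          and s = "{s. Re s > 0}" and s' = "S (min j k)"])
      have "(1 :: complex) \<in> {s. Re s > 0}" by simp
      thus "{s :: complex. Re s > 0} \<noteq> {}" by blast
      have "S (min j k) \<subseteq> S j" "S (min j k) \<subseteq> S k" by (auto simp: S_def)
      hence Gjk: "G j holomorphic_on S (min j k)" "G k holomorphic_on S (min j k)"
        using holomorphic_on_subset G(1)[OF jk(1)] G(1)[OF jk(2)] by blast+
      show "(\<lambda>w. poly (b k) w * G j w) holomorphic_on S (min j k)" by (intro holomorphic_intros Gjk)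
      show "(\<lambda>w. poly (b j) w * G k w) holomorphic_on S (min j k)" by (intro holomorphic_intros Gjk)
      show "poly (b k) u * G j u = poly (b j) u * G k u" if "u \<in> {s. Re s > 0}" for u
      proof -
        have "G j u = poly (b j) u * ?Z u" "G k u = poly (b k) u * ?Z u"
          using G(2)[OF jk(1), of u] G(2)[OF jk(2), of u] that by simp_all
        thus ?thesis by (simp only: mult_ac)
      qed
      show "open {s. Re s > 0}" by (rule open_halfspace_Re_gt)
    qed (rule S S0 w)+
    have "s \<in> S (min j k)" using jk by (simp add: min_def)
    hence "eventually (\<lambda>w. w \<in> S (min j k)) (at s)"
      using S(1) by (intro eventually_at_in_open') auto
    thus ?thesis using eventually_poly_nonzero[OF b(2)[OF jk(1)], of s] eventually_poly_nonzero[OF b(2)[OF jk(2)], of s]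
    proof eventually_elim
      case (elim w)
      thus ?case using eq[OF elim(1)] by (simp add: H_def field_simps)
    qed
  qed
  define J where "J s = Suc (nat \<lceil>2 * cmod s\<rceil>)" for s
  have J: "J s \<ge> 1" "s \<in> S (J s)" for s
  proof -
    have "real (J s) > 2 * cmod s" unfolding J_def by linarith
    moreover have "- Re s \<le> cmod s" using abs_Re_le_cmod[of s] by linarith
    ultimately show "s \<in> S (J s)" by (simp add: S_def)
  qed (simp add: J_def)
  \<comment> \<open>Any choice of \<open>J\<close> with \<open>s\<close> in the half-plane \<open>S (J s)\<close> would do, by \<open>HH\<close>.\<close>
  define F where "F s = remove_sings (H (J s)) s" for s
  have F: "F s = remove_sings (H j) s" if "j \<ge> 1" "s \<in> S j" for j s
    unfolding F_def by (rule remove_sings_cong[OF HH[OF J(1) that(1) J(2) that(2)] refl])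
  show ?thesis
  proof (rule that[of F])
    have "F meromorphic_on {s}" for s
    proof -
      have "H (J s) meromorphic_on S (J s)"
        unfolding H_def using G(1)[OF J(1)] S(1) by (rule holomorphic_divide_poly_meromorphic)
      hence "H (J s) meromorphic_on {s}" by (rule meromorphic_on_subset) (use J(2) in simp)
      hence "remove_sings (H (J s)) meromorphic_on {s}" by (rule remove_sings_meromorphic)
      moreover have "eventually (\<lambda>w. w \<in> S (J s)) (at s)"
        using S(1) J(2) by (rule eventually_at_in_open')
      hence "eventually (\<lambda>w. F w = remove_sings (H (J s)) w) (at s)"
        by eventually_elim (rule F[OF J(1)])
      hence "F meromorphic_on {s} \<longleftrightarrow> remove_sings (H (J s)) meromorphic_on {s}"
        by (intro meromorphic_on_cong) auto
      ultimately show ?thesis by (simp only:)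
    qed
    thus "F meromorphic_on UNIV" unfolding meromorphic_on_def by blast
  next
    fix s :: complex assume s: "Re s > 0"
    have "eventually (\<lambda>w. w \<in> {s. Re s > 0}) (at s)"
      using s open_halfspace_Re_gt by (intro eventually_at_in_open') auto
    hence "eventually (\<lambda>w. H 1 w = ?Z w) (at s)"
      using eventually_poly_nonzero[OF b(2)[OF order_refl], of s]
    proof eventually_elim
      case (elim w)
      thus ?case using G(2)[of 1 w] by (simp add: H_def field_simps)
    qed
    hence "remove_sings (H 1) s = remove_sings ?Z s" by (rule remove_sings_cong) simp
    also have "\<dots> = ?Z s"
      using Z s open_halfspace_Re_gt[of 0] by (intro remove_sings_at_analytic) (auto simp: analytic_at)
    finally show "F s = ?Z s" using F[of 1 s] S0 s by auto
  qed
qed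

section \<open>Bounds on pole orders\<close>

text \<open>
  Some meromorphic continuation of \<open>I\<close> from large \<open>Re s\<close> to a half-plane around \<open>z\<close> has a pole of order
  at most \<open>m\<close> at \<open>z\<close>. The order is expressed by a bound rather than by \<^const>\<open>zorder\<close>, so that sums need no case
  distinction, and the continuation stays on a half-plane, where it is unique.
\<close>

definition has_pole_le :: "(complex \<Rightarrow> complex) \<Rightarrow> complex \<Rightarrow> nat \<Rightarrow> bool" where
  "has_pole_le I z m \<longleftrightarrow> (\<exists>r R F C. r < Re z \<and> F meromorphic_on {s. Re s > r} \<and> (\<forall>s. Re s > R \<longrightarrow> F s = I s) \<and>
     eventually (\<lambda>s. cmod (F s) * cmod (s - z) ^ m \<le> C) (at z))"

lemma has_pole_leI:
  assumes "r < Re z" "F meromorphic_on {s. Re s > r}" "\<And>s. Re s > R \<Longrightarrow> F s = I s"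
    "eventually (\<lambda>s. cmod (F s) * cmod (s - z) ^ m \<le> C) (at z)"
  shows "has_pole_le I z m"
  unfolding has_pole_le_def using assms by (intro exI conjI allI impI) assumption+

lemma has_pole_leE:
  assumes "has_pole_le I z m"
  obtains r R F C where "r < Re z" "F meromorphic_on {s. Re s > r}" "\<And>s. Re s > R \<Longrightarrow> F s = I s"
    "eventually (\<lambda>s. cmod (F s) * cmod (s - z) ^ m \<le> C) (at z)"
  using assms unfolding has_pole_le_def by auto

lemma has_pole_le_cong:
  assumes "has_pole_le I z m" "\<And>s. Re s > R \<Longrightarrow> I' s = I s" shows "has_pole_le I' z m"
proof -
  obtain r R' F C where *: "r < Re z" "F meromorphic_on {s. Re s > r}" "\<And>s. Re s > R' \<Longrightarrow> F s = I s"
    "eventually (\<lambda>s. cmod (F s) * cmod (s - z) ^ m \<le> C) (at z)"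
    by (rule has_pole_leE[OF assms(1)]) (rule that)
  show ?thesis
    by (rule has_pole_leI[OF *(1,2) _ *(4), where R = "max R R'"]) (use assms(2) *(3) in auto)
qed

lemma has_pole_le_0: "has_pole_le (\<lambda>_. 0) z m"
  by (rule has_pole_leI[where r = "Re z - 1" and R = 0 and F = "\<lambda>_. 0" and C = 0]) auto

lemma has_pole_le_add:
  assumes "has_pole_le I1 z m" "has_pole_le I2 z m" shows "has_pole_le (\<lambda>s. I1 s + I2 s) z m"
proof -
  obtain r1 R1 F1 C1 where 1: "r1 < Re z" "F1 meromorphic_on {s. Re s > r1}" "\<And>s. Re s > R1 \<Longrightarrow> F1 s = I1 s"
    "eventually (\<lambda>s. cmod (F1 s) * cmod (s - z) ^ m \<le> C1) (at z)"
    by (rule has_pole_leE[OF assms(1)]) (rule that)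
  obtain r2 R2 F2 C2 where 2: "r2 < Re z" "F2 meromorphic_on {s. Re s > r2}" "\<And>s. Re s > R2 \<Longrightarrow> F2 s = I2 s"
    "eventually (\<lambda>s. cmod (F2 s) * cmod (s - z) ^ m \<le> C2) (at z)"
    by (rule has_pole_leE[OF assms(2)]) (rule that)
  show ?thesis
  proof (rule has_pole_leI)
    show "max r1 r2 < Re z" using 1(1) 2(1) by simp
    show "(\<lambda>s. F1 s + F2 s) meromorphic_on {s. Re s > max r1 r2}"
      by (intro meromorphic_on_add meromorphic_on_subset[OF 1(2)] meromorphic_on_subset[OF 2(2)]) auto
    show "F1 s + F2 s = I1 s + I2 s" if "Re s > max R1 R2" for s using that 1(3) 2(3) by simp
    show "eventually (\<lambda>s. cmod (F1 s + F2 s) * cmod (s - z) ^ m \<le> C1 + C2) (at z)"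
      using 1(4) 2(4)
    proof eventually_elim
      case (elim s)
      have "cmod (F1 s + F2 s) * cmod (s - z) ^ m \<le> (cmod (F1 s) + cmod (F2 s)) * cmod (s - z) ^ m"
        by (intro mult_right_mono norm_triangle_ineq) auto
      also have "\<dots> \<le> C1 + C2" using elim by (simp add: distrib_right)
      finally show ?case .
    qed
  qed
qed

lemma has_pole_le_sum: "(\<And>i. i \<in> A \<Longrightarrow> has_pole_le (I i) z m) \<Longrightarrow> has_pole_le (\<lambda>s. \<Sum>i\<in>A. I i s) z m"
  by (induction A rule: infinite_finite_induct) (auto intro: has_pole_le_0 has_pole_le_add)

lemma has_pole_le_mult:
  assumes "has_pole_le I z m" "g holomorphic_on UNIV" shows "has_pole_le (\<lambda>s. g s * I s) z m"
proof -
  obtain r R F C where *: "r < Re z" "F meromorphic_on {s. Re s > r}" "\<And>s. Re s > R \<Longrightarrow> F s = I s"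
    "eventually (\<lambda>s. cmod (F s) * cmod (s - z) ^ m \<le> C) (at z)"
    by (rule has_pole_leE[OF assms(1)]) (rule that)
  have g: "g analytic_on UNIV" using assms(2) by (simp add: analytic_on_open)
  have "isCont g z" using holomorphic_on_imp_continuous_on[OF assms(2)] by (simp add: continuous_on_eq_continuous_at)
  from tendsto_norm[OF isContD[OF this]]
  have ev: "eventually (\<lambda>s. cmod (g s) < cmod (g z) + 1) (at z)"
    by (rule order_tendstoD(2)) simp
  show ?thesis
  proof (rule has_pole_leI[OF *(1)])
    show "(\<lambda>s. g s * F s) meromorphic_on {s. Re s > r}"
      by (intro meromorphic_on_mult *(2) analytic_on_imp_meromorphic_on analytic_on_subset[OF g]) auto
    show "eventually (\<lambda>s. cmod (g s * F s) * cmod (s - z) ^ m \<le> (cmod (g z) + 1) * C) (at z)"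
      using *(4) ev
    proof eventually_elim
      case (elim s)
      have "cmod (g s) * (cmod (F s) * cmod (s - z) ^ m) \<le> (cmod (g z) + 1) * C"
        using elim by (intro mult_mono) auto
      thus ?case by (simp add: norm_mult mult.assoc)
    qed
    show "g s * F s = g s * I s" if "Re s > R" for s using *(3)[OF that] by simp
  qed
qed

lemma has_pole_le_lower:
  assumes "has_pole_le I z (Suc m)" shows "has_pole_le (\<lambda>s. (s - z) * I s) z m"
proof -
  obtain r R F C where *: "r < Re z" "F meromorphic_on {s. Re s > r}" "\<And>s. Re s > R \<Longrightarrow> F s = I s"
    "eventually (\<lambda>s. cmod (F s) * cmod (s - z) ^ Suc m \<le> C) (at z)"
    by (rule has_pole_leE[OF assms(1)]) (rule that)
  show ?thesis
  proof (rule has_pole_leI[OF *(1)])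
    show "(\<lambda>s. (s - z) * F s) meromorphic_on {s. Re s > r}"
      by (intro meromorphic_on_mult *(2) analytic_on_imp_meromorphic_on analytic_intros)
    show "(s - z) * F s = (s - z) * I s" if "Re s > R" for s using *(3)[OF that] by simp
    show "eventually (\<lambda>s. cmod ((s - z) * F s) * cmod (s - z) ^ m \<le> C) (at z)"
      using *(4) by eventually_elim (simp add: norm_mult mult_ac)
  qed
qed

text \<open>
  A continuation of the form \<open>G / p\<close> has at \<open>z\<close> at most the pole of \<open>1 / p\<close>.
\<close>

lemma has_pole_le_quotient:
  assumes G: "G holomorphic_on {s. Re s > r}" "r < Re z" and p: "p \<noteq> 0" "order z p \<le> m"
    and eq: "\<And>s. Re s > R \<Longrightarrow> poly p s * I s = G s"
  shows "has_pole_le I z m"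
proof -
  obtain q where q: "p = [:- z, 1:] ^ order z p * q" "\<not> [:- z, 1:] dvd q"
    using order_decomp[OF p(1)] by blast
  have qz: "poly q z \<noteq> 0" using q(2) by (simp add: poly_eq_0_iff_dvd)
  let ?n = "order z p"
  define K where "K s = G s * (s - z) ^ (m - ?n) / poly q s" for s
  have "isCont G z" using G open_halfspace_Re_gt[of r]
    by (metis continuous_on_eq_continuous_at holomorphic_on_imp_continuous_on mem_Collect_eq)
  hence "isCont K z" unfolding K_def using qz by (intro continuous_intros) auto
  from tendsto_norm[OF isContD[OF this]]
  have "eventually (\<lambda>s. cmod (K s) < cmod (K z) + 1) (at z)"
    by (rule order_tendstoD(2)) simp
  moreover have "eventually (\<lambda>s. s \<noteq> z) (at z)" by (simp add: eventually_at_filter)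
  ultimately have bd: "eventually (\<lambda>s. cmod (G s / poly p s) * cmod (s - z) ^ m \<le> cmod (K z) + 1) (at z)"
  proof eventually_elim
    case (elim s)
    have "poly p s = (s - z) ^ ?n * poly q s" by (subst q(1)) (simp add: poly_power)
    moreover have "(s - z) ^ m = (s - z) ^ ?n * (s - z) ^ (m - ?n)"
      using p(2) by (simp flip: power_add)
    ultimately have "G s / poly p s * (s - z) ^ m = K s" using elim(2) by (simp add: K_def)
    hence "cmod (G s / poly p s) * cmod (s - z) ^ m = cmod (K s)" by (metis norm_mult norm_power)
    thus ?case using elim(1) by simp
  qed
  obtain M where M: "\<And>s. poly p s = 0 \<Longrightarrow> cmod s \<le> M"
    using finite_imp_bounded[OF poly_roots_finite[OF p(1)]] unfolding bounded_iff by blast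
  show ?thesis
  proof (rule has_pole_leI[OF G(2) holomorphic_divide_poly_meromorphic[OF G(1) open_halfspace_Re_gt] _ bd])
    fix s assume s: "Re s > max R M"
    hence "poly p s \<noteq> 0" using M[of s] complex_Re_le_cmod[of s] by auto
    thus "G s / poly p s = I s" using eq[of s] s by (simp add: field_simps)
  qed
qed

lemma order_map_poly_cnj_le:
  assumes "p \<noteq> 0" shows "order z (map_poly cnj p) \<le> order (cnj z) p"
proof -
  obtain r where r: "map_poly cnj p = [:- z, 1:] ^ order z (map_poly cnj p) * r" using order_1 dvdE by blast
  have "p = [:- cnj z, 1:] ^ order z (map_poly cnj p) * map_poly cnj r"
  proof (rule poly_ext)
    fix x
    have "poly p x = cnj (poly (map_poly cnj p) (cnj x))" by simp
    also have "\<dots> = cnj (poly ([:- z, 1:] ^ order z (map_poly cnj p) * r) (cnj x))" using r by simp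
    also have "\<dots> = poly ([:- cnj z, 1:] ^ order z (map_poly cnj p) * map_poly cnj r) x"
      by (simp add: poly_power)
    finally show "poly p x = poly ([:- cnj z, 1:] ^ order z (map_poly cnj p) * map_poly cnj r) x" .
  qed
  hence "[:- cnj z, 1:] ^ order z (map_poly cnj p) dvd p" by (metis dvd_triv_left)
  thus ?thesis using assms order_divides by blast
qed

text \<open>
  Two meromorphic continuations to a half-plane agree near \<open>z\<close>, by the identity theorem. So the bound
  carries over to \<open>F\<close>, and it limits the exponent in the factorisation of \<open>F\<close> at \<open>z\<close>.
\<close>

lemma pole_order_le_of_has_pole_le:
  assumes F: "F meromorphic_on UNIV" "\<And>s. Re s > R \<Longrightarrow> F s = I s" and I: "has_pole_le I z m"
  shows "pole_order F z \<le> m"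
proof -
  obtain r R' F' C where *: "r < Re z" "F' meromorphic_on {s. Re s > r}" "\<And>s. Re s > R' \<Longrightarrow> F' s = I s"
    "eventually (\<lambda>s. cmod (F' s) * cmod (s - z) ^ m \<le> C) (at z)"
    by (rule has_pole_leE[OF I]) (rule that)
  let ?S = "{s. Re s > r}"
  have mero: "(\<lambda>s. F s - F' s) meromorphic_on ?S"
    by (intro meromorphic_on_diff meromorphic_on_subset[OF F(1)] *(2)) auto
  have "eventually (\<lambda>s. F s - F' s = 0) (cosparse ?S)"
  proof (rule ccontr)
    assume "\<not> ?thesis"
    hence ne: "eventually (\<lambda>s. F s - F' s \<noteq> 0) (cosparse ?S)"
      using meromorphic_imp_constant_or_avoid[OF mero open_halfspace_Re_gt connected_halfspace_Re_gt, of 0] by blast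
    define w where "w = complex_of_real (max r (max R R') + 1)"
    have w: "Re w > max r (max R R')" by (simp add: w_def)
    have "eventually (\<lambda>s. s \<in> {s. Re s > max r (max R R')}) (at w)"
      by (rule eventually_at_in_open'[OF open_halfspace_Re_gt]) (use w in simp)
    hence "eventually (\<lambda>s. F s - F' s = 0) (at w)"
      by eventually_elim (use F(2) *(3) in auto)
    moreover have "eventually (\<lambda>s. F s - F' s \<noteq> 0) (at w)"
      using ne w by (rule_tac eventually_cosparse_imp_eventually_at[where A = ?S]) auto
    ultimately have "eventually (\<lambda>_. False) (at w)" by eventually_elim simp
    thus False by simp
  qed
  hence "eventually (\<lambda>s. F s - F' s = 0) (at z)"
    using *(1) by (rule_tac eventually_cosparse_imp_eventually_at[where A = ?S]) auto
  with *(4) have bd: "eventually (\<lambda>s. cmod (F s) * cmod (s - z) ^ m \<le> C) (at z)"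
    by eventually_elim simp
  show ?thesis
  proof (cases "is_pole F z")
    case True
    have Fz: "F meromorphic_on {z}" using F(1) by (rule meromorphic_on_subset) simp
    define n where "n = zorder F z"
    have "eventually (\<lambda>s. F s \<noteq> 0) (at z)" by (rule non_zero_neighbour_pole[OF True])
    hence "\<exists>\<^sub>F s in at z. F s \<noteq> 0" by (simp add: eventually_frequently)
    from zorder_exist[OF meromorphic_on_isolated_singularity[OF Fz] meromorphic_on_not_essential[OF Fz] this]
    obtain e where g: "zor_poly F z z \<noteq> 0" "e > 0" "zor_poly F z holomorphic_on cball z e"
      "\<And>w. w \<in> cball z e - {z} \<Longrightarrow> F w = zor_poly F z w * (w - z) powi n"
      unfolding n_def by blast
    let ?g = "zor_poly F z"
    have "nat (- n) \<le> m"
    proof (rule ccontr)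
      assume "\<not> nat (- n) \<le> m"
      hence n: "- n > int m" by linarith
      define k where "k = nat (- n) - m"
      have k: "k > 0" "- n = int m + int k" using n by (auto simp: k_def)
      have "isCont ?g z" using g(2,3)
        by (metis centre_in_ball continuous_on_eq_continuous_at continuous_on_subset ball_subset_cball holomorphic_on_imp_continuous_on open_ball)
      hence "(?g \<longlongrightarrow> ?g z) (at z)" by (simp add: isCont_def)
      hence lim: "((\<lambda>s. cmod (?g s)) \<longlongrightarrow> cmod (?g z)) (at z)" by (rule tendsto_norm)
      have "eventually (\<lambda>s. s \<in> ball z e - {z}) (at z)" using g(2) by (intro eventually_at_in_open) auto
      with bd have le: "eventually (\<lambda>s. cmod (?g s) \<le> C * cmod (s - z) ^ k) (at z)"
      proof eventually_elim
        case (elim s)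
        have sz: "s \<noteq> z" using elim(2) by auto
        have "F s = ?g s * (s - z) powi n" using elim(2) by (intro g(4)) auto
        also have "(s - z) powi n = inverse ((s - z) ^ (m + k))"
          using k(2) by (metis minus_minus of_nat_add power_int_minus power_int_of_nat)
        finally have "F s * (s - z) ^ (m + k) = ?g s" using sz by simp
        hence "cmod (?g s) = cmod (F s) * cmod (s - z) ^ m * cmod (s - z) ^ k"
          by (metis mult.assoc norm_mult norm_power power_add)
        also have "\<dots> \<le> C * cmod (s - z) ^ k" using elim(1) by (intro mult_right_mono) auto
        finally show ?case .
      qed
      have "((\<lambda>s. C * cmod (s - z) ^ k) \<longlongrightarrow> C * cmod (z - z) ^ k) (at z)" by (intro tendsto_intros)
      hence lim0: "((\<lambda>s. C * cmod (s - z) ^ k) \<longlongrightarrow> 0) (at z)" using k(1) by (simp add: power_0_left)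
      have "cmod (?g z) \<le> 0" by (rule tendsto_le[OF _ lim0 lim le]) simp
      thus False using g(1) by simp
    qed
    thus ?thesis using True by (simp add: pole_order_def n_def)
  qed (simp add: pole_order_def)
qed

section \<open>The drop of the pole order\<close>

lemma fs_section_eval:
  assumes "fs_section f V h" shows "fs_section f V (\<lambda>_. h z)"
proof -
  obtain N d g where g: "\<And>k. holo_on (g k) V" "\<And>s y. y \<in> V \<Longrightarrow> f y \<noteq> 0 \<Longrightarrow> h s y = (\<Sum>k\<le>d. s ^ k * g k y) / f y ^ N"
    by (rule fs_sectionE[OF assms]) (rule that)
  show ?thesis
  proof (rule fs_sectionI[where N = N and d = 0 and g = "\<lambda>_ y. \<Sum>k\<le>d. z ^ k * g k y"])
    show "holo_on (\<lambda>y. \<Sum>k\<le>d. z ^ k * g k y) V" by (intro holo_on_sum holo_on_mult holo_on_const g)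
  qed (simp add: g(2))
qed

lemma conn_add:
  assumes V: "open V" "holo_on f V" and h: "fs_section f V h1" "fs_section f V h2" and y: "y \<in> V" "f y \<noteq> 0"
  shows "conn f e i (\<lambda>z. h1 c z + h2 c z) y = conn f e i (h1 c) y + conn f e i (h2 c) y"
proof -
  have "pd i (\<lambda>z. h1 c z + h2 c z) y = pd i (h1 c) y + pd i (h2 c) y"
    by (intro pd_eqI DERIV_add fs_section_line_derivative[OF V h(1) y] fs_section_line_derivative[OF V h(2) y])
  thus ?thesis by (simp add: conn_def algebra_simps add_divide_distrib)
qed

text \<open>
  Both sides agree at \<open>s = z\<close>, so their difference is divisible by \<open>s - z\<close>; the quotient \<open>K\<close> is built
  along the word. Its denominator is a power of \<open>f\<close>, whence the negative twist in \<open>zeta_integral_split\<close>.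
\<close>

lemma word_difference:
  assumes V: "open V" "holo_on f V" and u: "holo_on u V"
  shows "\<exists>K. fs_section f V K \<and> (\<forall>s. \<forall>y\<in>V. f y \<noteq> 0 \<longrightarrow>
      foldr (conn f s) w u y = foldr (conn f z) w u y + (s - z) * K s y)"
proof (induction w)
  case Nil
  show ?case by (rule exI[of _ "\<lambda>_ _. 0"]) (simp add: fs_section_holo holo_on_const)
next
  case (Cons i w)
  then obtain K where K: "fs_section f V K"
    "\<And>s y. y \<in> V \<Longrightarrow> f y \<noteq> 0 \<Longrightarrow> foldr (conn f s) w u y = foldr (conn f z) w u y + (s - z) * K s y" by blast
  define A where "A = foldr (conn f z) w u"
  have A: "fs_section f V (\<lambda>_. A)" unfolding A_def
    using fs_section_eval[OF fs_section_word[OF V fs_section_holo[OF u]]] .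
  let ?K = "\<lambda>s y. conn f s i (K s) y + pd i f y * (A y / f y)"
  have sec: "fs_section f V ?K"
    by (intro fs_section_add V fs_section_conn K(1) fs_section_holo_mult holo_on_pd fs_section_divide A)
  have diff: "foldr (conn f s) (i # w) u y = foldr (conn f z) (i # w) u y + (s - z) * ?K s y"
    if y: "y \<in> V" "f y \<noteq> 0" for s y
  proof -
    have sK: "fs_section f V (\<lambda>e y. (e - z) * K e y)"
    proof -
      have "fs_section f V (\<lambda>e y. e * K e y + (- z) * K e y)"
        by (intro fs_section_add V fs_section_mult_s fs_section_holo_mult holo_on_const K(1))
      thus ?thesis by (rule fs_section_cong) (simp add: algebra_simps)
    qed
    have "foldr (conn f s) (i # w) u y = conn f s i (foldr (conn f s) w u) y" by simp
    also have "\<dots> = conn f s i (\<lambda>y. A y + (s - z) * K s y) y"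
    proof (rule conn_cong[OF open_nonzero_set[OF V]])
      show "foldr (conn f s) w u x = A x + (s - z) * K s x" if "x \<in> {y \<in> V. f y \<noteq> 0}" for x
        unfolding A_def using that by (intro K(2)) auto
    qed (use y in auto)
    also have "\<dots> = conn f s i A y + conn f s i (\<lambda>y. (s - z) * K s y) y"
      by (rule conn_add[OF V A sK y])
    also have "conn f s i (\<lambda>y. (s - z) * K s y) y = pd i (\<lambda>_. s - z) y * K s y + (s - z) * conn f s i (K s) y"
      by (rule conn_holo_mult[OF V holo_on_const K(1) y])
    also have "pd i (\<lambda>_. s - z) y = 0" by (rule pd_eqI) simp
    also have "conn f s i A y = conn f z i A y + (s - z) * (pd i f y * (A y / f y))"
      using y(2) by (simp add: conn_def field_simps)
    also have "conn f z i A y = foldr (conn f z) (i # w) u y" by (simp add: A_def)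
    finally show ?thesis by (simp add: algebra_simps)
  qed
  show ?case using sec diff by (intro exI[of _ ?K] conjI allI ballI impI)
qed

text \<open>
  The half-plane of holomorphy in \<open>zeta_functional_equation\<close> contains \<open>z\<close> once \<open>j\<close> is large; the bound
  on the multiplicities is uniform in \<open>j\<close>, so this choice costs nothing.
\<close>

lemma zeta_integral_poly_multiple:
  fixes f :: "complex^'n \<Rightarrow> complex"
  assumes X: "open X" "holo_on f X" and b: "\<And>j. j \<ge> 1 \<Longrightarrow> functional_eq X f j (b j)" "\<And>j. j \<ge> 1 \<Longrightarrow> b j \<noteq> 0"
    and \<phi>: "test_function X \<phi>" and m: "\<And>j. j \<ge> 1 \<Longrightarrow> order (z + of_int k) (b j) \<le> m"
  obtains p G r R where "p \<noteq> 0" "order z p \<le> m" "r < Re z" "G holomorphic_on {s. Re s > r}"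
    "\<And>s. Re s > R \<Longrightarrow> poly p s * zeta_integral f k l \<phi> s = G s"
proof -
  \<comment> \<open>Large enough for \<open>2 Re z + k + l + j\<close> to be positive.\<close>
  define j where "j = Suc (nat \<lceil>\<bar>2 * Re z + of_int k + of_int l\<bar>\<rceil>)"
  have j: "j \<ge> 1" by (simp add: j_def)
  have "real j > \<bar>2 * Re z + of_int k + of_int l\<bar>" unfolding j_def by linarith
  hence jz: "2 * Re z + of_int k + of_int l + real j > 0" by linarith
  obtain G R where G: "G holomorphic_on {s. 2 * Re s + of_int (k + int j) + of_int l > 0}"
    "\<And>s. Re s > R \<Longrightarrow> poly (b j) (s + of_int k) * zeta_integral f k l \<phi> s = G s"
    by (rule zeta_functional_equation[OF X b(1)[OF j] \<phi>, where k = k and l = l]) (rule that)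
  define r where "r = - (of_int k + of_int l + real j) / 2"
  have "{s. 2 * Re s + of_int (k + int j) + of_int l > 0} = {s. Re s > r}" by (auto simp: r_def field_simps)
  hence Gr: "G holomorphic_on {s. Re s > r}" using G(1) by simp
  show ?thesis
  proof (rule that[OF _ _ _ Gr])
    show "pcompose (b j) [:of_int k, 1:] \<noteq> 0" using b(2)[OF j] by (simp add: pcompose_eq_0_iff)
    show "order z (pcompose (b j) [:of_int k, 1:]) \<le> m"
      using m[OF j] by (simp add: order_pcompose_shift[OF b(2)[OF j]])
    show "r < Re z" using jz by (simp add: r_def field_simps)
    show "poly (pcompose (b j) [:of_int k, 1:]) s * zeta_integral f k l \<phi> s = G s" if "Re s > R" for s
      using G(2)[OF that] by (simp add: poly_pcompose add.commute)
  qed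
qed

lemma zeta_integral_pole_le:
  fixes f :: "complex^'n \<Rightarrow> complex"
  assumes X: "open X" "holo_on f X" and b: "\<And>j. j \<ge> 1 \<Longrightarrow> functional_eq X f j (b j)" "\<And>j. j \<ge> 1 \<Longrightarrow> b j \<noteq> 0"
    and \<phi>: "test_function X \<phi>" and m: "\<And>j. j \<ge> 1 \<Longrightarrow> order (z + of_int k) (b j) \<le> m"
  shows "has_pole_le (zeta_integral f k l \<phi>) z m"
proof -
  obtain p G r R where *: "p \<noteq> 0" "order z p \<le> m" "r < Re z" "G holomorphic_on {s. Re s > r}"
    "\<And>s. Re s > R \<Longrightarrow> poly p s * zeta_integral f k l \<phi> s = G s"
    by (rule zeta_integral_poly_multiple[where k = k and l = l and b = b, OF X b \<phi> m]) (assumption+, rule that)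
  show ?thesis by (rule has_pole_le_quotient[OF *(4,3,1,2,5)])
qed

text \<open>
  Conjugation exchanges the twists \<open>k\<close> and \<open>l\<close>, so the operators may as well act on the antiholomorphic
  factor. The point \<open>z\<close> is real, hence stays in place.
\<close>

lemma zeta_integral_pole_le_conj:
  fixes f :: "complex^'n \<Rightarrow> complex"
  assumes X: "open X" "holo_on f X" and b: "\<And>j. j \<ge> 1 \<Longrightarrow> functional_eq X f j (b j)" "\<And>j. j \<ge> 1 \<Longrightarrow> b j \<noteq> 0"
    and \<phi>: "test_function X \<phi>" and z: "cnj z = z" and m: "\<And>j. j \<ge> 1 \<Longrightarrow> order (z + of_int l) (b j) \<le> m"
  shows "has_pole_le (zeta_integral f k l \<phi>) z m"
proof -
  obtain p G r R where *: "p \<noteq> 0" "order z p \<le> m" "r < Re z" "G holomorphic_on {s. Re s > r}"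
    "\<And>s. Re s > R \<Longrightarrow> poly p s * zeta_integral f l k (\<lambda>x. cnj (\<phi> x)) s = G s"
    by (rule zeta_integral_poly_multiple[where k = l and l = k and b = b, OF X b test_function_cnj[OF \<phi>] m])
       (assumption+, rule that)
  show ?thesis
  proof (rule has_pole_le_quotient)
    have "cnj ` {s. Re s > r} = {s. Re s > r}" by (auto simp: image_iff intro!: exI[of _ "cnj _"])
    hence "G holomorphic_on cnj ` {s. Re s > r}" using *(4) by simp
    from holomorphic_on_compose_cnj_cnj[OF this open_halfspace_Re_gt]
    show "(\<lambda>s. cnj (G (cnj s))) holomorphic_on {s. Re s > r}" by (simp add: o_def)
    show "r < Re z" by fact
    show "map_poly cnj p \<noteq> 0" using *(1) by (simp add: map_poly_eq_0_iff)
    show "order z (map_poly cnj p) \<le> m" using order_map_poly_cnj_le[OF *(1), of z] *(2) z by simp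
    show "poly (map_poly cnj p) s * zeta_integral f k l \<phi> s = cnj (G (cnj s))" if "Re s > R" for s
    proof -
      have "cnj (G (cnj s)) = cnj (poly p (cnj s)) * cnj (zeta_integral f l k (\<lambda>x. cnj (\<phi> x)) (cnj s))"
        unfolding complex_cnj_mult[symmetric] using *(5)[of "cnj s"] that by (simp del: complex_cnj_mult)
      also have "cnj (zeta_integral f l k (\<lambda>x. cnj (\<phi> x)) (cnj s)) = zeta_integral f k l \<phi> s"
        by (simp add: cnj_zeta_integral)
      finally show ?thesis by simp
    qed
  qed
qed

lemma zeta_span_pole_le:
  assumes "zeta_span f V k l J" "\<And>\<psi>. test_function V \<psi> \<Longrightarrow> has_pole_le (zeta_integral f k l \<psi>) z m"
  shows "has_pole_le J z m"
proof -
  obtain d \<psi> R where \<psi>: "\<And>i. test_function V (\<psi> i)"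
    "\<And>s. Re s > R \<Longrightarrow> J s = (\<Sum>i\<le>d. s ^ i * zeta_integral f k l (\<psi> i) s)"
    by (rule zeta_spanE[OF assms(1)]) (rule that)
  have "has_pole_le (\<lambda>s. \<Sum>i\<le>d. s ^ i * zeta_integral f k l (\<psi> i) s) z m"
    by (intro has_pole_le_sum has_pole_le_mult assms(2) holomorphic_intros \<psi>(1))
  thus ?thesis by (rule has_pole_le_cong) (rule \<psi>(2))
qed

text \<open>
  Lift \<open>f\<^sup>z = P f\<^sup>z\<^sup>+\<^sup>1\<close> to \<open>f\<^sup>s = P f\<^sup>s\<^sup>+\<^sup>1 - (s - z) h(s) f\<^sup>s\<^sup>-\<^sup>N\<close> and integrate: \<open>A\<close> comes from the first
  term, where \<open>P\<close> moves to the test function, and \<open>B\<close> from the second.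
\<close>

lemma zeta_integral_split:
  fixes f :: "complex^'n \<Rightarrow> complex"
  assumes V: "open V" "holo_on f V" and P: "P \<in> diff_ops V"
    "\<And>y. y \<in> V \<Longrightarrow> f y \<noteq> 0 \<Longrightarrow> 1 = diff_act f z P f y" and \<phi>: "test_function V \<phi>"
  obtains N A B R where "zeta_span f V 1 0 A" "zeta_span f V (- int N) 0 B"
    "\<And>s. Re s > R \<Longrightarrow> zeta_integral f 0 0 \<phi> s = A s - (s - z) * B s"
proof -
  define W where "W = {w. P w \<noteq> (\<lambda>_. 0)}"
  have W: "finite W" "\<And>w. holo_on (P w) V" using P(1) by (auto simp: diff_ops_def W_def)
  have "\<forall>w. \<exists>K. fs_section f V K \<and> (\<forall>s. \<forall>y\<in>V. f y \<noteq> 0 \<longrightarrow>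
    foldr (conn f s) w f y = foldr (conn f z) w f y + (s - z) * K s y)"
    using word_difference[OF V V(2)] by blast
  from choice[OF this] obtain K where K: "\<And>w. fs_section f V (K w)"
    "\<And>w s y. y \<in> V \<Longrightarrow> f y \<noteq> 0 \<Longrightarrow> foldr (conn f s) w f y = foldr (conn f z) w f y + (s - z) * K w s y" by blast
  let ?A = "\<lambda>s y. \<Sum>w\<in>W. poly [:P w y:] s * foldr (conn f s) w (\<lambda>z. f z ^ 1) y"
  let ?K = "\<lambda>s y. \<Sum>w\<in>W. P w y * K w s y"
  have lift: "?A s y = 1 + (s - z) * ?K s y" if y: "y \<in> V" "f y \<noteq> 0" for s y
  proof -
    have "?A s y = (\<Sum>w\<in>W. P w y * foldr (conn f z) w f y) + (s - z) * ?K s y"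
      by (simp add: K(2)[OF y, of s] distrib_left sum.distrib sum_distrib_left mult_ac)
    also have "(\<Sum>w\<in>W. P w y * foldr (conn f z) w f y) = 1"
      using P(2)[OF y] by (simp add: diff_act_def W_def)
    finally show ?thesis .
  qed
  have hp: "holo_poly_on (\<lambda>y. [:P w y:]) V" for w
    using holo_poly_on_smult[OF W(2), of w 1] by simp
  have Kfs: "fs_section f V ?K" by (intro fs_section_sum V fs_section_holo_mult W(2) K(1))
  have spanA: "zeta_span f V (0 + int 1) 0 (zeta_pairing f 0 0 ?A \<phi>)"
    by (rule zeta_span_operator[OF V \<phi> hp])
  obtain N where spanK: "zeta_span f V (0 - int N) 0 (zeta_pairing f 0 0 ?K \<phi>)"
    by (rule zeta_span_fs_section[OF V \<phi> Kfs]) (rule that)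
  obtain R where R: "\<And>s. Re s > R \<Longrightarrow> integrable lborel (\<lambda>x. zeta_kernel s 0 0 (f x) * (?K (s + of_int 0) x * \<phi> x))"
    by (rule zeta_pairing_integrable[where k = 0 and l = 0, OF V \<phi> Kfs]) (rule that)
  have "zeta_integral f 0 0 \<phi> s = zeta_pairing f 0 0 ?A \<phi> s - (s - z) * zeta_pairing f 0 0 ?K \<phi> s"
    if s: "Re s > max R 0" for s
  proof -
    have i1: "integrable lborel (\<lambda>x. zeta_kernel s 0 0 (f x) * \<phi> x)"
      by (rule integrable_zeta_integral[OF V(1) holo_on_imp_continuous_on[OF V(2)] \<phi>]) (use s in simp)
    have i2: "integrable lborel (\<lambda>x. zeta_kernel s 0 0 (f x) * (?K s x * \<phi> x))"
      using R[of s] s by simp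
    have "zeta_kernel s 0 0 (f x) * (?A s x * \<phi> x)
       = zeta_kernel s 0 0 (f x) * \<phi> x + (s - z) * (zeta_kernel s 0 0 (f x) * (?K s x * \<phi> x))" for x
    proof (cases "x \<in> V \<and> f x \<noteq> 0")
      case True
      hence "?A s x = 1 + (s - z) * ?K s x" by (intro lift) simp_all
      thus ?thesis by (simp only:) (simp add: distrib_left distrib_right mult_ac)
    next
      case False
      thus ?thesis using test_function_zero_outside[OF \<phi>, of x] by auto
    qed
    hence "zeta_pairing f 0 0 ?A \<phi> s = zeta_integral f 0 0 \<phi> s + (s - z) * zeta_pairing f 0 0 ?K \<phi> s"
      unfolding zeta_pairing_def zeta_integral_def using i1 i2 by simp
    thus ?thesis by simp
  qed
  thus ?thesis using spanA spanK by (intro that[of _ N _ "max R 0"]) simp_all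
qed

text \<open>
  In \<open>zeta_integral_split\<close>, \<open>A\<close> is controlled by the roots of
  the \<open>b\<^sub>j\<close> at \<open>z + 1\<close>. For \<open>B\<close> the twist \<open>k = - N\<close> would lead to the uncontrolled roots at \<open>z - N\<close>, but the
  conjugate bound uses \<open>l = 0\<close>, that is, the roots at \<open>z\<close>.
\<close>

lemma zeta_pole_drop:
  fixes f :: "complex^'n \<Rightarrow> complex" and z :: complex
  assumes X: "open X" "holo_on f X" and z: "cnj z = z"
    and b: "\<And>j. j \<ge> 1 \<Longrightarrow> functional_eq X f j (b j)" "\<And>j. j \<ge> 1 \<Longrightarrow> b j \<noteq> 0"
    and m1: "\<And>j. j \<ge> 1 \<Longrightarrow> order (z + 1) (b j) \<le> m" and m2: "\<And>j. j \<ge> 1 \<Longrightarrow> order z (b j) \<le> Suc m"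
    and D: "(X, \<lambda>_. 1) \<in> D_submodule X f z f"
    and \<phi>: "test_function X \<phi>"
  shows "has_pole_le (zeta_integral f 0 0 \<phi>) z m"
proof -
  define Q where "Q \<phi> \<longleftrightarrow> test_function X \<phi> \<and> has_pole_le (zeta_integral f 0 0 \<phi>) z m" for \<phi>
  have "Q \<phi>"
  proof (rule test_function_localization[where X = X])
    show "test_function X \<phi>" by fact
    show "Q (\<lambda>_. 0)"
      unfolding Q_def by (intro conjI test_function_0 has_pole_le_cong[OF has_pole_le_0]) (rule zeta_integral_0)
    show "Q (\<lambda>x. \<phi> x + \<psi> x)" if "Q \<phi>" "Q \<psi>" for \<phi> \<psi>
    proof -
      have t: "test_function X \<phi>" "test_function X \<psi>" using that by (auto simp: Q_def)
      have "has_pole_le (\<lambda>s. zeta_integral f 0 0 \<phi> s + zeta_integral f 0 0 \<psi> s) z m"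
        using that by (auto simp: Q_def intro: has_pole_le_add)
      hence "has_pole_le (zeta_integral f 0 0 (\<lambda>x. \<phi> x + \<psi> x)) z m"
        by (rule has_pole_le_cong[where R = 0])
           (rule zeta_integral_add[OF X(1) holo_on_imp_continuous_on[OF X(2)] t], simp)
      thus ?thesis using test_function_add[OF t] by (simp add: Q_def)
    qed
    fix x assume "x \<in> X"
    from D have "\<forall>x\<in>X. \<exists>V. open V \<and> x \<in> V \<and> V \<subseteq> X \<and>
        (\<exists>P\<in>diff_ops V. \<forall>y\<in>V. f y \<noteq> 0 \<longrightarrow> 1 = diff_act f z P f y)"
      by (simp add: D_submodule_def)
    from bspec[OF this \<open>x \<in> X\<close>] obtain V P where V: "open V" "x \<in> V" "V \<subseteq> X" and P: "P \<in> diff_ops V"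
      "\<forall>y\<in>V. f y \<noteq> 0 \<longrightarrow> 1 = diff_act f z P f y"
      by (elim exE conjE bexE)
    have f: "holo_on f V" using X(2) V(3) by (rule holo_on_subset)
    have "Q \<phi>" if \<phi>: "test_function V \<phi>" for \<phi>
    proof -
      obtain N A B R where span: "zeta_span f V 1 0 A" "zeta_span f V (- int N) 0 B"
        and eq: "\<And>s. Re s > R \<Longrightarrow> zeta_integral f 0 0 \<phi> s = A s - (s - z) * B s"
        by (rule zeta_integral_split[OF V(1) f P(1) P(2)[rule_format] \<phi>]) (assumption+, rule that)
      have A: "has_pole_le A z m"
      proof (rule zeta_span_pole_le[OF span(1)])
        fix \<psi> assume "test_function V \<psi>"
        hence t: "test_function X \<psi>" using V(3) by (rule test_function_mono)
        show "has_pole_le (zeta_integral f 1 0 \<psi>) z m"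
          by (rule zeta_integral_pole_le[where b = b, OF X b t]) (simp_all add: m1)
      qed
      have "has_pole_le B z (Suc m)"
      proof (rule zeta_span_pole_le[OF span(2)])
        fix \<psi> assume "test_function V \<psi>"
        hence t: "test_function X \<psi>" using V(3) by (rule test_function_mono)
        show "has_pole_le (zeta_integral f (- int N) 0 \<psi>) z (Suc m)"
          by (rule zeta_integral_pole_le_conj[where b = b, OF X b t]) (simp_all add: m2 z)
      qed
      hence "has_pole_le (\<lambda>s. (-1) * ((s - z) * B s)) z m"
        by (intro has_pole_le_mult has_pole_le_lower holomorphic_intros)
      hence "has_pole_le (\<lambda>s. A s + (-1) * ((s - z) * B s)) z m"
        by (intro has_pole_le_add A)
      hence "has_pole_le (zeta_integral f 0 0 \<phi>) z m"
        by (rule has_pole_le_cong[where R = R]) (simp add: eq)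
      thus ?thesis using test_function_mono[OF \<phi> V(3)] by (simp add: Q_def)
    qed
    thus "\<exists>V. open V \<and> x \<in> V \<and> (\<forall>\<phi>. test_function V \<phi> \<longrightarrow> Q \<phi>)" using V by blast
  qed
  thus ?thesis by (simp add: Q_def)
qed

theorem corollary1p14:
  fixes X :: "(complex^'n) set" and f :: "complex^'n \<Rightarrow> complex" and \<alpha> :: rat
    and b :: "nat \<Rightarrow> complex poly"
  assumes "open X"
    and "holo_on f X"
    and non_invertible: "\<not> (\<exists>g. holo_on g X \<and> (\<forall>x\<in>X. f x * g x = 1))"
    and not_zero: "\<exists>x\<in>X. f x \<noteq> 0"
    and b_def: "\<And>j. j \<ge> 1 \<Longrightarrow> is_b_poly X f j (b j)"
    and "nu1 b (\<alpha> - 1) < nu1 b \<alpha>"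
    and "zeta_pole_order X f (- of_rat \<alpha>) = nu1 b \<alpha>"
  shows "D_submodule X f (- of_rat \<alpha>) (\<lambda>_. 1) \<noteq> D_submodule X f (- of_rat \<alpha>) f"
proof
  let ?z = "- of_rat \<alpha> :: complex"
  assume eq: "D_submodule X f ?z (\<lambda>_. 1) = D_submodule X f ?z f"
  note X = assms(1,2)
  define m where "m = nu1 b \<alpha> - 1"
  have m: "nu1 b \<alpha> = Suc m" "nu1 b (\<alpha> - 1) \<le> m" using assms(6) by (auto simp: m_def)
  have fe: "functional_eq X f j (b j)" and nz: "b j \<noteq> 0" if "j \<ge> 1" for j
    using b_def[OF that] by (auto simp: is_b_poly_def)
  \<comment> \<open>The generator lies in its own module, through the identity operator.\<close>
  have "(X, \<lambda>_. 1) \<in> D_submodule X f ?z (\<lambda>_. 1)"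
  proof -
    let ?P = "\<lambda>w. if w = [] then (\<lambda>_. 1) else (\<lambda>_. 0) :: complex^'n \<Rightarrow> complex"
    have W: "{w. ?P w \<noteq> (\<lambda>_. 0)} = {[]}" by (auto simp: fun_eq_iff)
    have "?P \<in> diff_ops X" unfolding diff_ops_def W by (auto intro: holo_on_const)
    moreover have "1 = diff_act f ?z ?P (\<lambda>_. 1) y" for y unfolding diff_act_def W by simp
    ultimately show ?thesis unfolding D_submodule_def using X(1) by blast
  qed
  hence D: "(X, \<lambda>_. 1) \<in> D_submodule X f ?z f" using eq by simp
  have pole: "pole_order (zeta X f \<phi>) ?z \<le> m" if \<phi>: "test_function X \<phi>" for \<phi>
  proof -
    have int: "(LINT x:X|lborel. complex_of_real (cmod (f x)) powr (2 * s) * \<phi> x) = zeta_integral f 0 0 \<phi> s" for s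
    proof -
      have "indicator X x *\<^sub>R (complex_of_real (cmod (f x)) powr (2 * s) * \<phi> x) = zeta_kernel s 0 0 (f x) * \<phi> x" for x
        using test_function_zero_outside[OF \<phi>, of x] by (cases "x \<in> X") (simp_all add: powr_eq_zeta_kernel)
      thus ?thesis by (simp add: set_lebesgue_integral_def zeta_integral_def)
    qed
    obtain F where "F meromorphic_on UNIV" "\<And>s. Re s > 0 \<Longrightarrow> F s = zeta_integral f 0 0 \<phi> s"
      by (rule zeta_integral_meromorphic_continuation[OF X fe nz \<phi>]) (assumption+, rule that)
    hence "\<exists>F. F meromorphic_on UNIV \<and> (\<forall>s. Re s > 0 \<longrightarrow>
        F s = (LINT x:X|lborel. complex_of_real (cmod (f x)) powr (2 * s) * \<phi> x))"
      unfolding int by blast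
    hence "zeta X f \<phi> meromorphic_on UNIV \<and> (\<forall>s. Re s > 0 \<longrightarrow>
        zeta X f \<phi> s = (LINT x:X|lborel. complex_of_real (cmod (f x)) powr (2 * s) * \<phi> x))"
      unfolding zeta_def by (rule someI_ex)
    hence zeta: "zeta X f \<phi> meromorphic_on UNIV" "\<And>s. Re s > 0 \<Longrightarrow> zeta X f \<phi> s = zeta_integral f 0 0 \<phi> s"
      unfolding int by blast+
    have "has_pole_le (zeta_integral f 0 0 \<phi>) ?z m"
    proof (rule zeta_pole_drop[OF X _ fe nz _ _ D \<phi>])
      show "cnj ?z = ?z" by (cases \<alpha>) (simp add: of_rat_rat)
      have "- of_rat (\<alpha> - 1) = ?z + 1" by (simp add: of_rat_diff)
      thus "order (?z + 1) (b j) \<le> m" if "j \<ge> 1" for j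
        using order_b_poly_le_nu1[OF X b_def that, of "\<alpha> - 1"] m(2) by simp
      show "order ?z (b j) \<le> Suc m" if "j \<ge> 1" for j
        using order_b_poly_le_nu1[OF X b_def that, of \<alpha>] m(1) by simp
    qed
    with zeta show ?thesis by (rule pole_order_le_of_has_pole_le)
  qed
  let ?S = "{pole_order (zeta X f \<phi>) ?z | \<phi>. test_function X \<phi>}"
  have "?S \<subseteq> {..m}" using pole by auto
  \<comment> \<open>\<open>Max\<close> is meaningful only for a finite nonempty set.\<close>
  moreover have "?S \<noteq> {}" using test_function_0[of X] by blast
  ultimately have "Max ?S \<le> m" by (subst Max_le_iff) (auto intro: finite_subset)
  thus False using assms(7) m(1) by (simp add: zeta_pole_order_def)
qed

end
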